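(* Let $\tau>0$ and let $\lambda_0,\lambda\in L^\infty(\mathbb{R})$. Assume that, for some constant $\alpha_0>0$, $\lambda_0(x)\ge\alpha_0$ for a.e. $x\in\mathbb{R}$, and that there exist a positive constant $\alpha$ and a function $\beta\in L^p(\mathbb{R})$, for some $1\le p<\infty$, such that $$\frac{e^\tau+1}{2}|\lambda(x)|\le\alpha+\beta(x)\quad\text{for a.e. }x\in\mathbb{R}$$ with $$0\le\alpha<\alpha_0\quad\text{and}\quad\|\beta\|_p<\Big(\frac{\alpha_0-\alpha}{c_p}\Big)^{1-\frac1{2p}},\qquad c_p:=\Big(1-\frac1{2p}\Big)\Big(\frac2p\Big)^{\frac1{2p-1}}.$$ Then the problem $$\begin{cases} u_t(x,t)+u_{xxx}(x,t)-u_{xx}(x,t)+\lambda_0(x)u(x,t)+\lambda(x)u(x,t-\tau)+u(x,t)u_x(x,t)=0 & \text{in } \mathbb{R}\times(0,\infty),\\ u(x,s)=u_0(x,s) & \text{in } \mathbb{R}\times[-\tau,0] \end{cases}$$ is exponentially stable. In particular, for every $u_0\in C([-\tau,0];L^2(\mathbb{R}))$ the solution $u$ satisfies $$\mathcal{E}(t)\le C(u_0)e^{-\gamma t}\quad\text{for all }t\ge0,$$ where $$\gamma=\min\Big\{2\Big(\alpha_0-\alpha-\frac{2p-1}{2p}\Big(\frac2p\Big)^{\frac1{2p-1}}\|\beta\|_p^{\frac{2p}{2p-1}}\Big),\,1\Big\}$$ and $$C(u_0)=\mathcal{E}(0)=\frac12\|u_0(\cdot,0)\|_2^2+\frac12\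int_{-\tau}^0e^s\int_{\mathbb{R}}|\lambda(x)|u_0^2(x,s)\,dx\,ds.$$
   Context: All functions are real-valued; $\|\cdot\|_p$ is the norm of $L^p(\mathbb{R})$. For $t\ge0$, $$\mathcal{E}(t):=\frac12\int_{\mathbb{R}}u^2(x,t)\,dx+\frac12\int_{t-\tau}^t\int_{\mathbb{R}}e^{-(t-s)}|\lambda(x)|u^2(x,s)\,dx\,ds,$$ where $u=u_0$ on $[-\tau,0]$. The operator $A_{\lambda_0}u:=-u_{xxx}+u_{xx}-\lambda_0u$, $\mathcal{D}(A_{\lambda_0})=H^3(\mathbb{R})$, generates a strongly continuous semigroup $(S(t))_{t\ge0}$ in $L^2(\mathbb{R})$ (known). For $T>0$, $\mathcal{B}_T:=C([0,T];L^2(\mathbb{R}))\cap L^2(0,T;H^1(\mathbb{R}))$. A mild solution on $[0,T]$ is a function $u\in\mathcal{B}_T$ (extended by $u=u_0$ on $[-\tau,0]$, with $u(0)=u_0(0)$) such that $$u(t)=S(t)u_0(0)-\int_0^tS(t-s)\lambda u(s-\tau)\,ds-\int_0^tS(t-s)u(s)\partial_xu(s)\,ds,\quad t\in[0,T].$$ The solution is the global mild solution, i.e. the function on $[0,\infty)$ whose restriction to every bounded interval $[0,T]$ is a mild solution on $[0,T]$; under the hypotheses above it exists and is unique. Exponentially stable means that $\mathcal{E}$ decays exponentially along all solutions: there is $\gamma>0$ such that every solution satisfies $\mathcal{E}(t)\le Ce^{-\gamma t}$ for all $t\ge0$, with $C$ depending only on the initial datum $u_0$. *)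

theory Defs
  imports "HOL-Analysis.Analysis"
begin

section \<open>The Hilbert space \<open>L\<^sup>2(\<real>)\<close>\<close>

definition square_integrable :: "(real \<Rightarrow> real) \<Rightarrow> bool" where
  "square_integrable f \<longleftrightarrow>
     f \<in> borel_measurable lebesgue \<and> integrable lebesgue (\<lambda>x. (f x)\<^sup>2)"

lemma square_integrableD:
  assumes "square_integrable f"
  shows "f \<in> borel_measurable lebesgue" "integrable lebesgue (\<lambda>x. (f x)\<^sup>2)"
  using assms by (auto simp: square_integrable_def)

lemma square_integrable_bound:
  assumes "square_integrable f" "g \<in> borel_measurable lebesgue" "AE x in lebesgue. \<bar>g x\<bar> \<le> \<bar>c * f x\<bar>"
  shows "square_integrable g"
proof -
  have "integrable lebesgue (\<lambda>x. c\<^sup>2 * (f x)\<^sup>2)"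
    using assms(1) by (simp add: square_integrable_def)
  moreover have "AE x in lebesgue. norm ((g x)\<^sup>2) \<le> norm (c\<^sup>2 * (f x)\<^sup>2)"
    using assms(3)
  proof eventually_elim
    case (elim x)
    then have "(g x)\<^sup>2 \<le> (c * f x)\<^sup>2" by (simp add: abs_le_square_iff)
    then show ?case by (simp add: power_mult_distrib)
  qed
  ultimately have "integrable lebesgue (\<lambda>x. (g x)\<^sup>2)"
    using assms(2) by (intro Bochner_Integration.integrable_bound[where g = "\<lambda>x. (g x)\<^sup>2"]
        borel_measurable_power)
  then show ?thesis using assms(2) by (simp add: square_integrable_def)
qed

lemma square_integrable_mult:
  assumes "square_integrable f" "square_integrable g"
  shows "integrable lebesgue (\<lambda>x. f x * g x)"
proof -
  note [measurable] = square_integrableD(1)[OF assms(1)] square_integrableD(1)[OF assms(2)]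
  have "integrable lebesgue (\<lambda>x. (f x)\<^sup>2 + (g x)\<^sup>2)"
    using assms by (auto simp: square_integrable_def)
  moreover have "norm (f x * g x) \<le> norm ((f x)\<^sup>2 + (g x)\<^sup>2)" for x
  proof -
    have "2 * (\<bar>f x\<bar> * \<bar>g x\<bar>) \<le> \<bar>f x\<bar>\<^sup>2 + \<bar>g x\<bar>\<^sup>2"
      using sum_squares_bound[of "\<bar>f x\<bar>" "\<bar>g x\<bar>"] by (simp add: mult.assoc)
    moreover have "0 \<le> \<bar>f x\<bar> * \<bar>g x\<bar>" by simp
    ultimately have "\<bar>f x\<bar> * \<bar>g x\<bar> \<le> (f x)\<^sup>2 + (g x)\<^sup>2" unfolding power2_abs by linarith
    then show ?thesis by (simp add: abs_mult)
  qed
  ultimately show ?thesis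
    by (intro Bochner_Integration.integrable_bound[where g = "\<lambda>x. f x * g x"]) auto
qed

lemma square_integrable_zero: "square_integrable (\<lambda>_. 0)"
  by (simp add: square_integrable_def)

lemma square_integrable_scale:
  "square_integrable f \<Longrightarrow> square_integrable (\<lambda>x. c * f x)"
  by (auto simp: square_integrable_def power_mult_distrib)

lemma square_integrable_uminus:
  "square_integrable f \<Longrightarrow> square_integrable (\<lambda>x. - f x)"
  by (auto simp: square_integrable_def)

lemma square_integrable_add:
  assumes "square_integrable f" "square_integrable g"
  shows "square_integrable (\<lambda>x. f x + g x)"
  using assms square_integrable_mult[OF assms]
  by (auto simp: square_integrable_def power2_sum mult.assoc intro!: Bochner_Integration.integrable_add)

lemma square_integrable_diff:
  assumes "square_integrable f" "square_integrable g"
  shows "square_integrable (\<lambda>x. f x - g x)"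
  using square_integrable_add[OF assms(1) square_integrable_uminus[OF assms(2)]] by simp

definition L2_rel :: "(real \<Rightarrow> real) \<Rightarrow> (real \<Rightarrow> real) \<Rightarrow> bool" where
  "L2_rel f g \<longleftrightarrow>
     square_integrable f \<and> square_integrable g \<and> (AE x in lebesgue. f x = g x)"

lemma part_equivp_L2_rel: "part_equivp L2_rel"
proof (rule part_equivpI)
  show "\<exists>f. L2_rel f f" using square_integrable_zero by (auto simp: L2_rel_def)
  show "symp L2_rel" by (auto simp: symp_def L2_rel_def eq_commute)
  show "transp L2_rel"
  proof (rule transpI)
    fix f g h assume "L2_rel f g" "L2_rel g h"
    then show "L2_rel f h" unfolding L2_rel_def by (auto elim: eventually_elim2)
  qed
qed

quotient_type L2 = "real \<Rightarrow> real" / partial: L2_rel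
  by (rule part_equivp_L2_rel)

text \<open>\<open>rep_L2 f\<close> is some representative of the class \<open>f\<close>.\<close>

lemma L2_rel_rep: "L2_rel (rep_L2 f) (rep_L2 f)"
  using Quotient3_rep_reflp[OF Quotient3_L2] .

lemma square_integrable_rep: "square_integrable (rep_L2 f)"
  using L2_rel_rep[of f] by (simp add: L2_rel_def)

lemma rep_L2_measurable [measurable]: "rep_L2 f \<in> borel_measurable lebesgue"
  using square_integrable_rep[of f] by (simp add: square_integrable_def)

lemma rep_abs_L2: "square_integrable h \<Longrightarrow> AE x in lebesgue. rep_L2 (abs_L2 h) x = h x"
  using Quotient3_rep_abs[OF Quotient3_L2, of h] by (auto simp: L2_rel_def)

lemma abs_rep_L2: "abs_L2 (rep_L2 f) = f"
  using Quotient3_abs_rep[OF Quotient3_L2] .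

lemma L2_eqI:
  assumes "AE x in lebesgue. rep_L2 f x = rep_L2 g x"
  shows "f = g"
  using assms square_integrable_rep[of f] square_integrable_rep[of g]
    Quotient3_rel_rep[OF Quotient3_L2, of f g] by (simp add: L2_rel_def)

lemma abs_L2_eqI:
  assumes "square_integrable f" "square_integrable g" "AE x in lebesgue. f x = g x"
  shows "abs_L2 f = abs_L2 g"
  using Quotient3_rel[OF Quotient3_L2, of f g] assms by (auto simp: L2_rel_def)

text \<open>The class of \<open>h\<close>, with the junk value \<open>0\<close> when \<open>h\<close> is not square integrable.\<close>

definition L2_class :: "(real \<Rightarrow> real) \<Rightarrow> L2" where
  "L2_class h = (if square_integrable h then abs_L2 h else abs_L2 (\<lambda>_. 0))"

lemma rep_L2_class: "square_integrable h \<Longrightarrow> AE x in lebesgue. rep_L2 (L2_class h) x = h x"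
  by (simp add: L2_class_def rep_abs_L2)

instantiation L2 :: real_vector
begin

lift_definition zero_L2 :: L2 is "\<lambda>_. 0"
  by (simp add: L2_rel_def square_integrable_zero)

lift_definition uminus_L2 :: "L2 \<Rightarrow> L2" is "\<lambda>f x. - f x"
  by (auto simp: L2_rel_def square_integrable_uminus)

lift_definition plus_L2 :: "L2 \<Rightarrow> L2 \<Rightarrow> L2" is "\<lambda>f g x. f x + g x"
  by (auto simp: L2_rel_def square_integrable_add elim: eventually_elim2)

lift_definition minus_L2 :: "L2 \<Rightarrow> L2 \<Rightarrow> L2" is "\<lambda>f g x. f x - g x"
  by (auto simp: L2_rel_def square_integrable_diff elim: eventually_elim2)

lift_definition scaleR_L2 :: "real \<Rightarrow> L2 \<Rightarrow> L2" is "\<lambda>c f x. c * f x"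
  by (auto simp: L2_rel_def square_integrable_scale elim: eventually_mono)

instance
  by standard
    (transfer; auto simp: L2_rel_def algebra_simps square_integrable_zero
      intro!: square_integrable_add square_integrable_diff square_integrable_scale
        square_integrable_uminus)+

end

instantiation L2 :: real_inner
begin

lift_definition inner_L2 :: "L2 \<Rightarrow> L2 \<Rightarrow> real" is "\<lambda>f g. LINT x|lebesgue. f x * g x"
proof -
  fix f f' g g' assume *: "L2_rel f f'" "L2_rel g g'"
  then have m: "f \<in> borel_measurable lebesgue" "f' \<in> borel_measurable lebesgue"
    "g \<in> borel_measurable lebesgue" "g' \<in> borel_measurable lebesgue"
    by (auto simp: L2_rel_def square_integrable_def)
  have "AE x in lebesgue. f x * g x = f' x * g' x"
    using * unfolding L2_rel_def by (auto elim: eventually_elim2)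
  then show "(LINT x|lebesgue. f x * g x) = (LINT x|lebesgue. f' x * g' x)"
    using m by (intro integral_cong_AE) auto
qed

definition norm_L2 :: "L2 \<Rightarrow> real" where "norm_L2 f = sqrt (inner f f)"
definition sgn_L2 :: "L2 \<Rightarrow> L2" where "sgn_L2 f = f /\<^sub>R norm f"
definition dist_L2 :: "L2 \<Rightarrow> L2 \<Rightarrow> real" where "dist_L2 f g = norm (f - g)"
definition uniformity_L2 :: "(L2 \<times> L2) filter" where
  "uniformity_L2 = (INF e\<in>{0 <..}. principal {(f, g). dist f g < e})"
definition open_L2 :: "L2 set \<Rightarrow> bool" where
  "open_L2 U \<longleftrightarrow> (\<forall>f\<in>U. eventually (\<lambda>(f', g). f' = f \<longrightarrow> g \<in> U) uniformity)"

instance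
proof
  fix f g h :: L2 and c :: real
  show "inner f g = inner g f" by transfer (simp add: mult.commute)
  show "inner (f + g) h = inner f h + inner g h"
    by transfer (simp add: L2_rel_def distrib_right square_integrable_mult)
  show "inner (c *\<^sub>R f) g = c * inner f g"
    by transfer (simp add: mult.assoc)
  show "0 \<le> inner f f" by transfer simp
  show "(inner f f = 0) = (f = 0)"
  proof transfer
    fix f assume "L2_rel f f"
    then have f: "square_integrable f" by (simp add: L2_rel_def)
    then have "(LINT x|lebesgue. f x * f x) = 0 \<longleftrightarrow> (AE x in lebesgue. f x * f x = 0)"
      by (intro integral_nonneg_eq_0_iff_AE) (auto simp: square_integrable_def power2_eq_square)
    then show "((LINT x|lebesgue. f x * f x) = 0) = L2_rel f (\<lambda>_. 0)"
      using f by (simp add: L2_rel_def square_integrable_zero)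
  qed
qed (rule norm_L2_def sgn_L2_def dist_L2_def uniformity_L2_def open_L2_def)+

end

lemma rep_L2_zero: "AE x in lebesgue. rep_L2 0 x = 0"
  unfolding zero_L2.abs_eq by (rule rep_abs_L2[OF square_integrable_zero])

lemma L2_class_rep: "L2_class (rep_L2 f) = f"
  by (simp add: L2_class_def square_integrable_rep abs_rep_L2)

lemma L2_class_cong:
  assumes "square_integrable f" "square_integrable g" "AE x in lebesgue. f x = g x"
  shows "L2_class f = L2_class g"
  using abs_L2_eqI[OF assms] assms(1,2) by (simp add: L2_class_def)

lemma L2_class_add:
  "square_integrable f \<Longrightarrow> square_integrable g \<Longrightarrow>
    L2_class (\<lambda>x. f x + g x) = L2_class f + L2_class g"
  by (simp add: L2_class_def square_integrable_add plus_L2.abs_eq L2_rel_def)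

lemma L2_class_diff:
  "square_integrable f \<Longrightarrow> square_integrable g \<Longrightarrow>
    L2_class (\<lambda>x. f x - g x) = L2_class f - L2_class g"
  by (simp add: L2_class_def square_integrable_diff minus_L2.abs_eq L2_rel_def)

lemma L2_class_scale:
  "square_integrable f \<Longrightarrow> L2_class (\<lambda>x. c * f x) = c *\<^sub>R L2_class f"
  by (simp add: L2_class_def square_integrable_scale scaleR_L2.abs_eq L2_rel_def)

lemma L2_class_zero: "L2_class (\<lambda>_. 0) = 0"
  by (simp add: L2_class_def zero_L2.abs_eq)

lemma rep_L2_add: "AE x in lebesgue. rep_L2 (f + g) x = rep_L2 f x + rep_L2 g x"
  using rep_L2_class[OF square_integrable_add[OF square_integrable_rep square_integrable_rep], of f g]
  by (simp add: L2_class_add square_integrable_rep L2_class_rep)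

lemma rep_L2_diff: "AE x in lebesgue. rep_L2 (f - g) x = rep_L2 f x - rep_L2 g x"
  using rep_L2_class[OF square_integrable_diff[OF square_integrable_rep square_integrable_rep], of f g]
  by (simp add: L2_class_diff square_integrable_rep L2_class_rep)

lemma rep_L2_scale: "AE x in lebesgue. rep_L2 (c *\<^sub>R f) x = c * rep_L2 f x"
  using rep_L2_class[OF square_integrable_scale[OF square_integrable_rep], of c f]
  by (simp add: L2_class_scale square_integrable_rep L2_class_rep)

lemma inner_L2_rep: "inner f g = (LINT x|lebesgue. rep_L2 f x * rep_L2 g x)"
  using inner_L2.abs_eq[OF L2_rel_rep L2_rel_rep, of f g] by (simp add: abs_rep_L2)

lemma norm_L2_rep: "(norm f)\<^sup>2 = (LINT x|lebesgue. (rep_L2 f x)\<^sup>2)"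
  by (simp only: power2_norm_eq_inner inner_L2_rep) (simp only: power2_eq_square)

lemma norm_L2_class:
  assumes "square_integrable h"
  shows "(norm (L2_class h))\<^sup>2 = (LINT x|lebesgue. (h x)\<^sup>2)"
  unfolding norm_L2_rep using rep_L2_class[OF assms] square_integrableD(1)[OF assms]
  by (intro integral_cong_AE) (auto elim!: eventually_mono)

lemma nn_norm_L2_class:
  assumes "square_integrable h"
  shows "(\<integral>\<^sup>+x. ennreal ((h x)\<^sup>2) \<partial>lebesgue) = ennreal ((norm (L2_class h))\<^sup>2)"
  unfolding norm_L2_class[OF assms]
  using assms by (intro nn_integral_eq_integral) (auto simp: square_integrable_def)

lemma square_integrable_iff_nn:
  assumes "h \<in> borel_measurable lebesgue"
  shows "square_integrable h \<longleftrightarrow> (\<integral>\<^sup>+x. ennreal ((h x)\<^sup>2) \<partial>lebesgue) < \<infinity>"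
  using assms by (auto simp: square_integrable_def integrable_iff_bounded)

subsection \<open>Completeness\<close>

instance L2 :: banach
proof
  fix X :: "nat \<Rightarrow> L2"
  assume C: "Cauchy X"
  text \<open>pass to a subsequence with summable increments\<close>
  have "\<exists>N. \<forall>m\<ge>N. \<forall>n\<ge>N. norm (X m - X n) < (1/2)^k" for k :: nat
    using C unfolding Cauchy_iff by simp
  then obtain N where N: "\<And>k m n. m \<ge> N k \<Longrightarrow> n \<ge> N k \<Longrightarrow> norm (X m - X n) < (1/2)^k"
    by metis
  define r where "r k = (\<Sum>i\<le>k. N i) + k" for k
  have rN: "r k \<ge> N k" for k
    unfolding r_def by (simp add: member_le_sum trans_le_add1)
  have sr: "strict_mono r" unfolding strict_mono_Suc_iff r_def by simp
  define y where "y k = rep_L2 (X (r k))" for k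
  have y: "square_integrable (y k)" for k by (simp add: y_def square_integrable_rep)
  have cy: "L2_class (y k) = X (r k)" for k by (simp add: y_def L2_class_rep)
  note [measurable] = square_integrableD(1)[OF y]
  have ym: "norm (X (r m) - X (r n)) < (1/2)^k" if "m \<ge> k" "n \<ge> k" for m n k
    using that rN[of k] strict_mono_leD[OF sr, of k m] strict_mono_leD[OF sr, of k n]
    by (intro N) auto
  define d where "d k x = \<bar>y (Suc k) x - y k x\<bar>" for k x
  have d: "square_integrable (d k)" for k
    unfolding d_def
    by (rule square_integrable_bound[OF square_integrable_diff[OF y[of "Suc k"] y[of k]], where c=1]) auto
  note [measurable] = square_integrableD(1)[OF d]
  have nd: "norm (L2_class (d k)) \<le> (1/2)^k" for k
  proof -
    have "(norm (L2_class (d k)))\<^sup>2 = (norm (L2_class (\<lambda>x. y (Suc k) x - y k x)))\<^sup>2"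
      unfolding norm_L2_class[OF d] norm_L2_class[OF square_integrable_diff[OF y y]] by (simp add: d_def)
    then have "norm (L2_class (d k)) = norm (X (r (Suc k)) - X (r k))"
      by (simp add: L2_class_diff[OF y y] cy)
    then show ?thesis using ym[of k "Suc k" k] by simp
  qed
  have sd: "square_integrable (\<lambda>x. \<Sum>k<n. d k x) \<and>
      norm (L2_class (\<lambda>x. \<Sum>k<n. d k x)) \<le> (\<Sum>k<n. (1/2)^k)" for n
  proof (induction n)
    case 0 show ?case by (simp add: square_integrable_zero L2_class_zero)
  next
    case (Suc n)
    then show ?case
      using norm_triangle_ineq[of "L2_class (\<lambda>x. \<Sum>k<n. d k x)" "L2_class (d n)"] nd[of n]
      by (auto simp: square_integrable_add d L2_class_add)
  qed
  have geo: "(\<Sum>k<n. (1/2::real)^k) \<le> 2" for n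
  proof -
    have "(\<Sum>k<n. (1/2::real)^k) = 2 - 2 * (1/2)^n"
      by (induction n) auto
    then show ?thesis by simp
  qed
  have bd: "(\<integral>\<^sup>+x. ennreal ((\<Sum>k<n. d k x)\<^sup>2) \<partial>lebesgue) \<le> ennreal 4" for n
  proof -
    have "norm (L2_class (\<lambda>x. \<Sum>k<n. d k x)) \<le> 2"
      using sd[of n] geo[of n] by linarith
    then have "(norm (L2_class (\<lambda>x. \<Sum>k<n. d k x)))\<^sup>2 \<le> 2\<^sup>2"
      by (intro power_mono) auto
    then show ?thesis
      unfolding nn_norm_L2_class[OF conjunct1[OF sd]] by (intro ennreal_leI) simp
  qed
  have "(\<integral>\<^sup>+x. (SUP n. ennreal ((\<Sum>k<n. d k x)\<^sup>2)) \<partial>lebesgue)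
      = (SUP n. \<integral>\<^sup>+x. ennreal ((\<Sum>k<n. d k x)\<^sup>2) \<partial>lebesgue)"
    by (rule nn_integral_monotone_convergence_SUP)
      (auto simp: incseq_def le_fun_def d_def intro!: ennreal_leI power_mono sum_mono2 sum_nonneg)
  also have "\<dots> \<le> ennreal 4" by (intro SUP_least bd)
  also have "\<dots> < \<infinity>" by simp
  finally have fin: "(\<integral>\<^sup>+x. (SUP n. ennreal ((\<Sum>k<n. d k x)\<^sup>2)) \<partial>lebesgue) \<noteq> \<infinity>" by simp
  have "AE x in lebesgue. (SUP n. ennreal ((\<Sum>k<n. d k x)\<^sup>2)) \<noteq> \<infinity>"
    by (rule nn_integral_PInf_AE) (use fin in measurable)
  then have conv: "AE x in lebesgue. convergent (\<lambda>n. y n x)"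
  proof eventually_elim
    case (elim x)
    let ?s = "SUP n. ennreal ((\<Sum>k<n. d k x)\<^sup>2)"
    obtain M where M: "?s = ennreal M" "M \<ge> 0" using elim by (cases ?s) auto
    have "(\<Sum>k<n. d k x)\<^sup>2 \<le> M" for n
    proof -
      have "ennreal ((\<Sum>k<n. d k x)\<^sup>2) \<le> ?s" by (rule SUP_upper) simp
      then show ?thesis unfolding M(1) using M(2) by (simp add: ennreal_le_iff)
    qed
    then have "(\<Sum>k<n. d k x) \<le> sqrt M" for n by (rule real_le_rsqrt)
    then have "summable (\<lambda>k. d k x)"
      by (intro summableI_nonneg_bounded[where x="sqrt M"]) (auto simp: d_def)
    then have "summable (\<lambda>k. y (Suc k) x - y k x)"
      unfolding d_def by (rule summable_rabs_cancel)
    then have "convergent (\<lambda>n. \<Sum>k<n. y (Suc k) x - y k x)"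
      by (simp add: summable_iff_convergent)
    then have "convergent (\<lambda>n. y n x - y 0 x)"
      by (simp only: sum_lessThan_telescope[of "\<lambda>n. y n x"])
    then show ?case by (simp add: convergent_diff_const_right_iff)
  qed
  define f where "f x = lim (\<lambda>n. y n x)" for x
  have [measurable]: "f \<in> borel_measurable lebesgue" unfolding f_def by measurable
  have lf: "AE x in lebesgue. (\<lambda>n. y n x) \<longlonglongrightarrow> f x"
    using conv by eventually_elim (simp add: f_def convergent_LIMSEQ_iff)
  have Fatou: "(\<integral>\<^sup>+x. ennreal ((f x - y k x)\<^sup>2) \<partial>lebesgue) \<le> ennreal (((1/2)^k)\<^sup>2)" for k
  proof -
    have "(\<integral>\<^sup>+x. ennreal ((f x - y k x)\<^sup>2) \<partial>lebesgue)
        = (\<integral>\<^sup>+x. liminf (\<lambda>n. ennreal ((y n x - y k x)\<^sup>2)) \<partial>lebesgue)"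
    proof (rule nn_integral_cong_AE)
      show "AE x in lebesgue. ennreal ((f x - y k x)\<^sup>2) = liminf (\<lambda>n. ennreal ((y n x - y k x)\<^sup>2))"
        using lf
      proof eventually_elim
        case (elim x)
        then have "(\<lambda>n. ennreal ((y n x - y k x)\<^sup>2)) \<longlonglongrightarrow> ennreal ((f x - y k x)\<^sup>2)"
          by (intro tendsto_ennrealI tendsto_intros)
        then show ?case by (rule lim_imp_Liminf[OF sequentially_bot, symmetric])
      qed
    qed
    also have "\<dots> \<le> liminf (\<lambda>n. \<integral>\<^sup>+x. ennreal ((y n x - y k x)\<^sup>2) \<partial>lebesgue)"
      by (rule nn_integral_liminf) measurable
    also have "\<dots> \<le> ennreal (((1/2)^k)\<^sup>2)"
    proof (rule Liminf_le)
      show "\<forall>\<^sub>F n in sequentially.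
          (\<integral>\<^sup>+x. ennreal ((y n x - y k x)\<^sup>2) \<partial>lebesgue) \<le> ennreal (((1/2)^k)\<^sup>2)"
        using eventually_ge_at_top[of k]
      proof eventually_elim
        case (elim n)
        have "(norm (X (r n) - X (r k)))\<^sup>2 \<le> ((1/2)^k)\<^sup>2"
          using ym[OF elim, of k] by (intro power_mono) auto
        then show ?case
          unfolding nn_norm_L2_class[OF square_integrable_diff[OF y y]]
          by (intro ennreal_leI) (simp add: L2_class_diff[OF y y] cy)
      qed
    qed simp
    finally show ?thesis .
  qed
  have sfy: "square_integrable (\<lambda>x. f x - y k x)" for k
    by (subst square_integrable_iff_nn, measurable)
      (use Fatou[of k] in \<open>auto intro: le_less_trans\<close>)
  have sf: "square_integrable f"
    using square_integrable_add[OF sfy[of 0] y[of 0]] by simp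
  have "norm (L2_class f - X (r k)) \<le> (1/2)^k" for k
  proof -
    have "ennreal ((norm (L2_class f - X (r k)))\<^sup>2) \<le> ennreal (((1/2)^k)\<^sup>2)"
      using Fatou[of k] unfolding nn_norm_L2_class[OF sfy] by (simp add: L2_class_diff[OF sf y] cy)
    then have "(norm (L2_class f - X (r k)))\<^sup>2 \<le> ((1/2)^k)\<^sup>2"
      by (simp add: ennreal_le_iff)
    then show ?thesis by (rule power2_le_imp_le) simp
  qed
  then have "(\<lambda>k. norm (X (r k) - L2_class f)) \<longlonglongrightarrow> 0"
    by (intro tendsto_sandwich[OF _ _ tendsto_const LIMSEQ_realpow_zero[of "1/2"]])
      (auto simp: norm_minus_commute)
  then have "(\<lambda>k. X (r k)) \<longlonglongrightarrow> L2_class f"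
    by (simp add: LIM_zero_iff tendsto_norm_zero_iff)
  then have "X \<longlonglongrightarrow> L2_class f"
    using Cauchy_converges_subseq[OF C sr] by (simp add: comp_def)
  then show "convergent X" by (rule convergentI)
qed

subsection \<open>Separability\<close>

text \<open>Needed for the Bochner integral and for strong measurability to coincide with Borel
  measurability.\<close>

lemma L2_class_dominated:
  assumes h: "\<And>m::nat. square_integrable (h m)" and g: "square_integrable g"
    and w: "square_integrable w" and le: "\<And>m. AE x in lebesgue. \<bar>h m x - g x\<bar> \<le> w x"
    and lim: "AE x in lebesgue. (\<lambda>m. h m x) \<longlonglongrightarrow> g x"
  shows "(\<lambda>m. L2_class (h m)) \<longlonglongrightarrow> L2_class g"
proof -
  note [measurable] = square_integrableD(1)[OF h] square_integrableD(1)[OF g]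
  have "(\<lambda>m. LINT x|lebesgue. (h m x - g x)\<^sup>2) \<longlonglongrightarrow> integral\<^sup>L lebesgue (\<lambda>x :: real. 0 :: real)"
  proof (rule integral_dominated_convergence[where w = "\<lambda>x. (w x)\<^sup>2"])
    show "integrable lebesgue (\<lambda>x. (w x)\<^sup>2)" by (rule square_integrableD(2)[OF w])
    show "AE x in lebesgue. (\<lambda>m. (h m x - g x)\<^sup>2) \<longlonglongrightarrow> 0"
      using lim
    proof eventually_elim
      case (elim x)
      then have "(\<lambda>m. (h m x - g x)\<^sup>2) \<longlonglongrightarrow> (g x - g x)\<^sup>2" by (intro tendsto_intros)
      then show ?case by simp
    qed
    show "AE x in lebesgue. norm ((h m x - g x)\<^sup>2) \<le> (w x)\<^sup>2" for m
      using le[of m]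
    proof eventually_elim
      case (elim x)
      then have "\<bar>h m x - g x\<bar>\<^sup>2 \<le> (w x)\<^sup>2" by (intro power_mono) auto
      then show ?case by simp
    qed
  qed auto
  then have "(\<lambda>m. (norm (L2_class (h m) - L2_class g))\<^sup>2) \<longlonglongrightarrow> 0"
    by (simp add: norm_L2_class[OF square_integrable_diff[OF h g]] flip: L2_class_diff[OF h g])
  then have "(\<lambda>m. sqrt ((norm (L2_class (h m) - L2_class g))\<^sup>2)) \<longlonglongrightarrow> sqrt 0"
    by (rule tendsto_real_sqrt)
  then have "(\<lambda>m. L2_class (h m) - L2_class g) \<longlonglongrightarrow> 0"
    by (simp add: tendsto_norm_zero_iff)
  then show ?thesis by (simp add: LIM_zero_iff)
qed

lemma L2_separable: "\<exists>D :: L2 set. countable D \<and> closure D = UNIV"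
proof -
  obtain B :: "real set set" where B: "countable B" "topological_basis B"
    using ex_countable_basis by blast
  define G where "G = Inter ` {b. finite b \<and> b \<subseteq> B}"
  have cG: "countable G"
    unfolding G_def by (intro countable_image countable_Collect_finite_subset B)
  have UG: "UNIV \<in> G" unfolding G_def by (rule image_eqI[of _ _ "{}"]) auto
  have BG: "B \<subseteq> G"
  proof
    fix b assume "b \<in> B"
    then show "b \<in> G" unfolding G_def by (intro image_eqI[of _ _ "{b}"]) auto
  qed
  have IG: "Int_stable G"
  proof (rule Int_stableI)
    fix a b assume "a \<in> G" "b \<in> G"
    then obtain a' b' where "a = \<Inter>a'" "b = \<Inter>b'" "finite a'" "finite b'" "a' \<subseteq> B" "b' \<subseteq> B"
      unfolding G_def by blast
    then show "a \<inter> b \<in> G" unfolding G_def by (intro image_eqI[of _ _ "a' \<union> b'"]) auto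
  qed
  have Gb: "A \<in> sets borel" if A: "A \<in> G" for A
  proof -
    obtain b where b: "A = \<Inter>b" "finite b" "b \<subseteq> B" using A unfolding G_def by blast
    have "open A" unfolding b(1) using b B(2) by (intro open_Inter) (auto dest: topological_basis_open)
    then show ?thesis by simp
  qed
  have sG: "sets (borel :: real measure) = sigma_sets UNIV G"
  proof
    show "sets (borel :: real measure) \<subseteq> sigma_sets UNIV G"
      unfolding borel_eq_countable_basis[OF B] using sigma_sets_mono'[OF BG] by simp
    show "sigma_sets UNIV G \<subseteq> sets borel"
      using sets.sigma_sets_subset[of G borel] Gb by auto
  qed

  define ind :: "real set \<Rightarrow> L2" where "ind A = L2_class (indicator A)" for A
  define I where "I n = {- real n..real n}" for n
  define step where
    "step = (\<lambda>(q :: rat, i, n). of_rat q *\<^sub>R ind (from_nat_into G i \<inter> I n))"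
  define D where "D = range (\<lambda>xs. sum_list (map step xs))"
  have cD: "countable D" unfolding D_def by simp

  have add: "x + y \<in> closure D" if x: "x \<in> closure D" and y: "y \<in> closure D" for x y
  proof -
    obtain f where f: "\<And>n. f n \<in> D" "f \<longlonglongrightarrow> x"
      using x unfolding closure_sequential by auto
    obtain g where g: "\<And>n. g n \<in> D" "g \<longlonglongrightarrow> y"
      using y unfolding closure_sequential by auto
    have "a + b \<in> D" if ab: "a \<in> D" "b \<in> D" for a b
    proof -
      obtain xs ys where "a = sum_list (map step xs)" "b = sum_list (map step ys)"
        using ab unfolding D_def by blast
      then have "a + b = sum_list (map step (xs @ ys))" by simp
      then show ?thesis unfolding D_def by blast
    qed
    then show ?thesis
      unfolding closure_sequential
      using f g by (intro exI[of _ "\<lambda>n. f n + g n"] conjI allI tendsto_add) auto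
  qed
  have scale_rat: "of_rat q *\<^sub>R x \<in> closure D" if x: "x \<in> closure D" for x q
  proof -
    obtain f where f: "\<And>n. f n \<in> D" "f \<longlonglongrightarrow> x"
      using x unfolding closure_sequential by auto
    have "of_rat q *\<^sub>R a \<in> D" if a: "a \<in> D" for a
    proof -
      obtain xs where xs: "a = sum_list (map step xs)" using a unfolding D_def by blast
      have "of_rat q *\<^sub>R sum_list (map step xs)
          = sum_list (map step (map (\<lambda>(r, i, n). (q * r, i, n)) xs))"
        by (induction xs) (auto simp: step_def scaleR_add_right of_rat_mult)
      then show ?thesis unfolding D_def xs by blast
    qed
    then show ?thesis
      unfolding closure_sequential
      using f by (intro exI[of _ "\<lambda>n. of_rat q *\<^sub>R f n"] conjI allI tendsto_scaleR tendsto_const) auto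
  qed
  have scale: "c *\<^sub>R x \<in> closure D" if x: "x \<in> closure D" for x c
  proof -
    have "\<exists>q. c < of_rat q \<and> of_rat q < c + 1 / real (Suc n)" for n
      by (rule of_rat_dense) simp
    then obtain r where r: "\<And>n. c < of_rat (r n)" "\<And>n. of_rat (r n) < c + 1 / real (Suc n)"
      by metis
    define q :: "nat \<Rightarrow> real" where "q n = of_rat (r n)" for n
    have "(\<lambda>n. c + 1 / real (Suc n)) \<longlonglongrightarrow> c + 0"
      by (intro tendsto_add tendsto_const LIMSEQ_Suc lim_1_over_n)
    then have lim: "(\<lambda>n. c + 1 / real (Suc n)) \<longlonglongrightarrow> c" by simp
    have q: "q \<longlonglongrightarrow> c"
    proof (rule tendsto_sandwich[OF _ _ tendsto_const lim])
      show "\<forall>\<^sub>F n in sequentially. c \<le> q n"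
        unfolding q_def by (intro always_eventually allI less_imp_le r)
      show "\<forall>\<^sub>F n in sequentially. q n \<le> c + 1 / real (Suc n)"
        unfolding q_def by (intro always_eventually allI less_imp_le r)
    qed
    have "q n *\<^sub>R x \<in> closure D" for n
      unfolding q_def by (rule scale_rat[OF x])
    moreover have "(\<lambda>n. q n *\<^sub>R x) \<longlonglongrightarrow> c *\<^sub>R x" by (intro tendsto_scaleR q tendsto_const)
    ultimately show ?thesis by (rule closed_sequentially[OF closed_closure])
  qed
  have zero: "0 \<in> closure D"
  proof -
    have "sum_list (map step []) \<in> D" unfolding D_def by (rule rangeI)
    then show ?thesis using closure_subset[of D] by auto
  qed
  have diff: "x - y \<in> closure D" if "x \<in> closure D" "y \<in> closure D" for x y
    using add[OF that(1) scale[OF that(2), of "-1"]] by simp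
  have sum: "(\<Sum>i\<in>F. f i) \<in> closure D" if "finite F" "\<And>i. i \<in> F \<Longrightarrow> f i \<in> closure D"
    for F :: "'i set" and f
    using that by (induction F rule: finite_induct) (auto simp: zero add)

  have leb: "indicator A \<in> borel_measurable lebesgue" if "A \<in> sets borel" for A :: "real set"
    using that by (intro borel_measurable_indicator) auto
  have siI: "square_integrable (indicator (A \<inter> I n))" if "A \<in> sets borel" for A n
  proof -
    have "I n \<inter> A \<in> lmeasurable"
      using that unfolding I_def
      by (intro fmeasurable_Int_fmeasurable lmeasurable_interval) auto
    then have "A \<inter> I n \<in> lmeasurable" by (simp add: Int_commute)
    then have "integrable lebesgue (indicator (A \<inter> I n) :: real \<Rightarrow> real)"
      unfolding fmeasurable_def by (auto intro: integrable_real_indicator)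
    moreover have "(\<lambda>x. (indicator (A \<inter> I n) x :: real)\<^sup>2) = indicator (A \<inter> I n)"
      by (auto simp: indicator_def)
    ultimately show ?thesis
      using leb[of "A \<inter> I n"] that by (simp add: square_integrable_def I_def)
  qed
  have GU: "G \<subseteq> Pow UNIV" by simp
  have indI: "ind (A \<inter> I n) \<in> closure D" if A: "A \<in> sets borel" for A n
    using IG GU A[unfolded sG]
  proof (induction rule: sigma_sets_induct_disjoint)
    case (basic A)
    obtain i where "from_nat_into G i = A" using from_nat_into_surj[OF cG basic] by blast
    then have "ind (A \<inter> I n) = sum_list (map step [(1, i, n)])" by (simp add: step_def)
    then have "ind (A \<inter> I n) \<in> D" unfolding D_def by blast
    then show ?case using closure_subset by blast
  next
    case empty
    have "(indicator {} :: real \<Rightarrow> real) = (\<lambda>_. 0)" by auto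
    then show ?case by (simp add: ind_def L2_class_zero zero)
  next
    case (compl A)
    then have A: "A \<in> sets borel" unfolding sG by blast
    obtain i where "from_nat_into G i = UNIV" using from_nat_into_surj[OF cG UG] by blast
    then have "ind (UNIV \<inter> I n) = sum_list (map step [(1, i, n)])" by (simp add: step_def)
    then have "ind (UNIV \<inter> I n) \<in> D" unfolding D_def by blast
    then have U: "ind (UNIV \<inter> I n) \<in> closure D" using closure_subset by blast
    have "indicator ((UNIV - A) \<inter> I n) = (\<lambda>x. indicator (UNIV \<inter> I n) x - indicator (A \<inter> I n) x :: real)"
      by (auto simp: indicator_def)
    then have "ind ((UNIV - A) \<inter> I n) = ind (UNIV \<inter> I n) - ind (A \<inter> I n)"
      unfolding ind_def using L2_class_diff[OF siI[of UNIV n] siI[OF A, of n]] by simp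
    then show ?case using diff[OF U compl(2)] by simp
  next
    case (union A)
    have A: "A i \<in> sets borel" for i using union(2) unfolding sG by blast
    have "(\<lambda>m. ind ((\<Union>i<m. A i) \<inter> I n)) \<longlonglongrightarrow> ind ((\<Union>i. A i) \<inter> I n)"
      unfolding ind_def
    proof (rule L2_class_dominated)
      show "square_integrable (indicator (UNIV \<inter> I n))" by (rule siI) simp
      have U: "(\<Union>i<m. A i) \<in> sets borel" "(\<Union>i. A i) \<in> sets borel" for m
        using A by (auto intro!: sets.countable_UN')
      show "square_integrable (indicator ((\<Union>i<m. A i) \<inter> I n))" for m
        by (rule siI[OF U(1)])
      show "square_integrable (indicator ((\<Union>i. A i) \<inter> I n))"
        by (rule siI[OF U(2)])
      show "AE x in lebesgue. \<bar>indicator ((\<Union>i<m. A i) \<inter> I n) x - indicator ((\<Union>i. A i) \<inter> I n) x\<bar>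
          \<le> (indicator (UNIV \<inter> I n) x :: real)" for m
        by (auto simp: indicator_def)
      show "AE x in lebesgue. (\<lambda>m. indicator ((\<Union>i<m. A i) \<inter> I n) x :: real)
          \<longlonglongrightarrow> indicator ((\<Union>i. A i) \<inter> I n) x"
      proof (rule AE_I2)
        fix x
        have "(\<lambda>m. indicator ((\<Union>i<m. A i)) x :: real) \<longlonglongrightarrow> indicator ((\<Union>i. A i)) x"
          by (rule LIMSEQ_indicator_UN)
        then have "(\<lambda>m. indicator ((\<Union>i<m. A i)) x * indicator (I n) x :: real)
            \<longlonglongrightarrow> indicator ((\<Union>i. A i)) x * indicator (I n) x"
          by (intro tendsto_mult tendsto_const)
        then show "(\<lambda>m. indicator ((\<Union>i<m. A i) \<inter> I n) x :: real)
          \<longlonglongrightarrow> indicator ((\<Union>i. A i) \<inter> I n) x"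
          by (simp only: indicator_inter_arith)
      qed
    qed
    moreover have "ind ((\<Union>i<m. A i) \<inter> I n) = (\<Sum>i<m. ind (A i \<inter> I n))" for m
    proof (induction m)
      case 0
      have "(indicator {} :: real \<Rightarrow> real) = (\<lambda>_. 0)" by auto
      then show ?case by (simp add: ind_def L2_class_zero)
    next
      case (Suc m)
      have d: "A m \<inter> (\<Union>i<m. A i) = {}"
      proof -
        have "A m \<inter> A i = {}" if "i < m" for i
          using disjoint_family_onD[OF union(1), of m i] that by simp
        then show ?thesis by blast
      qed
      have "indicator ((\<Union>i<Suc m. A i) \<inter> I n)
          = (\<lambda>x. indicator ((\<Union>i<m. A i) \<inter> I n) x + indicator (A m \<inter> I n) x :: real)"
      proof
        fix x
        show "indicator ((\<Union>i<Suc m. A i) \<inter> I n) x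
          = (indicator ((\<Union>i<m. A i) \<inter> I n) x + indicator (A m \<inter> I n) x :: real)"
          using d unfolding lessThan_Suc by (auto simp: indicator_def)
      qed
      moreover have "(\<Union>i<m. A i) \<in> sets borel" using A by auto
      ultimately have "ind ((\<Union>i<Suc m. A i) \<inter> I n) = ind ((\<Union>i<m. A i) \<inter> I n) + ind (A m \<inter> I n)"
        unfolding ind_def using L2_class_add[OF siI siI, of "\<Union>i<m. A i" "A m" n n] A by simp
      then show ?case using Suc by simp
    qed
    ultimately have "(\<lambda>m. \<Sum>i<m. ind (A i \<inter> I n)) \<longlonglongrightarrow> ind ((\<Union>i. A i) \<inter> I n)" by simp
    then show ?case
      by (rule closed_sequentially[OF closed_closure, rotated]) (auto intro: sum union(3))
  qed
  have ind: "ind A \<in> closure D" if A: "A \<in> sets borel" "square_integrable (indicator A)" for A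
  proof -
    have "(\<lambda>n. ind (A \<inter> I n)) \<longlonglongrightarrow> ind A"
      unfolding ind_def
    proof (rule L2_class_dominated)
      show "AE x in lebesgue. (\<lambda>n. indicator (A \<inter> I n) x) \<longlonglongrightarrow> (indicator A x :: real)"
      proof (rule AE_I2)
        fix x :: real
        have "\<forall>\<^sub>F n in sequentially. indicator (A \<inter> I n) x = (indicator A x :: real)"
          using eventually_ge_at_top[of "nat \<lceil>\<bar>x\<bar>\<rceil>"]
        proof eventually_elim
          case (elim n)
          then have "\<bar>x\<bar> \<le> real n" by linarith
          then have "x \<in> I n" by (auto simp: I_def)
          then show ?case by (simp add: indicator_def)
        qed
        then show "(\<lambda>n. indicator (A \<inter> I n) x) \<longlonglongrightarrow> (indicator A x :: real)"
          by (rule tendsto_eventually)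
      qed
      show "AE x in lebesgue. \<bar>indicator (A \<inter> I n) x - indicator A x\<bar> \<le> (indicator A x :: real)" for n
        by (auto simp: indicator_def)
    qed (rule siI[OF A(1)] A(2))+
    then show ?thesis
      by (rule closed_sequentially[OF closed_closure, rotated]) (auto intro: indI A)
  qed
  have "F \<in> closure D" for F
  proof -
    obtain g where g: "g \<in> borel_measurable lborel" "AE x in lborel. rep_L2 F x = g x"
      using completion_ex_borel_measurable_real[OF rep_L2_measurable, of F] by blast
    have gl: "g \<in> borel_measurable lebesgue" using g(1) by (simp add: measurable_completion)
    have AEg: "AE x in lebesgue. rep_L2 F x = g x" by (rule AE_completion[OF g(2)])
    have sg: "square_integrable g"
      by (rule square_integrable_bound[OF square_integrable_rep[of F] gl, where c=1])
        (use AEg in auto)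
    have F: "F = L2_class g"
      using L2_class_cong[OF square_integrable_rep sg AEg] by (simp add: L2_class_rep)
    obtain s where s: "\<And>i. simple_function lborel (s i)" "\<And>x. (\<lambda>i. s i x) \<longlonglongrightarrow> g x"
      "\<And>i x. \<bar>s i x\<bar> \<le> 2 * \<bar>g x\<bar>"
      using borel_measurable_implies_sequence_metric[OF g(1), of 0] by (auto simp: dist_real_def)
    have sm: "s i \<in> borel_measurable lebesgue" for i
      using borel_measurable_simple_function[OF s(1)] by (simp add: measurable_completion)
    have ss: "square_integrable (s i)" for i
      by (rule square_integrable_bound[OF sg sm, where c=2]) (use s(3) in \<open>auto simp: abs_mult\<close>)
    have "L2_class (s i) \<in> closure D" for i
    proof -
      have fin: "finite (range (s i))" using simple_functionD(1)[OF s(1)[of i]] by simp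
      have lev: "s i -` {y} \<in> sets borel" for y
        using simple_functionD(2)[OF s(1)[of i], of "{y}"] by simp
      have sil: "square_integrable (indicator (s i -` {y}))" if "y \<noteq> 0" for y
        by (rule square_integrable_bound[OF ss[of i] leb[OF lev], where c="1 / y"])
          (use that in \<open>auto simp: indicator_def\<close>)
      define \<phi> where "\<phi> y x = y * indicator (s i -` {y}) x" for y x :: real
      have \<phi>: "square_integrable (\<phi> y)" "L2_class (\<phi> y) \<in> closure D" if "y \<noteq> 0" for y
        unfolding \<phi>_def
        using sil[OF that] scale[OF ind[OF lev sil[OF that]], of y]
        by (auto simp: square_integrable_scale L2_class_scale ind_def)
      have "square_integrable (\<lambda>x. \<Sum>y\<in>R. \<phi> y x) \<and> L2_class (\<lambda>x. \<Sum>y\<in>R. \<phi> y x) \<in> closure D"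
        if "finite R" "0 \<notin> R" for R
        using that
      proof (induction R rule: finite_induct)
        case empty show ?case by (simp add: square_integrable_zero L2_class_zero zero)
      next
        case (insert y R)
        then show ?case by (auto simp: square_integrable_add L2_class_add add \<phi>)
      qed
      from this[of "range (s i) - {0}"]
      have "L2_class (\<lambda>x. \<Sum>y\<in>range (s i) - {0}. \<phi> y x) \<in> closure D"
        using fin by simp
      moreover have "(\<Sum>y\<in>range (s i) - {0}. \<phi> y x) = s i x" for x
      proof -
        have "(\<Sum>y\<in>range (s i) - {0}. \<phi> y x) = (\<Sum>y\<in>range (s i). \<phi> y x)"
          using fin by (intro sum.mono_neutral_left) (auto simp: \<phi>_def)
        also have "\<dots> = (\<Sum>y\<in>range (s i). if y = s i x then y else 0)"
          by (intro sum.cong) (auto simp: \<phi>_def indicator_def)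
        also have "\<dots> = s i x" using fin by (simp add: sum.delta)
        finally show ?thesis .
      qed
      ultimately show ?thesis by simp
    qed
    moreover have "(\<lambda>i. L2_class (s i)) \<longlonglongrightarrow> L2_class g"
    proof (rule L2_class_dominated[OF ss sg, where w = "\<lambda>x. 3 * \<bar>g x\<bar>"])
      show "square_integrable (\<lambda>x. 3 * \<bar>g x\<bar>)"
        by (rule square_integrable_bound[OF sg, where c=3]) (use gl in auto)
      show "AE x in lebesgue. \<bar>s i x - g x\<bar> \<le> 3 * \<bar>g x\<bar>" for i
      proof (rule AE_I2)
        fix x show "\<bar>s i x - g x\<bar> \<le> 3 * \<bar>g x\<bar>" using s(3)[of i x] by linarith
      qed
    qed (use s(2) in auto)
    ultimately show ?thesis unfolding F by (rule closed_sequentially[OF closed_closure])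
  qed
  then show ?thesis using cD by blast
qed

instance L2 :: second_countable_topology
proof
  obtain D :: "L2 set" where D: "countable D" "closure D = UNIV" using L2_separable by blast
  define B where "B = (\<lambda>(d, n). ball d (1 / Suc n)) ` (D \<times> (UNIV :: nat set))"
  have "topological_basis B"
  proof (rule topological_basisI)
    show "open b" if "b \<in> B" for b using that by (auto simp: B_def)
    fix U and x :: L2 assume "open U" "x \<in> U"
    then obtain e where e: "e > 0" "ball x e \<subseteq> U" using open_contains_ball by blast
    obtain n :: nat where n: "1 / Suc n < e / 2" using e(1) nat_approx_posE[of "e / 2"] by auto
    have "x \<in> closure D" using D(2) by simp
    moreover have "0 < 1 / real (Suc n)" by simp
    ultimately obtain d where d: "d \<in> D" "dist d x < 1 / Suc n"
      unfolding closure_approachable by blast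
    have "ball d (1 / Suc n) \<subseteq> ball x e"
    proof
      fix z assume "z \<in> ball d (1 / Suc n)"
      then show "z \<in> ball x e"
        using dist_triangle[of x z d] d(2) n by (simp add: dist_commute del: of_nat_Suc)
    qed
    then show "\<exists>b\<in>B. x \<in> b \<and> b \<subseteq> U"
      using d e(2) by (intro bexI[of _ "ball d (1 / Suc n)"]) (auto simp: B_def)
  qed
  moreover have "countable B" unfolding B_def using D(1) by auto
  ultimately show "\<exists>B :: L2 set set. countable B \<and> open = generate_topology B"
    using topological_basis_imp_subbasis by blast
qed


section \<open>Lebesgue and Sobolev spaces on the real line\<close>

definition L_infty :: "(real \<Rightarrow> real) \<Rightarrow> bool" where
  "L_infty f \<longleftrightarrow> f \<in> borel_measurable lebesgue \<and> (\<exists>M. AE x in lebesgue. \<bar>f x\<bar> \<le> M)"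

definition L_p :: "real \<Rightarrow> (real \<Rightarrow> real) \<Rightarrow> bool" where
  "L_p p f \<longleftrightarrow> f \<in> borel_measurable lebesgue \<and> integrable lebesgue (\<lambda>x. \<bar>f x\<bar> powr p)"

definition L_p_norm :: "real \<Rightarrow> (real \<Rightarrow> real) \<Rightarrow> real" where
  "L_p_norm p f = (LINT x|lebesgue. \<bar>f x\<bar> powr p) powr (1 / p)"

definition test_function :: "(real \<Rightarrow> real) \<Rightarrow> bool" where
  "test_function \<phi> \<longleftrightarrow>
     (\<forall>k x. (deriv ^^ k) \<phi> differentiable (at x)) \<and> (\<exists>R. \<forall>x. \<bar>x\<bar> > R \<longrightarrow> \<phi> x = 0)"

definition has_weak_deriv :: "nat \<Rightarrow> L2 \<Rightarrow> L2 \<Rightarrow> bool" where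
  "has_weak_deriv k f g \<longleftrightarrow>
     (\<forall>\<phi>. test_function \<phi> \<longrightarrow>
        (LINT x|lebesgue. rep_L2 f x * (deriv ^^ k) \<phi> x)
          = (-1) ^ k * (LINT x|lebesgue. rep_L2 g x * \<phi> x))"

text \<open>Weak derivatives in \<open>L\<^sup>2\<close> are unique; \<open>weak_deriv k f\<close> is meaningful only when one
  exists.\<close>

definition weak_deriv :: "nat \<Rightarrow> L2 \<Rightarrow> L2" where
  "weak_deriv k f = (THE g. has_weak_deriv k f g)"

definition sobolev :: "nat \<Rightarrow> L2 set" where
  "sobolev k = {f. \<forall>j\<le>k. \<exists>g. has_weak_deriv j f g}"

text \<open>Pointwise products. The junk value of \<open>L2_class\<close> does not interfere: \<open>a \<cdot> f\<close> is square
  integrable for \<open>a \<in> L\<^sup>\<infinity>\<close>, and so is \<open>f \<partial>\<^sub>x f\<close> for \<open>f \<in> H\<^sup>1 \<subseteq> L\<^sup>\<infinity>\<close>.\<close>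

definition mult_fun :: "(real \<Rightarrow> real) \<Rightarrow> L2 \<Rightarrow> L2" where
  "mult_fun a f = L2_class (\<lambda>x. a x * rep_L2 f x)"

definition mult_L2 :: "L2 \<Rightarrow> L2 \<Rightarrow> L2" where
  "mult_L2 f g = L2_class (\<lambda>x. rep_L2 f x * rep_L2 g x)"

section \<open>Strongly continuous semigroups\<close>

definition C0_semigroup :: "(real \<Rightarrow> 'a::real_normed_vector \<Rightarrow> 'a) \<Rightarrow> bool" where
  "C0_semigroup S \<longleftrightarrow>
     (\<forall>t\<ge>0. bounded_linear (S t)) \<and>
     S 0 = id \<and>
     (\<forall>s\<ge>0. \<forall>t\<ge>0. S (s + t) = S s \<circ> S t) \<and>
     (\<forall>f. ((\<lambda>t. S t f) \<longlongrightarrow> f) (at_right 0))"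

text \<open>The operator \<open>A\<close> with domain \<open>D\<close> generates \<open>S\<close>: the right derivative of \<open>S\<close> at \<open>0\<close> exists
  precisely on \<open>D\<close> and equals \<open>A\<close> there.\<close>

definition generates :: "('a::real_normed_vector \<Rightarrow> 'a) \<Rightarrow> 'a set \<Rightarrow> (real \<Rightarrow> 'a \<Rightarrow> 'a) \<Rightarrow> bool" where
  "generates A D S \<longleftrightarrow>
     C0_semigroup S \<and>
     (\<forall>f g. ((\<lambda>h. (S h f - f) /\<^sub>R h) \<longlongrightarrow> g) (at_right 0) \<longleftrightarrow> f \<in> D \<and> g = A f)"

section \<open>The damped KdV--Burgers equation with delay\<close>

definition kdvb_operator :: "(real \<Rightarrow> real) \<Rightarrow> L2 \<Rightarrow> L2" where
  "kdvb_operator lam\<^sub>0 f = - weak_deriv 3 f + weak_deriv 2 f - mult_fun lam\<^sub>0 f"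

text \<open>\<open>C([0,T]; L\<^sup>2) \<inter> L\<^sup>2(0,T; H\<^sup>1)\<close>. The space \<open>H\<^sup>1\<close> embeds isometrically as a closed subspace of
  \<open>L\<^sup>2 \<times> L\<^sup>2\<close> via \<open>f \<mapsto> (f, \<partial>\<^sub>x f)\<close>, so measurability into \<open>H\<^sup>1\<close> means measurability of both
  components; that of the first one follows from continuity.\<close>

definition B_space :: "real \<Rightarrow> (real \<Rightarrow> L2) set" where
  "B_space T = {u. continuous_on {0..T} u \<and>
     (AE t in lebesgue_on {0..T}. u t \<in> sobolev 1) \<and>
     (\<lambda>t. weak_deriv 1 (u t)) \<in> borel_measurable (lebesgue_on {0..T}) \<and>
     integrable (lebesgue_on {0..T}) (\<lambda>t. (norm (u t))\<^sup>2 + (norm (weak_deriv 1 (u t)))\<^sup>2)}"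

text \<open>Solutions are functions of time with values in \<open>L\<^sup>2\<close>, already extended by the initial datum
  to \<open>[-\<tau>,0]\<close>; their values at times before \<open>-\<tau>\<close> are irrelevant.\<close>

definition mild_solution ::
    "(real \<Rightarrow> L2 \<Rightarrow> L2) \<Rightarrow> real \<Rightarrow> (real \<Rightarrow> real) \<Rightarrow> (real \<Rightarrow> L2) \<Rightarrow> real \<Rightarrow> (real \<Rightarrow> L2) \<Rightarrow> bool" where
  "mild_solution S \<tau> lam u\<^sub>0 T u \<longleftrightarrow>
     (\<forall>s\<in>{-\<tau>..0}. u s = u\<^sub>0 s) \<and>
     u \<in> B_space T \<and>
     (\<forall>t\<in>{0..T}.
        u t = S t (u\<^sub>0 0)
          - (LINT s|lebesgue_on {0..t}. S (t - s) (mult_fun lam (u (s - \<tau>))))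
          - (LINT s|lebesgue_on {0..t}. S (t - s) (mult_L2 (u s) (weak_deriv 1 (u s)))))"

definition global_mild_solution ::
    "(real \<Rightarrow> L2 \<Rightarrow> L2) \<Rightarrow> real \<Rightarrow> (real \<Rightarrow> real) \<Rightarrow> (real \<Rightarrow> L2) \<Rightarrow> (real \<Rightarrow> L2) \<Rightarrow> bool" where
  "global_mild_solution S \<tau> lam u\<^sub>0 u \<longleftrightarrow> (\<forall>T>0. mild_solution S \<tau> lam u\<^sub>0 T u)"

definition energy :: "real \<Rightarrow> (real \<Rightarrow> real) \<Rightarrow> (real \<Rightarrow> L2) \<Rightarrow> real \<Rightarrow> real" where
  "energy \<tau> lam u t =
     1 / 2 * (LINT x|lebesgue. (rep_L2 (u t) x)\<^sup>2)
     + 1 / 2 * (LINT s|lebesgue_on {t - \<tau>..t}.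
         LINT x|lebesgue. exp (- (t - s)) * \<bar>lam x\<bar> * (rep_L2 (u s) x)\<^sup>2)"

definition exponentially_stable ::
    "(real \<Rightarrow> L2 \<Rightarrow> L2) \<Rightarrow> real \<Rightarrow> (real \<Rightarrow> real) \<Rightarrow> bool" where
  "exponentially_stable S \<tau> lam \<longleftrightarrow>
     (\<exists>\<gamma>>0. \<forall>u\<^sub>0. continuous_on {-\<tau>..0} u\<^sub>0 \<longrightarrow>
        (\<exists>C. \<forall>u. global_mild_solution S \<tau> lam u\<^sub>0 u \<longrightarrow>
           (\<forall>t\<ge>0. energy \<tau> lam u t \<le> C * exp (- \<gamma> * t))))"

definition c_const :: "real \<Rightarrow> real" where
  "c_const p = (1 - 1 / (2 * p)) * (2 / p) powr (1 / (2 * p - 1))"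

definition decay_rate :: "real \<Rightarrow> real \<Rightarrow> real \<Rightarrow> (real \<Rightarrow> real) \<Rightarrow> real" where
  "decay_rate \<alpha>\<^sub>0 \<alpha> p \<beta> =
     min (2 * (\<alpha>\<^sub>0 - \<alpha> - (2 * p - 1) / (2 * p) * (2 / p) powr (1 / (2 * p - 1))
                          * L_p_norm p \<beta> powr (2 * p / (2 * p - 1)))) 1"

definition initial_energy :: "real \<Rightarrow> (real \<Rightarrow> real) \<Rightarrow> (real \<Rightarrow> L2) \<Rightarrow> real" where
  "initial_energy \<tau> lam u\<^sub>0 =
     1 / 2 * (norm (u\<^sub>0 0))\<^sup>2
     + 1 / 2 * (LINT s|lebesgue_on {-\<tau>..0}.
         exp s * (LINT x|lebesgue. \<bar>lam x\<bar> * (rep_L2 (u\<^sub>0 s) x)\<^sup>2))"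

end

theory Submission
  imports Defs
begin

text \<open>
  The proof makes rigorous the formal computation \<open>E' \<le> -\<gamma> E\<close> for the energy \<open>E\<close>. Pair
  the equation with \<open>u\<close>. The dispersive and the Burgers term contribute nothing, the second
  derivative contributes \<open>-\<parallel>u\<^sub>x\<parallel>\<^sup>2\<close>, and Young's inequality bounds the delay term by
  \<open>(e\<^sup>\<tau>/2) \<integral>|lam| u(t)\<^sup>2 + (e\<^sup>-\<^sup>\<tau>/2) \<integral>|lam| u(t-\<tau>)\<^sup>2\<close>. The derivative of the history part of the
  energy is \<open>(1/2) \<integral>|lam| u(t)\<^sup>2 - (e\<^sup>-\<^sup>\<tau>/2) \<integral>|lam| u(t-\<tau>)\<^sup>2\<close> minus that part itself. In the sum the
  delayed terms cancel and the weight \<open>(e\<^sup>\<tau> + 1)/2\<close> of \<open>|lam| u\<^sup>2\<close> is the one that the theorem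
  bounds by \<open>\<alpha> + \<beta>\<close>.

  It remains to absorb \<open>\<integral>|\<beta>| u\<^sup>2\<close> in \<open>\<parallel>u\<^sub>x\<parallel>\<^sup>2\<close>, which is \<open>weighted_L2_embedding\<close>: it rests on the
  sup bound \<open>u\<^sup>2 \<le> 2 \<parallel>u\<parallel> \<parallel>u\<^sub>x\<parallel>\<close> and Young's inequality with the optimal parameter, and produces the
  constant in the decay rate. The coercivity estimate \<open>kdvb_operator_dissipative\<close> on \<open>H\<^sup>3\<close>
  collects all this.

  A mild solution does not take values in \<open>H\<^sup>3\<close>, so it cannot be paired with the equation directly.
  Averaging it in time by the semigroup, \<open>h\<^sup>-\<^sup>1 \<integral>\<^sub>0\<^sup>h S(r) u(t) dr\<close>, moves it into the domain of the
  generator, where \<open>regularized_energy_identity\<close> and the coercivity estimate hold. In the estimate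
  so obtained every term is continuous in \<open>L\<^sup>2\<close>, and \<open>h \<rightarrow> 0\<close> yields \<open>mild_energy_inequality\<close>.
  The same averages show that the semigroup is contractive, once it is locally bounded by the uniform
  boundedness principle.

  The facts on Sobolev functions come from \<open>du_Bois_Reymond\<close>, which provides absolutely continuous
  representatives, and from \<open>integral_inner_by_parts\<close>, one application of Fubini that serves both as the
  product rule in space and as the energy identity in time. Finally \<open>integral_Gronwall_decay\<close> turns
  the integrated inequality into exponential decay.
\<close>

section \<open>Integrals over compact intervals\<close>

lemma integrable_subinterval_lebesgue_on:
  fixes f :: "real \<Rightarrow> 'b::{banach,second_countable_topology}"
  assumes "integrable (lebesgue_on {a..b}) f" "a \<le> c" "d \<le> b"
  shows "integrable (lebesgue_on {c..d}) f"
proof -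
  have "set_integrable lebesgue {a..b} f"
    using assms(1) by (simp add: integrable_restrict_space set_integrable_def)
  then have "set_integrable lebesgue {c..d} f"
    by (rule set_integrable_subset) (use assms in auto)
  then show ?thesis by (simp add: integrable_restrict_space set_integrable_def)
qed

lemma integral_lebesgue_on_indicator:
  fixes f :: "real \<Rightarrow> 'b::{banach,second_countable_topology}"
  assumes "a \<le> c" "d \<le> b"
  shows "(LINT x|lebesgue_on {c..d}. f x) = (LINT x|lebesgue_on {a..b}. indicator {c..d} x *\<^sub>R f x)"
  using assms by (auto simp: integral_restrict_space set_lebesgue_integral_def indicator_def intro!: Bochner_Integration.integral_cong)

lemma integral_lebesgue_on_combine:
  fixes f :: "real \<Rightarrow> 'b::{banach,second_countable_topology}"
  assumes f: "integrable (lebesgue_on {a..c}) f" and "a \<le> b" "b \<le> c"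
  shows "(LINT x|lebesgue_on {a..c}. f x) = (LINT x|lebesgue_on {a..b}. f x) + (LINT x|lebesgue_on {b..c}. f x)"
proof -
  have S: "set_integrable lebesgue {a..b} f" "set_integrable lebesgue {b..c} f"
    using integrable_subinterval_lebesgue_on[OF f, of a b] integrable_subinterval_lebesgue_on[OF f, of b c] assms
    by (auto simp: integrable_restrict_space set_integrable_def)
  have "AE x in lebesgue. x \<noteq> b"
    using AE_not_in[of "{b}" lebesgue] by simp
  then have "AE x in lebesgue. \<not> (x \<in> {a..b} \<and> x \<in> {b..c})" by eventually_elim auto
  then have "set_lebesgue_integral lebesgue ({a..b} \<union> {b..c}) f
     = set_lebesgue_integral lebesgue {a..b} f + set_lebesgue_integral lebesgue {b..c} f"
    by (rule set_integral_Un_AE) (use S in auto)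
  moreover have "{a..b} \<union> {b..c} = {a..c}" using assms by auto
  ultimately show ?thesis by (simp add: integral_restrict_space set_lebesgue_integral_def)
qed

lemma continuous_bounded_on_Icc:
  fixes f :: "real \<Rightarrow> 'b::real_normed_vector"
  assumes "continuous_on {a..b} f"
  obtains R where "\<And>s. s \<in> {a..b} \<Longrightarrow> norm (f s) \<le> R"
proof -
  have "compact (f ` {a..b})" by (rule compact_continuous_image[OF assms]) simp
  then have "bounded (f ` {a..b})" by (rule compact_imp_bounded)
  then obtain R where "\<forall>y\<in>f ` {a..b}. norm y \<le> R" unfolding bounded_iff by (rule exE)
  then show ?thesis by (intro that[of R]) simp
qed

lemma continuous_imp_Bochner_integrable:
  fixes f :: "real \<Rightarrow> 'b::{banach,second_countable_topology}"
  assumes c: "continuous_on {a..b} f"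
  shows "integrable (lebesgue_on {a..b}) f"
proof -
  obtain R where R: "\<And>s. s \<in> {a..b} \<Longrightarrow> norm (f s) \<le> R"
    using continuous_bounded_on_Icc[OF c] by blast
  have m: "f \<in> borel_measurable (lebesgue_on {a..b})"
    by (rule continuous_imp_measurable_on_sets_lebesgue[OF c]) simp
  interpret finite_measure "lebesgue_on {a..b}" by (rule finite_measure_lebesgue_on) simp
  show ?thesis by (rule integrable_const_bound[OF _ m, of R]) (auto intro!: AE_I2 R)
qed

text \<open>The product of two indefinite integrals is a double integral over a square; Fubini on the two
  triangles below and above the diagonal gives the two summands. For real functions this is the product rule for absolutely
  continuous functions, which Sobolev functions in space rely on; with values in \<open>L\<^sup>2\<close> and
  \<open>k = g\<close> it is the energy identity in time.\<close>

lemma integral_inner_by_parts: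
  fixes g k :: "real \<Rightarrow> 'b::{banach,second_countable_topology,real_inner}"
    and v w :: 'b
  assumes g: "integrable (lebesgue_on {a..b}) g" and k: "integrable (lebesgue_on {a..b}) k"
  defines "V \<equiv> \<lambda>s. v + (LINT x|lebesgue_on {a..s}. g x)"
    and "W \<equiv> \<lambda>s. w + (LINT x|lebesgue_on {a..s}. k x)"
  assumes "a \<le> b"
  shows "integrable (lebesgue_on {a..b}) (\<lambda>s. inner (g s) (W s))"
    and "integrable (lebesgue_on {a..b}) (\<lambda>s. inner (V s) (k s))"
    and "inner (V b) (W b) = inner v w + (LINT s|lebesgue_on {a..b}. inner (g s) (W s))
      + (LINT s|lebesgue_on {a..b}. inner (V s) (k s))"
proof -
  define N where "N = lebesgue_on {a..b}"
  have spN: "space N = {a..b}" by (simp add: N_def)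
  interpret N: finite_measure N unfolding N_def by (rule finite_measure_lebesgue_on) simp
  interpret NN: pair_sigma_finite N N ..
  have [measurable]: "(\<lambda>x. x) \<in> borel_measurable N" 
    unfolding N_def using id_borel_measurable_lebesgue_on[of "{a..b}"] by (simp add: id_def)
  have gN: "integrable N g" and kN: "integrable N k" using g k by (auto simp: N_def)
  have [measurable]: "g \<in> borel_measurable N" "k \<in> borel_measurable N"
    using gN kN by auto
  define Wi where "Wi s = (LINT y|lebesgue_on {a..s}. k y)" for s
  define Vi where "Vi s = (LINT y|lebesgue_on {a..s}. g y)" for s
  have restr: "(LINT x|lebesgue_on {a..s}. f x) = (LINT x|N. indicator {..s} x *\<^sub>R f x)"
    if "s \<in> {a..b}" for s and f :: "real \<Rightarrow> 'b"
  proof -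
    have "(LINT x|lebesgue_on {a..s}. f x) = (LINT x|N. indicator {a..s} x *\<^sub>R f x)"
      unfolding N_def using that by (intro integral_lebesgue_on_indicator) auto
    also have "\<dots> = (LINT x|N. indicator {..s} x *\<^sub>R f x)"
      by (intro Bochner_Integration.integral_cong) (auto simp: spN indicator_def)
    finally show ?thesis .
  qed
  have ind: "integrable N (\<lambda>x. indicator A x *\<^sub>R f x)" if "integrable N f" "A \<in> sets borel"
    for f :: "real \<Rightarrow> 'b" and A
  proof -
    note [measurable] = that(2) borel_measurable_integrable[OF that(1)]
    show ?thesis
      by (rule Bochner_Integration.integrable_bound[OF that(1)]) (auto simp: indicator_def)
  qed
  have prodint: "integrable (N \<Otimes>\<^sub>M N) (\<lambda>(x,y). norm (p x) * norm (q y))"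
    if "integrable N p" "integrable N q" for p q :: "real \<Rightarrow> 'b"
    by (rule NN.Fubini_integrable) (use that in \<open>auto simp: abs_mult intro!: borel_measurable_times\<close>)
  have F: "integrable (N \<Otimes>\<^sub>M N) (\<lambda>(x,y). inner (g x) (k y))"
    by (rule Bochner_Integration.integrable_bound[OF prodint[OF gN kN]])
      (auto simp: Cauchy_Schwarz_ineq2)
  have bnd: "\<bar>indicator A z * inner p q\<bar> \<le> norm p * norm q" for A :: "(real \<times> real) set" and z and p q :: 'b
    using Cauchy_Schwarz_ineq2[of p q] by (auto simp: indicator_def)
  have setm[measurable]: "{z \<in> space (N \<Otimes>\<^sub>M N). fst z \<le> snd z} \<in> sets (N \<Otimes>\<^sub>M N)"
    "{z \<in> space (N \<Otimes>\<^sub>M N). snd z \<le> fst z} \<in> sets (N \<Otimes>\<^sub>M N)" by measurable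
  have F1: "integrable (N \<Otimes>\<^sub>M N) (\<lambda>(x,y). indicator {z. fst z \<le> snd z} (x,y) * inner (g x) (k y))"
    by (rule Bochner_Integration.integrable_bound[OF prodint[OF gN kN]])
      (auto simp: bnd indicator_def Cauchy_Schwarz_ineq2 intro!: borel_measurable_times)
  have F2: "integrable (N \<Otimes>\<^sub>M N) (\<lambda>(x,y). indicator {z. snd z \<le> fst z} (x,y) * inner (g x) (k y))"
    by (rule Bochner_Integration.integrable_bound[OF prodint[OF gN kN]])
      (auto simp: bnd indicator_def Cauchy_Schwarz_ineq2 intro!: borel_measurable_times)
  have in1: "(LINT x|N. indicator {z. fst z \<le> snd z} (x,y) * inner (g x) (k y)) = inner (Vi y) (k y)"
    if "y \<in> {a..b}" for y
  proof -
    have "inner (Vi y) (k y) = (LINT x|N. inner (indicator {..y} x *\<^sub>R g x) (k y))"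
      unfolding Vi_def restr[OF that] by (rule integral_inner_left[symmetric]) (rule ind[OF gN], simp)
    then show ?thesis by (auto simp: indicator_def intro!: Bochner_Integration.integral_cong)
  qed
  have in2: "(LINT y|N. indicator {z. snd z \<le> fst z} (x,y) * inner (g x) (k y)) = inner (g x) (Wi x)"
    if "x \<in> {a..b}" for x
  proof -
    have "inner (g x) (Wi x) = (LINT y|N. inner (g x) (indicator {..x} y *\<^sub>R k y))"
      unfolding Wi_def restr[OF that] by (rule integral_inner_right[symmetric]) (rule ind[OF kN], simp)
    then show ?thesis by (auto simp: indicator_def intro!: Bochner_Integration.integral_cong)
  qed
  have I1: "integrable N (\<lambda>y. inner (Vi y) (k y))"
    using NN.integrable_snd[OF F1] by (rule Bochner_Integration.integrable_cong[THEN iffD1, rotated -1])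
      (auto simp: in1 spN)
  have I2: "integrable N (\<lambda>x. inner (g x) (Wi x))"
    using NN.integrable_fst[OF F2] by (rule Bochner_Integration.integrable_cong[THEN iffD1, rotated -1])
      (auto simp: in2 spN)
  have gi: "integrable N (\<lambda>x. inner (g x) w)" and ki: "integrable N (\<lambda>x. inner v (k x))"
    using gN kN by auto
  show "integrable (lebesgue_on {a..b}) (\<lambda>s. inner (g s) (W s))"
    using Bochner_Integration.integrable_add[OF gi I2] by (simp add: N_def W_def Wi_def inner_add_right)
  show "integrable (lebesgue_on {a..b}) (\<lambda>s. inner (V s) (k s))"
    using Bochner_Integration.integrable_add[OF ki I1] by (simp add: N_def V_def Vi_def inner_add_left)
  \<comment> \<open>the two closed triangles share the diagonal, all of whose sections are null sets\<close>
  have "AE y in N. (LINT x|N. inner (g x) (k y)) =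
     (LINT x|N. indicator {z. fst z \<le> snd z} (x,y) * inner (g x) (k y)) + (LINT x|N. indicator {z. snd z \<le> fst z} (x,y) * inner (g x) (k y))"
  proof (rule AE_I2)
    fix y assume y: "y \<in> space N"
    have gy: "integrable N (\<lambda>x. inner (g x) (k y))" using gN by simp
    have "AE x in lebesgue. x \<noteq> y"
      using AE_not_in[of "{y}" lebesgue] by simp
    then have "AE x in N. x \<noteq> y" unfolding N_def by (subst AE_restrict_space_iff) auto
    then have "(LINT x|N. inner (g x) (k y)) = (LINT x|N. indicator {z. fst z \<le> snd z} (x,y) * inner (g x) (k y) + indicator {z. snd z \<le> fst z} (x,y) * inner (g x) (k y))"
      by (intro integral_cong_AE) (auto elim!: eventually_mono simp: indicator_def)
    also have "\<dots> = (LINT x|N. indicator {z. fst z \<le> snd z} (x,y) * inner (g x) (k y)) + (LINT x|N. indicator {z. snd z \<le> fst z} (x,y) * inner (g x) (k y))"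
      by (intro Bochner_Integration.integral_add Bochner_Integration.integrable_bound[OF gy])
       (auto simp: indicator_def)
    finally show "(LINT x|N. inner (g x) (k y)) =
     (LINT x|N. indicator {z. fst z \<le> snd z} (x,y) * inner (g x) (k y)) + (LINT x|N. indicator {z. snd z \<le> fst z} (x,y) * inner (g x) (k y))" .
  qed
  then have "(LINT y|N. LINT x|N. inner (g x) (k y)) = (LINT y|N. 
     (LINT x|N. indicator {z. fst z \<le> snd z} (x,y) * inner (g x) (k y)) + (LINT x|N. indicator {z. snd z \<le> fst z} (x,y) * inner (g x) (k y)))"
    by (intro integral_cong_AE borel_measurable_integrable NN.integrable_snd[OF F] Bochner_Integration.integrable_add NN.integrable_snd[OF F1] NN.integrable_snd[OF F2])
  also have "\<dots> = (LINT y|N. LINT x|N. indicator {z. fst z \<le> snd z} (x,y) * inner (g x) (k y)) + 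
     (LINT y|N. LINT x|N. indicator {z. snd z \<le> fst z} (x,y) * inner (g x) (k y))"
    by (intro Bochner_Integration.integral_add NN.integrable_snd[OF F1] NN.integrable_snd[OF F2])
  also have "(LINT y|N. LINT x|N. indicator {z. snd z \<le> fst z} (x,y) * inner (g x) (k y)) =
    (LINT x|N. LINT y|N. indicator {z. snd z \<le> fst z} (x,y) * inner (g x) (k y))"
    by (rule NN.Fubini_integral[OF F2])
  also have "\<dots> = (LINT x|N. inner (g x) (Wi x))"
    by (intro Bochner_Integration.integral_cong) (auto simp: in2 spN)
  also have "(LINT y|N. LINT x|N. indicator {z. fst z \<le> snd z} (x,y) * inner (g x) (k y)) = (LINT y|N. inner (Vi y) (k y))"
    by (intro Bochner_Integration.integral_cong) (auto simp: in1 spN)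
  also have "(LINT y|N. LINT x|N. inner (g x) (k y)) = inner (LINT x|N. g x) (LINT y|N. k y)"
    using gN kN by simp
  finally have main: "inner (Vi b) (Wi b) = (LINT y|N. inner (Vi y) (k y)) + (LINT x|N. inner (g x) (Wi x))"
    by (simp add: Vi_def Wi_def N_def)
  have "(LINT s|N. inner (g s) (W s)) = (LINT s|N. inner (g s) w) + (LINT s|N. inner (g s) (Wi s))"
    unfolding W_def Wi_def[symmetric] inner_add_right by (rule Bochner_Integration.integral_add[OF gi I2])
  moreover have "(LINT s|N. inner (V s) (k s)) = (LINT s|N. inner v (k s)) + (LINT s|N. inner (Vi s) (k s))"
    unfolding V_def Vi_def[symmetric] inner_add_left by (rule Bochner_Integration.integral_add[OF ki I1])
  moreover have "(LINT s|N. inner (g s) w) = inner (Vi b) w" "(LINT s|N. inner v (k s)) = inner v (Wi b)"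
    using gN kN by (simp_all add: Vi_def Wi_def N_def)
  ultimately show "inner (V b) (W b) = inner v w + (LINT s|lebesgue_on {a..b}. inner (g s) (W s))
      + (LINT s|lebesgue_on {a..b}. inner (V s) (k s))"
    unfolding N_def[symmetric] V_def W_def Vi_def[symmetric] Wi_def[symmetric]
    using main by (simp add: inner_add_left inner_add_right)
qed

section \<open>Bump functions\<close>

text \<open>The functions \<open>P(1/y) e\<^sup>-\<^sup>1\<^sup>/\<^sup>y\<close> with a polynomial \<open>P\<close>, extended by zero, form a family
  closed under differentiation; this makes \<open>e\<^sup>-\<^sup>1\<^sup>/\<^sup>y\<close> smooth on the whole line.\<close>

definition flat_exp :: "real poly \<Rightarrow> real \<Rightarrow> real" where
  "flat_exp P y = (if y > 0 then poly P (1 / y) * exp (- 1 / y) else 0)"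

lemma poly_times_exp_minus_tendsto_zero: "((\<lambda>y. poly P y * exp (- y)) \<longlongrightarrow> (0::real)) at_top"
proof -
  have *: "((\<lambda>y. y ^ k * exp (- y)) \<longlongrightarrow> (0::real)) at_top" for k
    using tendsto_power_div_exp_0[of k] by (simp add: exp_minus divide_inverse)
  have "((\<lambda>y. \<Sum>i\<le>degree P. coeff P i * (y ^ i * exp (- y))) \<longlongrightarrow> (\<Sum>i\<le>degree P. coeff P i * 0)) at_top"
    by (intro tendsto_sum tendsto_mult tendsto_const *)
  then show ?thesis by (simp add: poly_altdef sum_distrib_right mult.assoc)
qed

lemma flat_exp_tendsto_zero: "(flat_exp P \<longlongrightarrow> 0) (at_right 0)"
proof -
  have "((\<lambda>y. poly P (inverse y) * exp (- inverse y)) \<longlongrightarrow> (0::real)) (at_right 0)"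
    using filterlim_compose[OF poly_times_exp_minus_tendsto_zero filterlim_inverse_at_top_right] .
  then show ?thesis
    by (rule Lim_transform_eventually)
      (auto simp: flat_exp_def eventually_at_filter divide_inverse)
qed

text \<open>Away from the origin this is the product rule. At the origin the difference quotient is again a
  function of the family, and exponential decay beats every power of \<open>1/y\<close>.\<close>

lemma flat_exp_has_derivative:
  "(flat_exp P has_real_derivative flat_exp ([:0, 0, 1:] * (P - pderiv P)) y) (at y)"
proof -
  consider "y > 0" | "y < 0" | "y = 0" by linarith
  then show ?thesis
  proof cases
    case 1
    have "((\<lambda>y. poly P (1 / y) * exp (- 1 / y)) has_real_derivative
        flat_exp ([:0, 0, 1:] * (P - pderiv P)) y) (at y)"
      using 1 by (auto intro!: derivative_eq_intros simp: flat_exp_def field_simps power2_eq_square)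
    then show ?thesis
      by (rule has_field_derivative_transform_within_open[where S="{0<..}"])
        (use 1 in \<open>auto simp: flat_exp_def\<close>)
  next
    case 2
    have "((\<lambda>y. 0) has_real_derivative flat_exp ([:0, 0, 1:] * (P - pderiv P)) y) (at y)"
      using 2 by (auto simp: flat_exp_def)
    then show ?thesis
      by (rule has_field_derivative_transform_within_open[where S="{..<0}"])
        (use 2 in \<open>auto simp: flat_exp_def\<close>)
  next
    case 3
    have "((\<lambda>h. (flat_exp P (0 + h) - flat_exp P 0) / h) \<longlongrightarrow> 0) (at 0)"
      unfolding filterlim_at_split
    proof
      show "((\<lambda>h. (flat_exp P (0 + h) - flat_exp P 0) / h) \<longlongrightarrow> 0) (at_left 0)"
        by (rule tendsto_eventually) (auto simp: eventually_at_filter flat_exp_def)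
      show "((\<lambda>h. (flat_exp P (0 + h) - flat_exp P 0) / h) \<longlongrightarrow> 0) (at_right 0)"
        by (rule Lim_transform_eventually[OF flat_exp_tendsto_zero[of "[:0, 1:] * P"]])
          (auto simp: flat_exp_def eventually_at_filter divide_inverse)
    qed
    then have "(flat_exp P has_real_derivative 0) (at 0)" by (simp add: DERIV_def)
    then show ?thesis using 3 by (simp add: flat_exp_def)
  qed
qed

text \<open>Composing with a polynomial \<open>q\<close> produces factors \<open>q'\<close>; the coefficients \<open>r\<close> absorb
  them, so the span is closed under differentiation and its members are smooth.\<close>

inductive_set bump_span :: "real poly \<Rightarrow> (real \<Rightarrow> real) set" for q where
  base: "(\<lambda>x. poly r x * flat_exp P (poly q x)) \<in> bump_span q"
| add: "f \<in> bump_span q \<Longrightarrow> g \<in> bump_span q \<Longrightarrow> (\<lambda>x. f x + g x) \<in> bump_span q"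

lemma bump_span_deriv:
  assumes "f \<in> bump_span q"
  obtains g where "g \<in> bump_span q" "\<And>x. (f has_real_derivative g x) (at x)"
proof -
  have "\<exists>g\<in>bump_span q. \<forall>x. (f has_real_derivative g x) (at x)"
    using assms
  proof induction
    case (base r P)
    define P' where "P' = [:0, 0, 1:] * (P - pderiv P)"
    have "((\<lambda>x. flat_exp P (poly q x)) has_real_derivative
        flat_exp P' (poly q x) * poly (pderiv q) x) (at x)" for x
      unfolding P'_def by (rule DERIV_chain2[OF flat_exp_has_derivative poly_DERIV])
    then have "((\<lambda>x. poly r x * flat_exp P (poly q x)) has_real_derivative
        poly (pderiv r) x * flat_exp P (poly q x) + poly (r * pderiv q) x * flat_exp P' (poly q x)) (at x)" for x
      by (auto intro!: derivative_eq_intros)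
    moreover have "(\<lambda>x. poly (pderiv r) x * flat_exp P (poly q x) + poly (r * pderiv q) x * flat_exp P' (poly q x)) \<in> bump_span q"
      by (intro bump_span.intros)
    ultimately show ?case by (auto intro: bexI[rotated])
  next
    case (add f g)
    then obtain f' g' where "f' \<in> bump_span q" "g' \<in> bump_span q"
      "\<And>x. (f has_real_derivative f' x) (at x)" "\<And>x. (g has_real_derivative g' x) (at x)" by blast
    then show ?case
      by (intro bexI[of _ "\<lambda>x. f' x + g' x"]) (auto intro!: bump_span.intros derivative_intros)
  qed
  then show ?thesis using that by blast
qed

lemma bump_span_higher_deriv: "f \<in> bump_span q \<Longrightarrow> (deriv ^^ k) f \<in> bump_span q"
proof (induction k)
  case (Suc k)
  then obtain g where "g \<in> bump_span q" "\<And>x. ((deriv ^^ k) f has_real_derivative g x) (at x)"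
    using bump_span_deriv by blast
  moreover from this have "deriv ((deriv ^^ k) f) = g" by (auto intro: DERIV_imp_deriv)
  ultimately show ?case by simp
qed auto

text \<open>The argument is positive exactly for \<open>a < x < b\<close>, and it tends to infinity there as \<open>n\<close>
  grows, so the bumps tend boundedly to the indicator of the interval.\<close>

definition bump :: "real \<Rightarrow> real \<Rightarrow> nat \<Rightarrow> real \<Rightarrow> real" where
  "bump a b n x = flat_exp 1 (real (Suc n) * ((x - a) * (b - x)))"

lemma mult_pos_iff_between:
  fixes a b x :: real
  assumes "a < b"
  shows "0 < (x - a) * (b - x) \<longleftrightarrow> a < x \<and> x < b"
  using assms by (auto simp: zero_less_mult_iff)

lemma bump_outside: "a < b \<Longrightarrow> x \<notin> {a<..<b} \<Longrightarrow> bump a b n x = 0"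
  using mult_pos_iff_between[of a b x] by (auto simp: bump_def flat_exp_def zero_less_mult_iff)

lemma bump_inside: "a < b \<Longrightarrow> x \<in> {a<..<b} \<Longrightarrow> bump a b n x = exp (- 1 / (real (Suc n) * ((x - a) * (b - x))))"
  using mult_pos_iff_between[of a b x] by (auto simp: bump_def flat_exp_def zero_less_mult_iff)

lemma bump_nonneg: "0 \<le> bump a b n x"
  by (simp add: bump_def flat_exp_def)

lemma bump_le: "a < b \<Longrightarrow> bump a b n x \<le> indicator {a<..<b} x"
proof (cases "x \<in> {a<..<b}")
  case True
  assume "a < b"
  then have "0 \<le> real (Suc n) * ((x - a) * (b - x))" using True by (intro mult_nonneg_nonneg) auto
  then show ?thesis using True bump_inside[OF \<open>a<b\<close> True] by simp
qed (simp add: bump_outside)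

lemma bump_tendsto:
  assumes "a < b"
  shows "(\<lambda>n. bump a b n x) \<longlonglongrightarrow> indicator {a<..<b} x"
proof (cases "x \<in> {a<..<b}")
  case True
  define c where "c = (x - a) * (b - x)"
  have "c > 0" using True by (simp add: c_def)
  have "(\<lambda>n. - (1 / c) * (1 / real (Suc n))) \<longlonglongrightarrow> - (1 / c) * 0"
    by (intro tendsto_intros LIMSEQ_Suc lim_1_over_n)
  then have "(\<lambda>n. exp (- (1 / c) * (1 / real (Suc n)))) \<longlonglongrightarrow> exp 0"
    by (intro tendsto_exp) simp
  moreover have "bump a b n x = exp (- (1 / c) * (1 / real (Suc n)))" for n
    unfolding bump_inside[OF assms True] c_def[symmetric] by (simp add: mult.commute)
  ultimately show ?thesis using True by simp
qed (simp add: bump_outside[OF assms])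

lemma test_function_bump:
  assumes "a < b"
  shows "test_function (bump a b n)"
proof -
  define q where "q = smult (real (Suc n)) ([:- a, 1:] * [:b, - 1:])"
  have "(\<lambda>x. poly 1 x * flat_exp 1 (poly q x)) \<in> bump_span q" by (rule bump_span.base)
  moreover have "(\<lambda>x. poly 1 x * flat_exp 1 (poly q x)) = bump a b n"
    by (rule ext) (simp add: bump_def q_def algebra_simps)
  ultimately have "bump a b n \<in> bump_span q" by simp
  then have "(deriv ^^ k) (bump a b n) differentiable at x" for k x
    using bump_span_deriv[OF bump_span_higher_deriv] by (metis real_differentiable_def)
  moreover have "bump a b n x = 0" if "\<bar>x\<bar> > \<bar>a\<bar> + \<bar>b\<bar>" for x
    by (rule bump_outside[OF assms]) (use that in auto)
  ultimately show ?thesis unfolding test_function_def by blast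
qed

lemma test_functionD:
  assumes "test_function \<phi>"
  shows "(\<phi> has_real_derivative deriv \<phi> x) (at x)" "test_function (deriv \<phi>)"
    "continuous_on A \<phi>" "\<phi> \<in> borel_measurable borel"
proof -
  from assms obtain R where *: "\<And>k x. (deriv ^^ k) \<phi> differentiable (at x)" and R: "\<And>x. \<bar>x\<bar> > R \<Longrightarrow> \<phi> x = 0"
    unfolding test_function_def by blast
  show d: "(\<phi> has_real_derivative deriv \<phi> x) (at x)" for x
    using *[of 0 x] by (simp add: DERIV_deriv_iff_real_differentiable)
  have "deriv \<phi> x = 0" if "\<bar>x\<bar> > R" for x
  proof (rule DERIV_imp_deriv)
    have "open {x. \<bar>x\<bar> > R}" by (intro open_Collect_less continuous_intros)
    then show "(\<phi> has_real_derivative 0) (at x)"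
      by (rule has_field_derivative_transform_within_open[where f="\<lambda>_. 0", OF DERIV_const])
        (use that R in auto)
  qed
  moreover have "(deriv ^^ k) (deriv \<phi>) differentiable (at x)" for k x
    using *[of "Suc k" x] by (simp add: funpow_swap1)
  ultimately show "test_function (deriv \<phi>)" unfolding test_function_def by blast
  show c: "continuous_on A \<phi>" for A
    using d by (meson DERIV_continuous continuous_at_imp_continuous_on)
  show "\<phi> \<in> borel_measurable borel" by (rule borel_measurable_continuous_onI[OF c])
qed

lemma test_function_bounded_support:
  assumes "test_function \<phi>"
  obtains R where "R > 0" "\<And>x. x \<notin> {-R..R} \<Longrightarrow> \<phi> x = 0"
proof -
  from assms obtain R where R: "\<And>x. \<bar>x\<bar> > R \<Longrightarrow> \<phi> x = 0"
    unfolding test_function_def by blast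
  show ?thesis by (rule that[of "\<bar>R\<bar> + 1"]) (auto intro!: R)
qed

lemma test_function_bounded:
  assumes "test_function \<phi>"
  obtains M where "\<And>x. \<bar>\<phi> x\<bar> \<le> M"
proof -
  obtain R where R: "\<And>x. x \<notin> {-R..R} \<Longrightarrow> \<phi> x = 0"
    using test_function_bounded_support[OF assms] by metis
  have "compact (\<phi> ` {-R..R})"
    by (intro compact_continuous_image test_functionD(3)[OF assms]) auto
  then obtain M where M: "\<And>x. x \<in> {-R..R} \<Longrightarrow> \<bar>\<phi> x\<bar> \<le> M" "M > 0"
    using compact_imp_bounded bounded_pos by (metis image_eqI real_norm_def)
  show ?thesis by (rule that[of M]) (use M R in force)
qed

lemma test_functionI:
  assumes "\<And>x. (\<eta> has_real_derivative \<phi> x) (at x)" "test_function \<phi>" "\<And>x. \<bar>x\<bar> > R \<Longrightarrow> \<eta> x = 0"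
  shows "test_function \<eta>"
proof -
  have d: "deriv \<eta> = \<phi>" using assms(1) by (auto intro: DERIV_imp_deriv)
  have "(deriv ^^ k) \<eta> differentiable at x" for k x
  proof (cases k)
    case 0
    then show ?thesis using assms(1) real_differentiable_def by auto
  next
    case (Suc j)
    then show ?thesis using assms(2) by (simp add: funpow_swap1 d test_function_def)
  qed
  then show ?thesis using assms(3) unfolding test_function_def by blast
qed

lemma test_function_diff_scale:
  assumes "test_function \<phi>" "test_function \<psi>"
  shows "test_function (\<lambda>x. \<phi> x - c * \<psi> x)"
proof -
  have eq: "(deriv ^^ k) (\<lambda>x. \<phi> x - c * \<psi> x) = (\<lambda>x. (deriv ^^ k) \<phi> x - c * (deriv ^^ k) \<psi> x)" for k
  proof (induction k)
    case (Suc k)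
    have "((deriv ^^ k) \<phi> has_real_derivative deriv ((deriv ^^ k) \<phi>) x) (at x)"
      "((deriv ^^ k) \<psi> has_real_derivative deriv ((deriv ^^ k) \<psi>) x) (at x)" for x
      using assms unfolding test_function_def by (auto simp: DERIV_deriv_iff_real_differentiable)
    then show ?case unfolding funpow.simps comp_def Suc
      by (intro ext DERIV_imp_deriv DERIV_diff DERIV_cmult) auto
  qed auto
  obtain R1 R2 where R: "\<And>x. x \<notin> {-R1..R1} \<Longrightarrow> \<phi> x = 0" "\<And>x. x \<notin> {-R2..R2} \<Longrightarrow> \<psi> x = 0"
    using test_function_bounded_support assms by metis
  have "\<phi> x - c * \<psi> x = 0" if "\<bar>x\<bar> > max R1 R2" for x
  proof -
    have "x \<notin> {-R1..R1}" "x \<notin> {-R2..R2}" using that by auto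
    then show ?thesis by (simp add: R)
  qed
  moreover have "(deriv ^^ k) (\<lambda>x. \<phi> x - c * \<psi> x) differentiable at x" for k x
    unfolding eq using assms unfolding test_function_def by (intro derivative_intros) auto
  ultimately show ?thesis unfolding test_function_def by blast
qed

section \<open>The fundamental lemma of the calculus of variations\<close>

text \<open>On each \<open>[-n, n]\<close> the positive and the negative part of \<open>h\<close> are densities of finite
  measures with the same mass on every half-line, hence of the same measure, so they coincide almost
  everywhere; being parts of one function, both vanish. A Borel representative of \<open>h\<close> is used
  because measures on the line are determined by half-lines only on the Borel sets.\<close>

lemma zero_on_intervals_imp_AE_zero:
  fixes h :: "real \<Rightarrow> real"
  assumes li: "\<And>a b. integrable (lebesgue_on {a..b}) h"
    and zero: "\<And>a b. a < b \<Longrightarrow> (LINT x|lebesgue_on {a..b}. h x) = 0"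
  shows "AE x in lebesgue. h x = 0"
proof -
  have "AE x in lebesgue. x \<in> {- real n..real n} \<longrightarrow> h x = 0" for n
  proof -
    define I where "I = {- real n..real n}"
    define hI where "hI x = indicator I x * h x" for x
    have hI: "integrable lebesgue hI"
      using li[of "- real n" "real n"] by (simp add: integrable_restrict_space set_integrable_def hI_def[abs_def] I_def)
    then have "hI \<in> borel_measurable (completion lborel)" by simp
    then obtain h' where h'[measurable]: "h' \<in> borel_measurable lborel" and AEh: "AE x in lborel. hI x = h' x"
      using completion_ex_borel_measurable_real by blast
    have AEh': "AE x in lebesgue. hI x = h' x" by (rule AE_completion[OF AEh])
    have "integrable lebesgue h'"
      by (rule integrable_cong_AE_imp[OF hI]) (use AEh' in \<open>auto simp: measurable_completion elim: eventually_mono\<close>)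
    then have ih: "integrable lborel h'" by (simp add: integrable_completion)
    have tail0: "(LINT x|lborel. indicator {c<..} x * h' x) = 0" for c
    proof -
      have "(LINT x|lborel. indicator {c<..} x * h' x) = (LINT x|lebesgue. indicator {c<..} x * h' x)"
        by (rule integral_completion[symmetric]) simp
      also have "\<dots> = (LINT x|lebesgue. indicator {max c (- real n)..real n} x * h x)"
      proof (rule integral_cong_AE)
        have "AE x in lebesgue. x \<noteq> c" using AE_not_in[of "{c}" lebesgue] by simp
        then show "AE x in lebesgue. indicator {c<..} x * h' x = indicator {max c (- real n)..real n} x * h x"
          using AEh' by eventually_elim (auto simp: hI_def I_def indicator_def)
        show "(\<lambda>x. indicator {c<..} x * h' x) \<in> borel_measurable lebesgue"
          by (intro borel_measurable_times borel_measurable_indicator) (auto simp: measurable_completion)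
        have "integrable lebesgue (\<lambda>x. indicator {max c (- real n)..real n} x * h x)"
          using li[of "max c (- real n)" "real n"] by (simp add: integrable_restrict_space set_integrable_def)
        then show "(\<lambda>x. indicator {max c (- real n)..real n} x * h x) \<in> borel_measurable lebesgue" by simp
      qed
      also have "\<dots> = (LINT x|lebesgue_on {max c (- real n)..real n}. h x)"
        by (simp add: integral_restrict_space set_lebesgue_integral_def)
      also have "\<dots> = 0"
      proof (cases "max c (- real n) < real n")
        case False
        then consider "max c (- real n) = real n" | "{max c (- real n)..real n} = {}" by fastforce
        then show ?thesis
        proof cases
          case 1
          have "AE x in lebesgue. x \<noteq> real n" using AE_not_in[of "{real n}" lebesgue] by simp
          then have "AE x in lebesgue. indicator {real n..real n} x * h x = 0"
            by eventually_elim (auto simp: indicator_def)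
          then show ?thesis
            unfolding 1 by (simp add: integral_restrict_space set_lebesgue_integral_def integral_eq_zero_AE)
        next
          case 2
          then show ?thesis by (simp add: integral_restrict_space set_lebesgue_integral_def)
        qed
      qed (rule zero)
      finally show ?thesis .
    qed
    define p where "p x = ennreal (h' x)" for x
    define q where "q x = ennreal (- h' x)" for x
    have pq[measurable]: "p \<in> borel_measurable lborel" "q \<in> borel_measurable lborel"
      using h' by (simp_all add: p_def[abs_def] q_def[abs_def])
    have fin: "(\<integral>\<^sup>+x. p x \<partial>lborel) < \<infinity>" "(\<integral>\<^sup>+x. q x \<partial>lborel) < \<infinity>"
      using ih unfolding p_def q_def real_integrable_def by (auto simp: top.not_eq_extremum)
    have "density lborel p = density lborel q"
    proof (rule measure_eqI_lessThan)
      fix c :: real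
      have "emeasure (density lborel p) {c<..} = (\<integral>\<^sup>+x. ennreal (indicator {c<..} x * h' x) \<partial>lborel)"
        by (auto simp: emeasure_density p_def indicator_def intro!: nn_integral_cong)
      moreover have "emeasure (density lborel q) {c<..} = (\<integral>\<^sup>+x. ennreal (- (indicator {c<..} x * h' x)) \<partial>lborel)"
        by (auto simp: emeasure_density q_def indicator_def intro!: nn_integral_cong)
      moreover have ic: "integrable lborel (\<lambda>x. indicator {c<..} x * h' x)"
        using integrable_mult_indicator[OF _ ih, of "{c<..}"] by simp
      moreover have "(\<integral>\<^sup>+x. ennreal (indicator {c<..} x * h' x) \<partial>lborel) \<noteq> \<infinity>"
        "(\<integral>\<^sup>+x. ennreal (- (indicator {c<..} x * h' x)) \<partial>lborel) \<noteq> \<infinity>"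
        using ic unfolding real_integrable_def by auto
      moreover have "enn2real (\<integral>\<^sup>+x. ennreal (indicator {c<..} x * h' x) \<partial>lborel)
          = enn2real (\<integral>\<^sup>+x. ennreal (- (indicator {c<..} x * h' x)) \<partial>lborel)"
        using real_lebesgue_integral_def[OF ic] tail0[of c] by linarith
      ultimately show "emeasure (density lborel p) {c<..} = emeasure (density lborel q) {c<..}"
        "emeasure (density lborel p) {c<..} < \<infinity>"
        by (metis ennreal_enn2real_if infinity_ennreal_def, metis top.not_eq_extremum infinity_ennreal_def)
    qed auto
    then have "AE x in lborel. p x = q x"
      using finite_density_unique[OF pq] fin by auto
    then have "AE x in lborel. h' x = 0"
    proof eventually_elim
      case (elim x)
      then show ?case by (cases "h' x \<ge> 0") (auto simp: p_def q_def ennreal_neg)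
    qed
    then have "AE x in lebesgue. h' x = 0" by (rule AE_completion)
    with AEh' show ?thesis by eventually_elim (auto simp: hI_def I_def)
  qed
  then have "AE x in lebesgue. \<forall>n. x \<in> {- real n..real n} \<longrightarrow> h x = 0"
    unfolding AE_all_countable by blast
  then show ?thesis
  proof eventually_elim
    case (elim x)
    obtain n where "\<bar>x\<bar> \<le> real n" using real_arch_simple by blast
    then show ?case using elim[rule_format, of n] by (simp add: abs_le_iff)
  qed
qed

lemma integrable_mult_test_function:
  fixes h :: "real \<Rightarrow> real"
  assumes li: "\<And>a b. integrable (lebesgue_on {a..b}) h" and \<phi>: "test_function \<phi>"
  shows "integrable lebesgue (\<lambda>x. h x * \<phi> x)"
proof -
  obtain R where R: "\<And>x. x \<notin> {-R..R} \<Longrightarrow> \<phi> x = 0" using test_function_bounded_support[OF \<phi>] by metis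
  obtain M where M: "\<And>x. \<bar>\<phi> x\<bar> \<le> M" using test_function_bounded[OF \<phi>] by metis
  have [measurable]: "\<phi> \<in> borel_measurable lebesgue"
    using test_functionD(4)[OF \<phi>] by (simp add: measurable_completion)
  have ih: "integrable lebesgue (\<lambda>x. indicator {-R..R} x * h x)"
    using li[of "-R" R] by (simp add: integrable_restrict_space set_integrable_def)
  then have im: "integrable lebesgue (\<lambda>x. M * (indicator {-R..R} x * h x))" by (rule integrable_mult_right)
  have "integrable lebesgue (\<lambda>x. (indicator {-R..R} x * h x) * \<phi> x)"
  proof (rule Bochner_Integration.integrable_bound[OF im])
    show "(\<lambda>x. (indicator {-R..R} x * h x) * \<phi> x) \<in> borel_measurable lebesgue"
      by (rule borel_measurable_times[OF borel_measurable_integrable[OF ih]]) measurable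
    have "\<bar>h x\<bar> * \<bar>\<phi> x\<bar> \<le> \<bar>M\<bar> * \<bar>h x\<bar>" for x
      using mult_left_mono[of "\<bar>\<phi> x\<bar>" "\<bar>M\<bar>" "\<bar>h x\<bar>"] M[of x] by (simp add: mult.commute)
    then show "AE x in lebesgue. norm ((indicator {-R..R} x * h x) * \<phi> x) \<le> norm (M * (indicator {-R..R} x * h x))"
      by (auto simp: abs_mult indicator_def)
  qed
  moreover have "(indicator {-R..R} x * h x) * \<phi> x = h x * \<phi> x" for x
    using R[of x] by (auto simp: indicator_def)
  ultimately show ?thesis by simp
qed

lemma integral_mult_test_function_restrict:
  fixes h \<phi> :: "real \<Rightarrow> real"
  assumes "\<And>x. x \<notin> {a..b} \<Longrightarrow> \<phi> x = 0"
  shows "(LINT x|lebesgue. h x * \<phi> x) = (LINT x|lebesgue_on {a..b}. h x * \<phi> x :: real)"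
proof -
  have "(LINT x|lebesgue. h x * \<phi> x) = (LINT x|lebesgue. indicator {a..b} x *\<^sub>R (h x * \<phi> x))"
    using assms by (intro Bochner_Integration.integral_cong) (auto simp: indicator_def)
  then show ?thesis by (simp add: integral_restrict_space set_lebesgue_integral_def)
qed

text \<open>Testing with bumps that tend boundedly to the indicator of an interval shows that \<open>h\<close> has
  integral zero over it.\<close>

lemma fundamental_lemma_test_functions:
  fixes h :: "real \<Rightarrow> real"
  assumes li: "\<And>a b. integrable (lebesgue_on {a..b}) h"
    and zero: "\<And>\<phi>. test_function \<phi> \<Longrightarrow> (LINT x|lebesgue. h x * \<phi> x) = 0"
  shows "AE x in lebesgue. h x = 0"
proof (rule zero_on_intervals_imp_AE_zero[OF li])
  fix a b :: real assume "a < b"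
  have hi: "integrable lebesgue (\<lambda>x. indicator {a..b} x * h x)"
    using li[of a b] by (simp add: integrable_restrict_space set_integrable_def)
  have "(\<lambda>n. LINT x|lebesgue. h x * bump a b n x) \<longlonglongrightarrow> (LINT x|lebesgue. indicator {a..b} x * h x)"
  proof (rule integral_dominated_convergence[where w="\<lambda>x. \<bar>indicator {a..b} x * h x\<bar>"])
    show "integrable lebesgue (\<lambda>x. \<bar>indicator {a..b} x * h x\<bar>)" using hi by (rule integrable_abs)
    have "AE x in lebesgue. x \<noteq> a" "AE x in lebesgue. x \<noteq> b"
      using AE_not_in[of "{a}" lebesgue] AE_not_in[of "{b}" lebesgue] by auto
    then show "AE x in lebesgue. (\<lambda>n. h x * bump a b n x) \<longlonglongrightarrow> indicator {a..b} x * h x"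
    proof eventually_elim
      case (elim x)
      have "(\<lambda>n. h x * bump a b n x) \<longlonglongrightarrow> h x * indicator {a<..<b} x"
        by (intro tendsto_intros bump_tendsto \<open>a < b\<close>)
      then show ?case using elim by (auto simp: indicator_def)
    qed
    show "AE x in lebesgue. norm (h x * bump a b n x) \<le> \<bar>indicator {a..b} x * h x\<bar>" for n
    proof (rule AE_I2)
      fix x
      have "indicator {a<..<b} x \<le> (indicator {a..b} x :: real)" by (auto simp: indicator_def)
      then have "bump a b n x \<le> indicator {a..b} x"
        using bump_le[OF \<open>a < b\<close>, of n x] by (rule order_trans[rotated])
      then show "norm (h x * bump a b n x) \<le> \<bar>indicator {a..b} x * h x\<bar>"
        using mult_left_mono[of "bump a b n x" "indicator {a..b} x" "\<bar>h x\<bar>"] bump_nonneg[of a b n x]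
        by (simp add: abs_mult mult.commute)
    qed
    show "(\<lambda>x. h x * bump a b n x) \<in> borel_measurable lebesgue" for n
      using integrable_mult_test_function[OF li test_function_bump[OF \<open>a<b\<close>]] by simp
  qed (use hi in auto)
  then have "(LINT x|lebesgue. indicator {a..b} x * h x) = 0"
    using zero[OF test_function_bump[OF \<open>a < b\<close>]] by (simp add: LIMSEQ_const_iff)
  then show "(LINT x|lebesgue_on {a..b}. h x) = 0"
    by (simp add: integral_restrict_space set_lebesgue_integral_def)
qed

section \<open>Primitives and weak derivatives\<close>

text \<open>Local absolute continuity with derivative \<open>g\<close>, expressed through increments over
  \<open>a \<le> b\<close>: this form has no base point and no oriented integrals.\<close>

definition primitive_of :: "(real \<Rightarrow> real) \<Rightarrow> (real \<Rightarrow> real) \<Rightarrow> bool" where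
  "primitive_of F g \<longleftrightarrow> (\<forall>a b. integrable (lebesgue_on {a..b}) g) \<and>
     (\<forall>a b. a \<le> b \<longrightarrow> F b - F a = (LINT x|lebesgue_on {a..b}. g x))"

lemma primitive_ofD:
  assumes "primitive_of F g"
  shows "integrable (lebesgue_on {a..b}) g" "a \<le> b \<Longrightarrow> F b - F a = (LINT x|lebesgue_on {a..b}. g x)"
    "a \<le> b \<Longrightarrow> F b = F a + (LINT x|lebesgue_on {a..b}. g x)"
  using assms by (auto simp: primitive_of_def algebra_simps)

lemma primitive_of_exists:
  assumes li: "\<And>a b. integrable (lebesgue_on {a..b}) g"
  obtains F where "primitive_of F g"
proof -
  define F where "F x = (if 0 \<le> x then (LINT y|lebesgue_on {0..x}. g y) else - (LINT y|lebesgue_on {x..0}. g y))" for x :: real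
  have at: "(LINT x|lebesgue_on {a..c}. g x) = (LINT x|lebesgue_on {a..b}. g x) + (LINT x|lebesgue_on {b..c}. g x)"
    if "a \<le> b" "b \<le> c" for a b c
    by (rule integral_lebesgue_on_combine[OF li that])
  have "F b - F a = (LINT x|lebesgue_on {a..b}. g x)" if "a \<le> b" for a b
  proof -
    consider "0 \<le> a" | "a < 0" "0 \<le> b" | "b < 0" by linarith
    then show ?thesis
    proof cases
      case 1
      then have "F a = (LINT y|lebesgue_on {0..a}. g y)" "F b = (LINT y|lebesgue_on {0..b}. g y)"
        using that by (auto simp: F_def)
      with at[of 0 a b] 1 that show ?thesis by linarith
    next
      case 2
      then have "F a = - (LINT y|lebesgue_on {a..0}. g y)" "F b = (LINT y|lebesgue_on {0..b}. g y)"
        by (auto simp: F_def)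
      with at[of a 0 b] 2 show ?thesis by linarith
    next
      case 3
      then have "F a = - (LINT y|lebesgue_on {a..0}. g y)" "F b = - (LINT y|lebesgue_on {b..0}. g y)"
        using that by (auto simp: F_def)
      with at[of a b 0] 3 that show ?thesis by linarith
    qed
  qed
  then have "primitive_of F g" using li by (simp add: primitive_of_def)
  then show ?thesis by (rule that)
qed

lemma primitive_of_eq_integral:
  assumes "primitive_of F g" "a \<le> x"
  shows "F x = F a + integral {a..x} g"
  using primitive_ofD(3)[OF assms] lebesgue_integral_eq_integral[OF primitive_ofD(1)[OF assms(1)], of a x]
  by simp

lemma primitive_of_continuous:
  assumes "primitive_of F g"
  shows "continuous_on A F"
proof -
  have "isCont F x" for x
  proof -
    have "g integrable_on {x-1..x+1}"
      by (rule integrable_on_lebesgue_on[OF primitive_ofD(1)[OF assms]]) simp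
    then have "continuous_on {x-1..x+1} (\<lambda>y. F (x-1) + integral {x-1..y} g)"
      by (intro continuous_intros indefinite_integral_continuous_1)
    then have "continuous_on {x-1..x+1} F"
      by (rule continuous_on_eq) (rule primitive_of_eq_integral[OF assms, symmetric], simp)
    then show ?thesis
      by (rule continuous_on_interior) simp
  qed
  then show ?thesis by (simp add: continuous_at_imp_continuous_on)
qed

lemma primitive_of_measurable: "primitive_of F g \<Longrightarrow> F \<in> borel_measurable lebesgue"
  using borel_measurable_continuous_onI[OF primitive_of_continuous] by (simp add: measurable_completion)

lemma primitive_of_deriv:
  assumes F: "primitive_of F g" and g: "continuous_on UNIV g"
  shows "(F has_real_derivative g x) (at x)"
proof -
  have "continuous_on {x-1..x+1} g" using g continuous_on_subset by blast
  then have "((\<lambda>y. integral {x-1..y} g) has_real_derivative g x) (at x within {x-1..x+1})"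
    by (rule integral_has_real_derivative) simp
  moreover have "at x within {x-1..x+1} = at x" by (rule at_within_interior) simp
  ultimately have "((\<lambda>y. integral {x-1..y} g) has_real_derivative g x) (at x)" by simp
  from DERIV_add[OF DERIV_const this, of "F (x-1)"]
  have "((\<lambda>y. F (x-1) + integral {x-1..y} g) has_real_derivative g x) (at x)" by simp
  then show ?thesis
    by (rule has_field_derivative_transform_within_open[where S="{x-1<..<x+1}"])
      (auto intro!: primitive_of_eq_integral[OF F, symmetric])
qed

lemma primitive_of_test_function:
  assumes "test_function \<phi>"
  shows "primitive_of \<phi> (deriv \<phi>)"
  unfolding primitive_of_def
proof (intro conjI allI impI)
  fix a b :: real
  show i: "integrable (lebesgue_on {a..b}) (deriv \<phi>)"
    by (intro continuous_imp_integrable_real)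
      (rule test_functionD(3)[OF test_functionD(2)[OF assms]])
  assume "a \<le> b"
  have "(deriv \<phi> has_integral (\<phi> b - \<phi> a)) {a..b}"
    by (rule fundamental_theorem_of_calculus[OF \<open>a \<le> b\<close>])
      (use test_functionD(1)[OF assms] in \<open>auto simp: has_real_derivative_iff_has_vector_derivative intro: has_vector_derivative_at_within\<close>)
  then show "\<phi> b - \<phi> a = (LINT x|lebesgue_on {a..b}. deriv \<phi> x)"
    using lebesgue_integral_eq_integral[OF i] by (simp add: integral_unique)
qed

lemma primitive_of_mult:
  assumes F: "primitive_of F f" and G: "primitive_of G g"
  shows "primitive_of (\<lambda>x. F x * G x) (\<lambda>x. f x * G x + F x * g x)"
proof -
  have *: "integrable (lebesgue_on {a..b}) (\<lambda>x. f x * G x) \<and> integrable (lebesgue_on {a..b}) (\<lambda>x. F x * g x) \<and>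
     F b * G b = F a * G a + (LINT x|lebesgue_on {a..b}. f x * G x) + (LINT x|lebesgue_on {a..b}. F x * g x)"
    if "a \<le> b" for a b
  proof -
    have eqF: "F a + (LINT x|lebesgue_on {a..s}. f x) = F s" if "s \<in> {a..b}" for s
      by (rule primitive_ofD(3)[OF F, symmetric]) (use that in simp)
    have eqG: "G a + (LINT x|lebesgue_on {a..s}. g x) = G s" if "s \<in> {a..b}" for s
      by (rule primitive_ofD(3)[OF G, symmetric]) (use that in simp)
    have 1: "integrable (lebesgue_on {a..b}) (\<lambda>s. inner (f s) (G a + (LINT x|lebesgue_on {a..s}. g x)))
          = integrable (lebesgue_on {a..b}) (\<lambda>s. f s * G s)"
      "integrable (lebesgue_on {a..b}) (\<lambda>s. inner (F a + (LINT x|lebesgue_on {a..s}. f x)) (g s))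
          = integrable (lebesgue_on {a..b}) (\<lambda>s. F s * g s)"
      by (rule Bochner_Integration.integrable_cong; simp add: eqF eqG)+
    have 2: "(LINT s|lebesgue_on {a..b}. inner (f s) (G a + (LINT x|lebesgue_on {a..s}. g x)))
          = (LINT s|lebesgue_on {a..b}. f s * G s)"
      "(LINT s|lebesgue_on {a..b}. inner (F a + (LINT x|lebesgue_on {a..s}. f x)) (g s))
          = (LINT s|lebesgue_on {a..b}. F s * g s)"
      by (rule Bochner_Integration.integral_cong; simp add: eqF eqG)+
    have I: "integrable (lebesgue_on {a..b}) (\<lambda>s. f s * G s)" "integrable (lebesgue_on {a..b}) (\<lambda>s. F s * g s)"
      using integral_inner_by_parts(1)[OF primitive_ofD(1)[OF F, of a b] primitive_ofD(1)[OF G, of a b] that, where w = "G a"]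
        integral_inner_by_parts(2)[OF primitive_ofD(1)[OF F, of a b] primitive_ofD(1)[OF G, of a b] that, where v = "F a"]
      by (simp_all only: 1)
    have "F b * G b = F a * G a + (LINT x|lebesgue_on {a..b}. f x * G x) + (LINT x|lebesgue_on {a..b}. F x * g x)"
      using integral_inner_by_parts(3)[OF primitive_ofD(1)[OF F, of a b] primitive_ofD(1)[OF G, of a b] that,
        where v = "F a" and w = "G a"] eqF[of b] eqG[of b] that by (simp only: 2) simp
    with I show ?thesis by simp
  qed
  show ?thesis unfolding primitive_of_def
  proof (intro conjI allI impI)
    fix a b :: real
    show "integrable (lebesgue_on {a..b}) (\<lambda>x. f x * G x + F x * g x)"
      using *[of a b] by (cases "a \<le> b") auto
    show "F b * G b - F a * G a = (LINT x|lebesgue_on {a..b}. f x * G x + F x * g x)" if "a \<le> b"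
      using *[OF that] by simp
  qed
qed

text \<open>An integrable function need not tend to zero at infinity, but it takes arbitrarily small values on
  every half-line. Evaluating primitives at such points is enough to remove boundary terms.\<close>

lemma small_value_on_infinite_measure:
  fixes P :: "real \<Rightarrow> real"
  assumes P: "integrable lebesgue P" and S: "S \<in> sets lebesgue" "emeasure lebesgue S = \<infinity>" and e: "e > 0"
  obtains x where "x \<in> S" "\<bar>P x\<bar> < e"
proof -
  have "\<exists>x\<in>S. \<bar>P x\<bar> < e"
  proof (rule ccontr)
    assume "\<not> (\<exists>x\<in>S. \<bar>P x\<bar> < e)"
    then have ge: "e \<le> \<bar>P x\<bar>" if "x \<in> S" for x using that by force
    have "integrable lebesgue (indicator S :: real \<Rightarrow> real)"
    proof (rule Bochner_Integration.integrable_bound[of lebesgue "\<lambda>x. P x / e"])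
      show "AE x in lebesgue. norm (indicator S x :: real) \<le> norm (P x / e)"
        using ge e by (auto simp: indicator_def field_simps)
    qed (use P S in auto)
    then show False using S by (auto simp: integrable_indicator_iff)
  qed
  then show ?thesis using that by blast
qed

lemma emeasure_lebesgue_half_lines:
  fixes c :: real
  shows "emeasure lebesgue {c..} = \<infinity>" "emeasure lebesgue {..c} = \<infinity>"
proof -
  have "\<not> emeasure lebesgue S < \<infinity>" if "S \<in> sets lebesgue" "\<And>n. {d n..d n + real n} \<subseteq> S" for S and d :: "nat \<Rightarrow> real"
  proof
    assume fin: "emeasure lebesgue S < \<infinity>"
    have "real n \<le> measure lebesgue S" for n
    proof -
      have "measure lebesgue {d n..d n + real n} \<le> measure lebesgue S"
        using that fin by (intro measure_mono_fmeasurable) (auto simp: fmeasurable_def)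
      then show ?thesis by simp
    qed
    then show False by (metis not_le reals_Archimedean2)
  qed
  from this[of "{c..}" "\<lambda>_. c"] this[of "{..c}" "\<lambda>n. c - real n"]
  show "emeasure lebesgue {c..} = \<infinity>" "emeasure lebesgue {..c} = \<infinity>"
    by (auto simp: not_less_iff_gr_or_eq less_top)
qed

text \<open>The integrals of \<open>q\<close> over \<open>[a\<^sub>n, b\<^sub>n]\<close> tend to the full integral, while their values
  \<open>P b\<^sub>n - P a\<^sub>n\<close> tend to zero when \<open>a\<^sub>n \<rightarrow> -\<infinity>\<close> and \<open>b\<^sub>n \<rightarrow> \<infinity>\<close> run through points
  where \<open>P\<close> is small.\<close>

lemma integral_of_total_derivative:
  assumes P: "primitive_of P q" and iP: "integrable lebesgue P" and iq: "integrable lebesgue q"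
  shows "(LINT x|lebesgue. q x) = 0"
proof -
  have "\<exists>b. real n \<le> b \<and> \<bar>P b\<bar> < 1 / real (Suc n)" for n
    by (rule small_value_on_infinite_measure[OF iP _ emeasure_lebesgue_half_lines(1)[of "real n"], of "1 / real (Suc n)"]) auto
  then obtain b where b: "\<And>n. real n \<le> b n" "\<And>n. \<bar>P (b n)\<bar> < 1 / real (Suc n)" by metis
  have "\<exists>a\<le>- real n. \<bar>P a\<bar> < 1 / real (Suc n)" for n
    by (rule small_value_on_infinite_measure[OF iP _ emeasure_lebesgue_half_lines(2)[of "- real n"], of "1 / real (Suc n)"]) auto
  then obtain a where a: "\<And>n. a n \<le> - real n" "\<And>n. \<bar>P (a n)\<bar> < 1 / real (Suc n)" by metis
  have "(\<lambda>n. LINT x|lebesgue. indicator {a n..b n} x * q x) \<longlonglongrightarrow> (LINT x|lebesgue. q x)"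
  proof (rule integral_dominated_convergence[where w="\<lambda>x. \<bar>q x\<bar>"])
    show "AE x in lebesgue. (\<lambda>n. indicator {a n..b n} x * q x) \<longlonglongrightarrow> q x"
    proof (rule AE_I2, rule tendsto_eventually)
      fix x :: real
      obtain N where N: "\<bar>x\<bar> \<le> real N" using real_arch_simple by blast
      show "\<forall>\<^sub>F n in sequentially. indicator {a n..b n} x * q x = q x"
        using eventually_ge_at_top[of N]
      proof eventually_elim
        case (elim n)
        then have "real N \<le> real n" by simp
        then have "x \<in> {a n..b n}" using N a(1)[of n] b(1)[of n] unfolding atLeastAtMost_iff by linarith
        then show ?case by simp
      qed
    qed
    show "AE x in lebesgue. norm (indicator {a n..b n} x * q x) \<le> \<bar>q x\<bar>" for n
      by (auto simp: indicator_def)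
    show "(\<lambda>x. indicator {a n..b n} x * q x) \<in> borel_measurable lebesgue" for n
      using borel_measurable_integrable[OF integrable_mult_indicator[OF _ iq, of "{a n..b n}"]] by simp
  qed (use iq in auto)
  moreover have "(LINT x|lebesgue. indicator {a n..b n} x * q x) = P (b n) - P (a n)" for n
  proof -
    have "a n \<le> b n" using a(1)[of n] b(1)[of n] by linarith
    then show ?thesis
      using primitive_ofD(2)[OF P, of "a n" "b n"] by (simp add: integral_restrict_space set_lebesgue_integral_def)
  qed
  moreover have "(\<lambda>n. P (b n) - P (a n)) \<longlonglongrightarrow> 0 - 0"
  proof (intro tendsto_diff)
    have z: "(\<lambda>n. 1 / real (Suc n)) \<longlonglongrightarrow> 0" by (intro LIMSEQ_Suc lim_1_over_n)
    show "(\<lambda>n. P (b n)) \<longlonglongrightarrow> 0"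
      by (rule tendsto_rabs_zero_cancel, rule tendsto_sandwich[OF _ _ tendsto_const z])
        (auto intro!: always_eventually less_imp_le b(2) simp del: of_nat_Suc)
    show "(\<lambda>n. P (a n)) \<longlonglongrightarrow> 0"
      by (rule tendsto_rabs_zero_cancel, rule tendsto_sandwich[OF _ _ tendsto_const z])
        (auto intro!: always_eventually less_imp_le a(2) simp del: of_nat_Suc)
  qed
  ultimately show ?thesis by (simp add: LIMSEQ_unique)
qed

lemma primitive_of_weak_deriv:
  assumes F: "primitive_of F g" and \<phi>: "test_function \<phi>"
  shows "(LINT x|lebesgue. F x * deriv \<phi> x) = - (LINT x|lebesgue. g x * \<phi> x)"
proof -
  have li: "integrable (lebesgue_on {a..b}) F" for a b
    by (rule continuous_imp_integrable_real[OF primitive_of_continuous[OF F]])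
  note i = integrable_mult_test_function[OF primitive_ofD(1)[OF F] \<phi>]
    integrable_mult_test_function[OF li test_functionD(2)[OF \<phi>]]
  have "(LINT x|lebesgue. g x * \<phi> x + F x * deriv \<phi> x) = 0"
    by (rule integral_of_total_derivative[OF primitive_of_mult[OF F primitive_of_test_function[OF \<phi>]]
          integrable_mult_test_function[OF li \<phi>] Bochner_Integration.integrable_add[OF i]])
  then show ?thesis using i by simp
qed

text \<open>Mean zero is what makes the antiderivative vanish to the right of the support as well as to the
  left.\<close>

lemma test_function_antiderivative:
  assumes \<theta>: "test_function \<theta>" and zero: "(LINT x|lebesgue. \<theta> x) = 0"
  obtains \<eta> where "test_function \<eta>" "deriv \<eta> = \<theta>"
proof -
  obtain R where "R > 0" and R: "\<And>x. x \<notin> {-R..R} \<Longrightarrow> \<theta> x = 0" using test_function_bounded_support[OF \<theta>] by metis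
  have "integrable (lebesgue_on {a..b}) \<theta>" for a b
    by (rule continuous_imp_integrable_real[OF test_functionD(3)[OF \<theta>]])
  then obtain F where F: "primitive_of F \<theta>" using primitive_of_exists by blast
  define \<eta> where "\<eta> x = F x - F (-R)" for x
  have d: "(\<eta> has_real_derivative \<theta> x) (at x)" for x
    unfolding \<eta>_def using DERIV_diff[OF primitive_of_deriv[OF F test_functionD(3)[OF \<theta>]] DERIV_const] by simp
  have "\<eta> x = 0" if "\<bar>x\<bar> > R" for x
  proof (cases "x > 0")
    case True
    then have "\<eta> x = (LINT y|lebesgue_on {-R..x}. 1 * \<theta> y)"
      using primitive_ofD(2)[OF F, of "-R" x] \<open>R > 0\<close> by (simp add: \<eta>_def)
    also have "\<dots> = (LINT y|lebesgue. 1 * \<theta> y)"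
      by (rule integral_mult_test_function_restrict[symmetric]) (use that True in \<open>auto intro!: R\<close>)
    finally show ?thesis using zero by simp
  next
    case False
    then have "- \<eta> x = (LINT y|lebesgue_on {x..-R}. \<theta> y)"
      using primitive_ofD(2)[OF F, of x "-R"] that by (simp add: \<eta>_def)
    also have "\<dots> = 0"
    proof -
      have "AE y in lebesgue. y \<noteq> - R" using AE_not_in[of "{-R}" lebesgue] by simp
      then have "AE y in lebesgue. indicator {x..-R} y *\<^sub>R \<theta> y = 0"
        by eventually_elim (use R in \<open>auto simp: indicator_def\<close>)
      then show ?thesis
        by (simp add: integral_restrict_space set_lebesgue_integral_def integral_eq_zero_AE)
    qed
    finally show ?thesis by simp
  qed
  then have "test_function \<eta>" by (intro test_functionI[OF d \<theta>])
  moreover have "deriv \<eta> = \<theta>" using d by (auto intro: DERIV_imp_deriv)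
  ultimately show ?thesis by (rule that)
qed

text \<open>If \<open>G\<close> is a primitive of \<open>g\<close>, then \<open>f - G\<close> annihilates the derivatives of test
  functions, which are the test functions of mean zero. Subtracting a multiple of one fixed bump \<open>\<psi>\<close>
  makes any test function mean zero, so \<open>f - G\<close> acts on test functions as a constant, and the
  fundamental lemma identifies it with that constant.\<close>

theorem du_Bois_Reymond:
  fixes f g :: "real \<Rightarrow> real"
  assumes f: "\<And>a b. integrable (lebesgue_on {a..b}) f" and g: "\<And>a b. integrable (lebesgue_on {a..b}) g"
    and wd: "\<And>\<phi>. test_function \<phi> \<Longrightarrow> (LINT x|lebesgue. f x * deriv \<phi> x) = - (LINT x|lebesgue. g x * \<phi> x)"
  obtains F where "primitive_of F g" "AE x in lebesgue. f x = F x"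
proof -
  obtain G where G: "primitive_of G g" using primitive_of_exists[OF g] by blast
  have Gi: "integrable (lebesgue_on {a..b}) G" for a b
    by (rule continuous_imp_integrable_real[OF primitive_of_continuous[OF G]])
  define h where "h x = f x - G x" for x
  have hi: "integrable (lebesgue_on {a..b}) h" for a b
    unfolding h_def by (rule Bochner_Integration.integrable_diff[OF f Gi])
  have h0: "(LINT x|lebesgue. h x * deriv \<phi> x) = 0" if "test_function \<phi>" for \<phi>
    using wd[OF that] primitive_of_weak_deriv[OF G that]
      integrable_mult_test_function[OF f test_functionD(2)[OF that]] 
      integrable_mult_test_function[OF Gi test_functionD(2)[OF that]]
    by (simp add: h_def left_diff_distrib)
  have c1: "integrable (lebesgue_on {a..b}) (\<lambda>_. 1 :: real)" for a b :: real
    by (rule continuous_imp_integrable_real) simp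
  have ti: "integrable lebesgue \<phi>" if "test_function \<phi>" for \<phi>
    using integrable_mult_test_function[OF c1 that] by simp
  define \<psi> where "\<psi> = bump 0 1 0"
  have \<psi>: "test_function \<psi>" unfolding \<psi>_def by (rule test_function_bump) simp
  define c0 where "c0 = (LINT x|lebesgue. \<psi> x)"
  have "c0 \<noteq> 0"
  proof
    assume "c0 = 0"
    then have "AE x in lebesgue. \<psi> x = 0"
      using integral_nonneg_eq_0_iff_AE[OF ti[OF \<psi>]] by (simp add: c0_def \<psi>_def bump_nonneg)
    then have "AE x in lebesgue. x \<notin> {0<..<1::real}"
      by (rule eventually_mono) (auto simp: \<psi>_def bump_inside)
    then have "emeasure lebesgue {0<..<1::real} = 0"
      by (subst (asm) AE_iff_measurable[of "{0<..<1}"]) auto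
    then show False by simp
  qed
  define C where "C = (LINT x|lebesgue. h x * \<psi> x) / c0"
  have "AE x in lebesgue. h x - C = 0"
  proof (rule fundamental_lemma_test_functions)
    show "integrable (lebesgue_on {a..b}) (\<lambda>x. h x - C)" for a b
      using hi[of a b] integrable_mult_right[OF c1[of a b], of C] by simp
    fix \<phi> assume \<phi>: "test_function \<phi>"
    define c where "c = (LINT x|lebesgue. \<phi> x) / c0"
    have \<theta>: "test_function (\<lambda>x. \<phi> x - c * \<psi> x)" by (rule test_function_diff_scale[OF \<phi> \<psi>])
    have "(LINT x|lebesgue. \<phi> x - c * \<psi> x) = 0"
      using ti[OF \<phi>] ti[OF \<psi>] \<open>c0 \<noteq> 0\<close> by (simp add: c_def c0_def)
    from test_function_antiderivative[OF \<theta> this] obtain \<eta> where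
      "test_function \<eta>" "deriv \<eta> = (\<lambda>x. \<phi> x - c * \<psi> x)" by metis
    with h0[of \<eta>] have "(LINT x|lebesgue. h x * (\<phi> x - c * \<psi> x)) = 0" by simp
    moreover have "h x * (\<phi> x - c * \<psi> x) = h x * \<phi> x - c * (h x * \<psi> x)" for x by (simp add: algebra_simps)
    ultimately have "(LINT x|lebesgue. h x * \<phi> x) = c * (LINT x|lebesgue. h x * \<psi> x)"
      using integrable_mult_test_function[OF hi \<phi>] integrable_mult_test_function[OF hi \<psi>] by simp
    also have "\<dots> = C * (LINT x|lebesgue. \<phi> x)" by (simp add: c_def C_def)
    finally show "(LINT x|lebesgue. (h x - C) * \<phi> x) = 0"
      using integrable_mult_test_function[OF hi \<phi>] ti[OF \<phi>] by (simp add: left_diff_distrib)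
  qed
  then have "AE x in lebesgue. f x = G x + C"
    by eventually_elim (simp add: h_def)
  moreover have "primitive_of (\<lambda>x. G x + C) g" using G by (simp add: primitive_of_def)
  ultimately show ?thesis by (intro that)
qed

section \<open>Sobolev functions on the line\<close>

lemma square_integrable_locally_integrable:
  assumes "square_integrable f"
  shows "integrable (lebesgue_on {a..b}) f"
proof -
  have "square_integrable (indicator {a..b} :: real \<Rightarrow> real)"
  proof -
    have "(\<lambda>x. (indicator {a..b} x :: real)\<^sup>2) = indicator {a..b}" by (auto simp: indicator_def)
    then show ?thesis
      by (auto simp: square_integrable_def integrable_indicator_iff emeasure_lborel_Icc_eq intro!: borel_measurable_indicator)
  qed
  from square_integrable_mult[OF this assms] show ?thesis
    by (simp add: integrable_restrict_space set_integrable_def)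
qed

lemmas rep_L2_locally_integrable = square_integrable_locally_integrable[OF square_integrable_rep]

lemma norm_L2_class_mono:
  assumes "square_integrable f" "square_integrable g" "AE x in lebesgue. \<bar>f x\<bar> \<le> \<bar>g x\<bar>"
  shows "norm (L2_class f) \<le> norm (L2_class g)"
proof -
  have "(norm (L2_class f))\<^sup>2 \<le> (norm (L2_class g))\<^sup>2"
    unfolding norm_L2_class[OF assms(1)] norm_L2_class[OF assms(2)]
    by (rule integral_mono_AE)
      (use assms in \<open>auto simp: square_integrable_def abs_le_square_iff\<close>)
  then show ?thesis by (rule power2_le_imp_le) simp
qed

lemma square_integrable_abs: "square_integrable f \<Longrightarrow> square_integrable (\<lambda>x. \<bar>f x\<bar>)"
  by (auto simp: square_integrable_def)

lemma has_weak_derivD: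
  assumes "has_weak_deriv k f g" "test_function \<phi>"
  shows "(LINT x|lebesgue. rep_L2 f x * (deriv ^^ k) \<phi> x) = (-1) ^ k * (LINT x|lebesgue. rep_L2 g x * \<phi> x)"
  using assms unfolding has_weak_deriv_def by blast

text \<open>Uniqueness, from the fundamental lemma, turns the description operator in \<open>weak_deriv\<close> into a
  usable function.\<close>

lemma has_weak_deriv_unique:
  assumes "has_weak_deriv k f g" "has_weak_deriv k f g'"
  shows "g = g'"
proof (rule L2_eqI)
  have "AE x in lebesgue. rep_L2 g x - rep_L2 g' x = 0"
  proof (rule fundamental_lemma_test_functions)
    show "integrable (lebesgue_on {a..b}) (\<lambda>x. rep_L2 g x - rep_L2 g' x)" for a b
      by (intro Bochner_Integration.integrable_diff rep_L2_locally_integrable)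
    fix \<phi> assume \<phi>: "test_function \<phi>"
    have "(-1) ^ k * (LINT x|lebesgue. rep_L2 g x * \<phi> x) = (-1) ^ k * (LINT x|lebesgue. rep_L2 g' x * \<phi> x)"
      using has_weak_derivD[OF assms(1) \<phi>] has_weak_derivD[OF assms(2) \<phi>] by (rule trans[OF sym])
    then have "(LINT x|lebesgue. rep_L2 g x * \<phi> x) = (LINT x|lebesgue. rep_L2 g' x * \<phi> x)" by simp
    then show "(LINT x|lebesgue. (rep_L2 g x - rep_L2 g' x) * \<phi> x) = 0"
      using integrable_mult_test_function[OF rep_L2_locally_integrable \<phi>] by (simp add: left_diff_distrib)
  qed
  then show "AE x in lebesgue. rep_L2 g x = rep_L2 g' x" by (rule eventually_mono) simp
qed

lemma weak_deriv_eq: "has_weak_deriv k f g \<Longrightarrow> weak_deriv k f = g"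
  unfolding weak_deriv_def using has_weak_deriv_unique by (intro the_equality)

lemma has_weak_deriv_weak_deriv: "f \<in> sobolev k \<Longrightarrow> j \<le> k \<Longrightarrow> has_weak_deriv j f (weak_deriv j f)"
  using weak_deriv_eq by (force simp: sobolev_def)

text \<open>Testing the derivative of order \<open>k\<close> with \<open>\<phi>'\<close> is testing the function itself with the
  derivative of order \<open>k + 1\<close> of \<open>\<phi>\<close>. Thus facts about \<open>H\<^sup>1\<close> apply to each derivative
  of a function in \<open>H\<^sup>3\<close>.\<close>

lemma has_weak_deriv_step:
  assumes f: "has_weak_deriv k f g" and h: "has_weak_deriv (Suc k) f h"
  shows "has_weak_deriv 1 g h"
  unfolding has_weak_deriv_def
proof (intro allI impI)
  fix \<phi> assume \<phi>: "test_function \<phi>"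
  have "(-1) ^ k * (LINT x|lebesgue. rep_L2 g x * deriv \<phi> x) = (LINT x|lebesgue. rep_L2 f x * (deriv ^^ k) (deriv \<phi>) x)"
    by (rule has_weak_derivD[OF f test_functionD(2)[OF \<phi>], symmetric])
  also have "(deriv ^^ k) (deriv \<phi>) = (deriv ^^ Suc k) \<phi>" by (simp add: funpow_swap1)
  also have "(LINT x|lebesgue. rep_L2 f x * (deriv ^^ Suc k) \<phi> x) = (-1) ^ Suc k * (LINT x|lebesgue. rep_L2 h x * \<phi> x)"
    by (rule has_weak_derivD[OF h \<phi>])
  finally have "(-1) ^ k * (LINT x|lebesgue. rep_L2 g x * deriv \<phi> x) = (-1) ^ k * (- (LINT x|lebesgue. rep_L2 h x * \<phi> x))"
    by simp
  then have "(LINT x|lebesgue. rep_L2 g x * deriv \<phi> x) = - (LINT x|lebesgue. rep_L2 h x * \<phi> x)"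
    by (subst (asm) mult_cancel_left) simp
  then show "(LINT x|lebesgue. rep_L2 g x * (deriv ^^ 1) \<phi> x) = (-1) ^ 1 * (LINT x|lebesgue. rep_L2 h x * \<phi> x)"
    by simp
qed

lemma H1_representative:
  assumes "has_weak_deriv 1 f g"
  obtains F where "primitive_of F (rep_L2 g)" "AE x in lebesgue. rep_L2 f x = F x" "square_integrable F"
proof -
  obtain F where F: "primitive_of F (rep_L2 g)" "AE x in lebesgue. rep_L2 f x = F x"
  proof (rule du_Bois_Reymond[of "rep_L2 f" "rep_L2 g"])
    show "(LINT x|lebesgue. rep_L2 f x * deriv \<phi> x) = - (LINT x|lebesgue. rep_L2 g x * \<phi> x)"
      if "test_function \<phi>" for \<phi>
      using assms that unfolding has_weak_deriv_def by simp
  qed (auto intro: rep_L2_locally_integrable)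
  have "square_integrable F"
    by (rule square_integrable_bound[OF square_integrable_rep[of f] primitive_of_measurable[OF F(1)], of 1])
      (use F(2) in auto)
  with F show ?thesis by (rule that)
qed

lemma H1_integration_by_parts:
  assumes "has_weak_deriv 1 f f'" "has_weak_deriv 1 g g'"
  shows "inner f' g + inner f g' = 0"
proof -
  obtain F where F: "primitive_of F (rep_L2 f')" "AE x in lebesgue. rep_L2 f x = F x" "square_integrable F"
    using H1_representative[OF assms(1)] .
  obtain G where G: "primitive_of G (rep_L2 g')" "AE x in lebesgue. rep_L2 g x = G x" "square_integrable G"
    using H1_representative[OF assms(2)] .
  note [measurable] = primitive_of_measurable[OF F(1)] primitive_of_measurable[OF G(1)]
  have i: "integrable lebesgue (\<lambda>x. rep_L2 f' x * G x)" "integrable lebesgue (\<lambda>x. F x * rep_L2 g' x)"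
    by (intro square_integrable_mult square_integrable_rep F G)+
  have "(LINT x|lebesgue. rep_L2 f' x * G x + F x * rep_L2 g' x) = 0"
    by (rule integral_of_total_derivative[OF primitive_of_mult[OF F(1) G(1)]])
      (intro square_integrable_mult F G Bochner_Integration.integrable_add i)+
  moreover have "inner f' g = (LINT x|lebesgue. rep_L2 f' x * G x)"
    unfolding inner_L2_rep by (rule integral_cong_AE) (use G(2) in \<open>auto elim: eventually_mono\<close>)
  moreover have "inner f g' = (LINT x|lebesgue. F x * rep_L2 g' x)"
    unfolding inner_L2_rep by (rule integral_cong_AE) (use F(2) in \<open>auto elim: eventually_mono\<close>)
  ultimately show ?thesis using i by simp
qed

text \<open>\<open>F\<^sup>2\<close> has derivative \<open>2 F g\<close> and is small somewhere to the left of \<open>x\<close>; the rest is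
  Cauchy--Schwarz.\<close>

lemma H1_sup_bound:
  assumes "has_weak_deriv 1 f g" and F: "primitive_of F (rep_L2 g)" "AE x in lebesgue. rep_L2 f x = F x" "square_integrable F"
  shows "(F x)\<^sup>2 \<le> 2 * norm f * norm g"
proof (rule field_le_epsilon)
  fix e :: real assume "e > 0"
  have iF: "integrable lebesgue (\<lambda>x. (F x)\<^sup>2)" using F(3) by (simp add: square_integrable_def)
  obtain a where a: "a \<le> x" "\<bar>(F a)\<^sup>2\<bar> < e"
    using small_value_on_infinite_measure[OF iF _ emeasure_lebesgue_half_lines(2)[of x] \<open>e > 0\<close>] by auto
  note [measurable] = primitive_of_measurable[OF F(1)]
  have ig: "integrable lebesgue (\<lambda>x. F x * rep_L2 g x)"
    by (intro square_integrable_mult square_integrable_rep F)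
  have "(F x)\<^sup>2 - (F a)\<^sup>2 = (LINT y|lebesgue_on {a..x}. 2 * (F y * rep_L2 g y))"
    using primitive_ofD(2)[OF primitive_of_mult[OF F(1) F(1)] a(1)] by (simp add: power2_eq_square mult.commute)
  also have "\<dots> = (LINT y|lebesgue. indicator {a..x} y * (2 * (F y * rep_L2 g y)))"
    by (subst integral_restrict_space) (simp, simp only: set_lebesgue_integral_def real_scaleR_def)
  also have "\<dots> \<le> (LINT y|lebesgue. 2 * \<bar>F y * rep_L2 g y\<bar>)"
  proof (rule integral_mono)
    show "integrable lebesgue (\<lambda>y. indicator {a..x} y * (2 * (F y * rep_L2 g y)))"
      using integrable_mult_indicator[OF _ integrable_mult_right[OF ig, of 2], of "{a..x}"] by simp
    show "integrable lebesgue (\<lambda>y. 2 * \<bar>F y * rep_L2 g y\<bar>)"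
      using integrable_abs[OF ig] by simp
  qed (auto simp: indicator_def abs_mult[symmetric])
  also have "\<dots> = 2 * (LINT y|lebesgue. \<bar>F y\<bar> * \<bar>rep_L2 g y\<bar>)" by (simp add: abs_mult)
  also have "(LINT y|lebesgue. \<bar>F y\<bar> * \<bar>rep_L2 g y\<bar>) \<le> norm f * norm g"
  proof -
      note s = square_integrable_abs[OF square_integrable_rep]
    have "(LINT y|lebesgue. \<bar>F y\<bar> * \<bar>rep_L2 g y\<bar>) = inner (L2_class (\<lambda>y. \<bar>rep_L2 f y\<bar>)) (L2_class (\<lambda>y. \<bar>rep_L2 g y\<bar>))"
      unfolding inner_L2_rep
    proof (rule integral_cong_AE)
      show "AE y in lebesgue. \<bar>F y\<bar> * \<bar>rep_L2 g y\<bar> = rep_L2 (L2_class (\<lambda>y. \<bar>rep_L2 f y\<bar>)) y * rep_L2 (L2_class (\<lambda>y. \<bar>rep_L2 g y\<bar>)) y"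
        using F(2) rep_L2_class[OF s[of f]] rep_L2_class[OF s[of g]] by eventually_elim simp
    qed auto
    also have "\<dots> \<le> norm (L2_class (\<lambda>y. \<bar>rep_L2 f y\<bar>)) * norm (L2_class (\<lambda>y. \<bar>rep_L2 g y\<bar>))"
      by (rule norm_cauchy_schwarz)
    also have "\<dots> \<le> norm f * norm g"
      using norm_L2_class_mono[OF s square_integrable_rep, of f f] norm_L2_class_mono[OF s square_integrable_rep, of g g]
      by (intro mult_mono) (auto simp: L2_class_rep)
    finally show ?thesis .
  qed
  finally show "(F x)\<^sup>2 \<le> 2 * norm f * norm g + e" using a(2) by simp
qed

lemma H1_AE_bound:
  assumes "has_weak_deriv 1 f g"
  shows "AE x in lebesgue. (rep_L2 f x)\<^sup>2 \<le> 2 * norm f * norm g"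
proof -
  obtain F where F: "primitive_of F (rep_L2 g)" "AE x in lebesgue. rep_L2 f x = F x" "square_integrable F"
    using H1_representative[OF assms(1)] .
  show ?thesis using F(2)
  proof eventually_elim
    case (elim x)
    then show ?case using H1_sup_bound[OF assms F, of x] by simp
  qed
qed

text \<open>The sup bound puts \<open>f f'\<close> into \<open>L\<^sup>2\<close> with norm at most the squared \<open>H\<^sup>1\<close> norm, which
  makes the nonlinearity of a mild solution integrable in time. The nonlinearity does no work because
  \<open>3 f\<^sup>2 f'\<close> is the derivative of the integrable function \<open>f\<^sup>3\<close>.\<close>

lemma H1_burgers_term:
  assumes fg: "has_weak_deriv 1 f g"
  shows "square_integrable (\<lambda>x. rep_L2 f x * rep_L2 g x)"
    and "norm (mult_L2 f g) \<le> (norm f)\<^sup>2 + (norm g)\<^sup>2"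
    and "inner (mult_L2 f g) f = 0"
proof -
  define m where "m = 2 * norm f * norm g"
  have m0: "m \<ge> 0" by (simp add: m_def)
  have m1: "m \<le> (norm f)\<^sup>2 + (norm g)\<^sup>2"
    using sum_squares_bound[of "norm f" "norm g"] by (simp add: m_def)
  have b: "AE x in lebesgue. \<bar>rep_L2 f x\<bar> \<le> sqrt m"
    using H1_AE_bound[OF fg] by (rule eventually_mono) (simp add: m_def real_le_rsqrt)
  have b2: "AE x in lebesgue. \<bar>rep_L2 f x * rep_L2 g x\<bar> \<le> \<bar>sqrt m * rep_L2 g x\<bar>"
    using b by (rule eventually_mono) (simp add: abs_mult mult_right_mono m0)
  show sq: "square_integrable (\<lambda>x. rep_L2 f x * rep_L2 g x)"
    by (rule square_integrable_bound[OF square_integrable_rep[of g] _ b2]) measurable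
  have "(norm (mult_L2 f g))\<^sup>2 \<le> m * (norm g)\<^sup>2"
    unfolding mult_L2_def norm_L2_class[OF sq] norm_L2_rep[of g] integral_mult_right_zero[symmetric]
  proof (rule integral_mono_AE)
    show "AE x in lebesgue. (rep_L2 f x * rep_L2 g x)\<^sup>2 \<le> m * (rep_L2 g x)\<^sup>2"
      using H1_AE_bound[OF fg]
      by (rule eventually_mono) (simp add: power_mult_distrib mult_right_mono m_def)
  qed (use sq square_integrable_rep[of g] in \<open>auto simp: square_integrable_def\<close>)
  also have "\<dots> \<le> ((norm f)\<^sup>2 + (norm g)\<^sup>2) * ((norm f)\<^sup>2 + (norm g)\<^sup>2)"
    using m0 m1 by (intro mult_mono) auto
  finally have "(norm (mult_L2 f g))\<^sup>2 \<le> ((norm f)\<^sup>2 + (norm g)\<^sup>2)\<^sup>2" by (simp add: power2_eq_square)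
  then show "norm (mult_L2 f g) \<le> (norm f)\<^sup>2 + (norm g)\<^sup>2" by (rule power2_le_imp_le) simp
  obtain F where F: "primitive_of F (rep_L2 g)" "AE x in lebesgue. rep_L2 f x = F x" "square_integrable F"
    using H1_representative[OF fg] .
  note [measurable] = primitive_of_measurable[OF F(1)]
  have Fb: "\<bar>F x\<bar> \<le> sqrt m" for x
    using H1_sup_bound[OF fg F, of x] by (simp add: m_def real_le_rsqrt)
  have F2: "square_integrable (\<lambda>x. F x * F x)"
  proof (rule square_integrable_bound[OF F(3)])
    show "AE x in lebesgue. \<bar>F x * F x\<bar> \<le> \<bar>sqrt m * F x\<bar>"
      using mult_right_mono[OF Fb abs_ge_zero] m0 by (intro AE_I2) (simp add: abs_mult del: abs_mult_self_eq)
  qed measurable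
  define q where "q x = (rep_L2 g x * F x + F x * rep_L2 g x) * F x + F x * F x * rep_L2 g x" for x
  have q: "q = (\<lambda>x. 3 * ((F x * F x) * rep_L2 g x))" by (rule ext) (simp add: q_def)
  have P: "primitive_of (\<lambda>x. F x * F x * F x) q"
    unfolding q_def[abs_def] by (rule primitive_of_mult[OF primitive_of_mult[OF F(1) F(1)] F(1)])
  have "integrable lebesgue q"
    unfolding q by (rule integrable_mult_right[OF square_integrable_mult[OF F2 square_integrable_rep[of g]]])
  from integral_of_total_derivative[OF P square_integrable_mult[OF F2 F(3)] this]
  have "(LINT x|lebesgue. q x) = 0" .
  then have "(LINT x|lebesgue. (F x * F x) * rep_L2 g x) = 0" by (simp add: q)
  moreover have "inner (mult_L2 f g) f = (LINT x|lebesgue. (F x * F x) * rep_L2 g x)"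
    unfolding inner_L2_rep
  proof (rule integral_cong_AE)
    show "AE x in lebesgue. rep_L2 (mult_L2 f g) x * rep_L2 f x = (F x * F x) * rep_L2 g x"
      using F(2) rep_L2_class[OF sq] unfolding mult_L2_def[symmetric] by eventually_elim simp
  qed auto
  ultimately show "inner (mult_L2 f g) f = 0" by simp
qed

text \<open>Two integrations by parts: the third derivative contributes the pairing of the second with the
  first, which vanishes, and the second contributes \<open>-\<parallel>f'\<parallel>\<^sup>2\<close>.\<close>

lemma H3_dissipation:
  assumes "f \<in> sobolev 3"
  shows "inner (- weak_deriv 3 f + weak_deriv 2 f) f = - (norm (weak_deriv 1 f))\<^sup>2"
proof -
  note w = has_weak_deriv_weak_deriv[OF assms]
  have 1: "has_weak_deriv 1 f (weak_deriv 1 f)" by (rule w) simp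
  have 2: "has_weak_deriv 1 (weak_deriv 1 f) (weak_deriv 2 f)"
    using has_weak_deriv_step[OF w[of 1], of "weak_deriv 2 f"] w[of 2] by (simp add: numeral_2_eq_2)
  have 3: "has_weak_deriv 1 (weak_deriv 2 f) (weak_deriv 3 f)"
    using has_weak_deriv_step[OF w[of 2], of "weak_deriv 3 f"] w[of 3] by (simp add: numeral_3_eq_3 numeral_2_eq_2)
  show ?thesis
    using H1_integration_by_parts[OF 3 1] H1_integration_by_parts[OF 2 1] H1_integration_by_parts[OF 2 2]
    by (simp add: inner_add_left inner_diff_left inner_diff_right power2_norm_eq_inner inner_commute)
qed

section \<open>Coercivity of the KdV--Burgers operator\<close>

lemma square_integrable_mult_L_infty:
  assumes a: "L_infty a" and f: "square_integrable f"
  shows "square_integrable (\<lambda>x. a x * f x)"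
proof -
  obtain M where M: "AE x in lebesgue. \<bar>a x\<bar> \<le> M" and [measurable]: "a \<in> borel_measurable lebesgue"
    using a by (auto simp: L_infty_def)
  note [measurable] = square_integrableD(1)[OF f]
  show ?thesis
  proof (rule square_integrable_bound[OF f])
    show "AE x in lebesgue. \<bar>a x * f x\<bar> \<le> \<bar>M * f x\<bar>"
      using M by (rule eventually_mono) (auto simp: abs_mult intro!: mult_right_mono)
  qed measurable
qed

lemma rep_mult_fun:
  "L_infty a \<Longrightarrow> AE x in lebesgue. rep_L2 (mult_fun a f) x = a x * rep_L2 f x"
  unfolding mult_fun_def by (intro rep_L2_class square_integrable_mult_L_infty square_integrable_rep)

lemma inner_mult_fun:
  assumes "L_infty a"
  shows "inner (mult_fun a f) g = (LINT x|lebesgue. a x * rep_L2 f x * rep_L2 g x)"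
    and "integrable lebesgue (\<lambda>x. a x * rep_L2 f x * rep_L2 g x)"
proof -
  have [measurable]: "a \<in> borel_measurable lebesgue" using assms by (simp add: L_infty_def)
  show "inner (mult_fun a f) g = (LINT x|lebesgue. a x * rep_L2 f x * rep_L2 g x)"
    unfolding inner_L2_rep
    by (rule integral_cong_AE) (use rep_mult_fun[OF assms, of f] in \<open>auto elim: eventually_mono\<close>)
  show "integrable lebesgue (\<lambda>x. a x * rep_L2 f x * rep_L2 g x)"
    by (intro square_integrable_mult square_integrable_mult_L_infty assms square_integrable_rep)
qed

lemma bounded_linear_mult_fun:
  assumes a: "L_infty a"
  shows "bounded_linear (mult_fun a)"
proof -
  obtain M where M: "AE x in lebesgue. \<bar>a x\<bar> \<le> M"
    using a by (auto simp: L_infty_def)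
  note s = square_integrable_mult_L_infty[OF a square_integrable_rep]
  show ?thesis
  proof (rule bounded_linear_intro[where K="\<bar>M\<bar>"])
    fix f g :: L2 and c :: real
    have "mult_fun a (f + g) = L2_class (\<lambda>x. a x * rep_L2 f x + a x * rep_L2 g x)"
      unfolding mult_fun_def
      by (rule L2_class_cong[OF s square_integrable_add[OF s s]])
        (use rep_L2_add[of f g] in \<open>auto elim!: eventually_mono simp: distrib_left\<close>)
    then show "mult_fun a (f + g) = mult_fun a f + mult_fun a g"
      by (simp add: L2_class_add[OF s s] mult_fun_def)
    have "mult_fun a (c *\<^sub>R f) = L2_class (\<lambda>x. c * (a x * rep_L2 f x))"
      unfolding mult_fun_def
      by (rule L2_class_cong[OF s square_integrable_scale[OF s]])
        (use rep_L2_scale[of c f] in \<open>auto elim!: eventually_mono\<close>)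
    then show "mult_fun a (c *\<^sub>R f) = c *\<^sub>R mult_fun a f"
      by (simp add: L2_class_scale[OF s] mult_fun_def)
    have "(norm (mult_fun a f))\<^sup>2 \<le> \<bar>M\<bar>\<^sup>2 * (norm f)\<^sup>2"
      unfolding mult_fun_def norm_L2_class[OF s] norm_L2_rep[of f] integral_mult_right_zero[symmetric]
    proof (rule integral_mono_AE)
      show "AE x in lebesgue. (a x * rep_L2 f x)\<^sup>2 \<le> \<bar>M\<bar>\<^sup>2 * (rep_L2 f x)\<^sup>2"
        using M
      proof eventually_elim
        case (elim x)
        then have "\<bar>a x\<bar>\<^sup>2 \<le> \<bar>M\<bar>\<^sup>2" by (intro power_mono) auto
        then show ?case unfolding power_mult_distrib power2_abs by (rule mult_right_mono) simp
      qed
    qed (use s[of f] square_integrable_rep[of f] in \<open>auto simp: square_integrable_def\<close>)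
    then have "(norm (mult_fun a f))\<^sup>2 \<le> (norm f * \<bar>M\<bar>)\<^sup>2" by (simp add: power_mult_distrib mult.commute)
    then show "norm (mult_fun a f) \<le> norm f * \<bar>M\<bar>" by (rule power2_le_imp_le) simp
  qed
qed

lemma L_infty_abs: "L_infty a \<Longrightarrow> L_infty (\<lambda>x. \<bar>a x\<bar>)"
  by (auto simp: L_infty_def)

lemma inner_mult_fun_abs:
  assumes "L_infty a"
  shows "inner (mult_fun (\<lambda>x. \<bar>a x\<bar>) f) f = (LINT x|lebesgue. \<bar>a x\<bar> * (rep_L2 f x)\<^sup>2)"
    and "integrable lebesgue (\<lambda>x. \<bar>a x\<bar> * (rep_L2 f x)\<^sup>2)"
  using inner_mult_fun[OF L_infty_abs[OF assms], of f f] by (simp_all add: power2_eq_square mult.assoc)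

lemma inner_mult_fun_abs_nonneg:
  assumes "L_infty a"
  shows "0 \<le> inner (mult_fun (\<lambda>x. \<bar>a x\<bar>) f) f"
  unfolding inner_mult_fun_abs[OF assms] by (rule Bochner_Integration.integral_nonneg) simp

lemma inner_mult_fun_weighted_Young:
  assumes a: "L_infty a" and k: "k > 0"
  shows "\<bar>inner (mult_fun a f) g\<bar>
    \<le> k / 2 * inner (mult_fun (\<lambda>x. \<bar>a x\<bar>) f) f + 1 / (2 * k) * inner (mult_fun (\<lambda>x. \<bar>a x\<bar>) g) g"
proof -
  have "\<bar>inner (mult_fun a f) g\<bar> \<le> (LINT x|lebesgue. \<bar>a x * rep_L2 f x * rep_L2 g x\<bar>)"
    unfolding inner_mult_fun[OF a] by (rule integral_abs_bound)
  also have "\<dots> \<le> (LINT x|lebesgue. k / 2 * (\<bar>a x\<bar> * (rep_L2 f x)\<^sup>2) + 1 / (2 * k) * (\<bar>a x\<bar> * (rep_L2 g x)\<^sup>2))"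
  proof (rule integral_mono)
    fix x
    define u where "u = sqrt k * \<bar>rep_L2 f x\<bar>"
    define w where "w = \<bar>rep_L2 g x\<bar> / sqrt k"
    have "2 * u * w \<le> u\<^sup>2 + w\<^sup>2" by (rule sum_squares_bound)
    then have "\<bar>rep_L2 f x\<bar> * \<bar>rep_L2 g x\<bar> \<le> k / 2 * (rep_L2 f x)\<^sup>2 + 1 / (2 * k) * (rep_L2 g x)\<^sup>2"
      using k by (simp add: u_def w_def power_mult_distrib power_divide field_simps)
    from mult_left_mono[OF this, of "\<bar>a x\<bar>"]
    show "\<bar>a x * rep_L2 f x * rep_L2 g x\<bar> \<le> k / 2 * (\<bar>a x\<bar> * (rep_L2 f x)\<^sup>2) + 1 / (2 * k) * (\<bar>a x\<bar> * (rep_L2 g x)\<^sup>2)"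
      by (simp add: abs_mult algebra_simps)
  next
    show "integrable lebesgue (\<lambda>x. \<bar>a x * rep_L2 f x * rep_L2 g x\<bar>)"
      by (rule integrable_abs[OF inner_mult_fun(2)[OF a]])
    show "integrable lebesgue (\<lambda>x. k / 2 * (\<bar>a x\<bar> * (rep_L2 f x)\<^sup>2) + 1 / (2 * k) * (\<bar>a x\<bar> * (rep_L2 g x)\<^sup>2))"
      by (intro Bochner_Integration.integrable_add integrable_mult_right inner_mult_fun_abs(2)[OF a])
  qed
  also have "\<dots> = k / 2 * inner (mult_fun (\<lambda>x. \<bar>a x\<bar>) f) f + 1 / (2 * k) * inner (mult_fun (\<lambda>x. \<bar>a x\<bar>) g) g"
    unfolding inner_mult_fun_abs(1)[OF a]
    by (subst Bochner_Integration.integral_add)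
      (intro integrable_mult_right inner_mult_fun_abs(2)[OF a] | simp only: integral_mult_right_zero)+
  finally show ?thesis .
qed

text \<open>Young's inequality for \<open>b/\<mu>\<close> and \<open>1\<close>, rescaled. In this form \<open>p = 1\<close> is the case of
  equality.\<close>

lemma Young_against_constant:
  fixes p b \<mu> :: real
  assumes p: "1 \<le> p" and b: "0 \<le> b" and \<mu>: "0 < \<mu>"
  shows "b \<le> 1 / p * \<mu> powr (1 - p) * b powr p + (1 - 1 / p) * \<mu>"
proof (cases "p = 1")
  case True
  then show ?thesis using b \<mu> by simp
next
  case False
  define q where "q = p / (p - 1)"
  have p1: "p > 1" using p False by simp
  have q: "q > 1" "1 / p + 1 / q = 1" using p1 by (auto simp: q_def field_simps)
  have "(b / \<mu>) * 1 \<le> (b / \<mu>) powr p / p + 1 powr q / q"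
    by (rule Youngs_inequality) (use p1 q b \<mu> in auto)
  then have "\<mu> * (b / \<mu>) \<le> \<mu> * ((b / \<mu>) powr p / p + 1 / q)"
    using \<mu> by (intro mult_left_mono) auto
  moreover have "1 / q = 1 - 1 / p" using q by simp
  moreover have "\<mu> * (b / \<mu>) powr p = \<mu> powr (1 - p) * b powr p"
    using b \<mu> by (simp add: powr_divide powr_diff)
  ultimately show ?thesis using \<mu> by (simp add: distrib_left mult.commute)
qed

text \<open>The coefficient of \<open>\<parallel>v\<parallel>\<^sup>2\<close> in the bound of \<open>\<integral>|\<beta>| v\<^sup>2\<close> in which \<open>\<parallel>v'\<parallel>\<^sup>2\<close> has
  coefficient one.\<close>

definition embedding_coeff :: "real \<Rightarrow> (real \<Rightarrow> real) \<Rightarrow> real" where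
  "embedding_coeff p \<beta> = (2 * p - 1) / (2 * p) * (2 / p) powr (1 / (2 * p - 1))
                          * L_p_norm p \<beta> powr (2 * p / (2 * p - 1))"

text \<open>Pointwise, \<open>|\<beta>| \<le> \<mu>\<^sup>1\<^sup>-\<^sup>p |\<beta>|\<^sup>p / p + (1 - 1/p) \<mu>\<close>. Against \<open>v\<^sup>2\<close> the first term is
  controlled by the sup bound \<open>v\<^sup>2 \<le> 2 \<parallel>v\<parallel> \<parallel>v'\<parallel>\<close>, the second by \<open>\<parallel>v\<parallel>\<^sup>2\<close>, and the product
  \<open>\<parallel>v\<parallel> \<parallel>v'\<parallel>\<close> is then split so that \<open>\<parallel>v'\<parallel>\<^sup>2\<close> gets coefficient one.\<close>

lemma weighted_L2_embedding:
  assumes p: "1 \<le> p" and \<beta>: "L_p p \<beta>" and vg: "has_weak_deriv 1 v g"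
  shows "integrable lebesgue (\<lambda>x. \<bar>\<beta> x\<bar> * (rep_L2 v x)\<^sup>2)"
    and "(LINT x|lebesgue. \<bar>\<beta> x\<bar> * (rep_L2 v x)\<^sup>2) \<le> (norm g)\<^sup>2 + embedding_coeff p \<beta> * (norm v)\<^sup>2"
proof -
  define m where "m = 2 * norm v * norm g"
  define B where "B = L_p_norm p \<beta>"
  have [measurable]: "\<beta> \<in> borel_measurable lebesgue" and i\<beta>: "integrable lebesgue (\<lambda>x. \<bar>\<beta> x\<bar> powr p)"
    using \<beta> by (auto simp: L_p_def)
  have I0: "0 \<le> (LINT x|lebesgue. \<bar>\<beta> x\<bar> powr p)" by (rule Bochner_Integration.integral_nonneg) simp
  have B0: "0 \<le> B" by (simp add: B_def L_p_norm_def)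
  have Bp: "B powr p = (LINT x|lebesgue. \<bar>\<beta> x\<bar> powr p)"
    using p I0 by (simp add: B_def L_p_norm_def powr_powr)
  have bd: "AE x in lebesgue. (rep_L2 v x)\<^sup>2 \<le> m" using H1_AE_bound[OF vg] by (simp add: m_def)
  have m0: "0 \<le> m" by (simp add: m_def)
  have iv: "integrable lebesgue (\<lambda>x. (rep_L2 v x)\<^sup>2)" using square_integrable_rep[of v] by (simp add: square_integrable_def)
  have ibv: "integrable lebesgue (\<lambda>x. \<bar>\<beta> x\<bar> powr p * (rep_L2 v x)\<^sup>2)"
  proof (rule Bochner_Integration.integrable_bound[OF integrable_mult_right[OF i\<beta>, of m]])
    show "AE x in lebesgue. norm (\<bar>\<beta> x\<bar> powr p * (rep_L2 v x)\<^sup>2) \<le> norm (m * \<bar>\<beta> x\<bar> powr p)"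
      using bd by (rule eventually_mono) (simp add: abs_mult m0 mult.commute[of m] mult_left_mono)
  qed measurable
  have ibvle: "(LINT x|lebesgue. \<bar>\<beta> x\<bar> powr p * (rep_L2 v x)\<^sup>2) \<le> m * B powr p"
    unfolding Bp integral_mult_right_zero[symmetric]
    by (rule integral_mono_AE[OF ibv integrable_mult_right[OF i\<beta>]])
      (use bd in \<open>auto elim!: eventually_mono intro: mult_left_mono simp: mult.commute[of m]\<close>)
  have split: "integrable lebesgue (\<lambda>x. \<bar>\<beta> x\<bar> * (rep_L2 v x)\<^sup>2) \<and> (LINT x|lebesgue. \<bar>\<beta> x\<bar> * (rep_L2 v x)\<^sup>2)
     \<le> 1 / p * \<mu> powr (1 - p) * (m * B powr p) + (1 - 1 / p) * \<mu> * (norm v)\<^sup>2" if \<mu>: "\<mu> > 0" for \<mu>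
  proof -
    define w where "w x = 1 / p * \<mu> powr (1 - p) * (\<bar>\<beta> x\<bar> powr p * (rep_L2 v x)\<^sup>2) + (1 - 1 / p) * \<mu> * (rep_L2 v x)\<^sup>2" for x
    have iw: "integrable lebesgue w"
      unfolding w_def by (intro Bochner_Integration.integrable_add integrable_mult_right ibv iv)
    have le: "\<bar>\<beta> x\<bar> * (rep_L2 v x)\<^sup>2 \<le> w x" for x
      using mult_right_mono[OF Young_against_constant[OF p abs_ge_zero \<mu>, of "\<beta> x"], of "(rep_L2 v x)\<^sup>2"]
      by (simp add: w_def distrib_right mult.assoc)
    have i: "integrable lebesgue (\<lambda>x. \<bar>\<beta> x\<bar> * (rep_L2 v x)\<^sup>2)"
    proof (rule Bochner_Integration.integrable_bound[OF iw])
      show "AE x in lebesgue. norm (\<bar>\<beta> x\<bar> * (rep_L2 v x)\<^sup>2) \<le> norm (w x)"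
        using le by (intro AE_I2) (simp add: abs_mult order_trans[OF _ abs_ge_self])
    qed measurable
    have "(LINT x|lebesgue. \<bar>\<beta> x\<bar> * (rep_L2 v x)\<^sup>2) \<le> (LINT x|lebesgue. w x)"
      by (rule integral_mono[OF i iw le])
    also have "\<dots> = 1 / p * \<mu> powr (1 - p) * (LINT x|lebesgue. \<bar>\<beta> x\<bar> powr p * (rep_L2 v x)\<^sup>2) + (1 - 1 / p) * \<mu> * (norm v)\<^sup>2"
      unfolding w_def norm_L2_rep integral_mult_right_zero[symmetric]
      by (intro Bochner_Integration.integral_add integrable_mult_right ibv iv)
    also have "\<dots> \<le> 1 / p * \<mu> powr (1 - p) * (m * B powr p) + (1 - 1 / p) * \<mu> * (norm v)\<^sup>2"
      using ibvle p by (intro add_right_mono mult_left_mono) auto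
    finally show ?thesis using i by simp
  qed
  from split[of 1] show "integrable lebesgue (\<lambda>x. \<bar>\<beta> x\<bar> * (rep_L2 v x)\<^sup>2)" by simp
  show "(LINT x|lebesgue. \<bar>\<beta> x\<bar> * (rep_L2 v x)\<^sup>2) \<le> (norm g)\<^sup>2 + embedding_coeff p \<beta> * (norm v)\<^sup>2"
  proof (cases "B = 0")
    case True
    then have "(LINT x|lebesgue. \<bar>\<beta> x\<bar> powr p) = 0" using Bp p by simp
    then have "AE x in lebesgue. \<bar>\<beta> x\<bar> powr p = 0"
      using integral_nonneg_eq_0_iff_AE[OF i\<beta>] by simp
    then have "AE x in lebesgue. \<bar>\<beta> x\<bar> * (rep_L2 v x)\<^sup>2 = 0"
      by (rule eventually_mono) simp
    then have "(LINT x|lebesgue. \<bar>\<beta> x\<bar> * (rep_L2 v x)\<^sup>2) = 0" by (rule integral_eq_zero_AE)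
    moreover have "0 \<le> embedding_coeff p \<beta>" using p by (simp add: embedding_coeff_def)
    ultimately show ?thesis by simp
  next
    case False
    with B0 have Bpos: "B > 0" by simp
    \<comment> \<open>a minimiser of the coefficient \<open>\<kappa>\<^sup>2 + (1 - 1/p) \<mu>\<close> that results below, where \<open>\<kappa>\<^sup>2\<close> is
      proportional to \<open>\<mu>\<^sup>2\<^sup>-\<^sup>2\<^sup>p\<close>\<close>
    define \<mu> where "\<mu> = (2 / p) powr (1 / (2 * p - 1)) * B powr (2 * p / (2 * p - 1))"
    have \<mu>0: "\<mu> > 0" using Bpos p by (simp add: \<mu>_def)
    have \<mu>p: "\<mu> powr (2 * p - 1) = 2 / p * B powr (2 * p)"
      using p Bpos by (simp add: \<mu>_def powr_mult powr_powr)
    define \<kappa> where "\<kappa> = 1 / p * \<mu> powr (1 - p) * B powr p"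
    have "\<kappa>\<^sup>2 = 1 / p\<^sup>2 * \<mu> powr (2 * (1 - p)) * B powr (2 * p)"
      using \<mu>0 Bpos by (simp add: \<kappa>_def power_mult_distrib power_divide powr_power mult.commute)
    also have "B powr (2 * p) = p / 2 * \<mu> powr (2 * p - 1)" using \<mu>p p by simp
    also have "1 / p\<^sup>2 * \<mu> powr (2 * (1 - p)) * (p / 2 * \<mu> powr (2 * p - 1)) = 1 / (2 * p) * (\<mu> powr (2 * (1 - p)) * \<mu> powr (2 * p - 1))"
      using p by (simp add: power2_eq_square)
    also have "\<mu> powr (2 * (1 - p)) * \<mu> powr (2 * p - 1) = \<mu>"
      using \<mu>0 by (simp add: powr_add[symmetric])
    finally have \<kappa>2: "\<kappa>\<^sup>2 = \<mu> / (2 * p)" by simp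
    have "(LINT x|lebesgue. \<bar>\<beta> x\<bar> * (rep_L2 v x)\<^sup>2) \<le> \<kappa> * m + (1 - 1 / p) * \<mu> * (norm v)\<^sup>2"
      using split[OF \<mu>0] by (simp add: \<kappa>_def mult.commute mult.left_commute)
    also have "\<kappa> * m \<le> \<kappa>\<^sup>2 * (norm v)\<^sup>2 + (norm g)\<^sup>2"
      using sum_squares_bound[of "\<kappa> * norm v" "norm g"] by (simp add: m_def power_mult_distrib mult.commute mult.left_commute)
    also have "\<kappa>\<^sup>2 * (norm v)\<^sup>2 + (norm g)\<^sup>2 + (1 - 1 / p) * \<mu> * (norm v)\<^sup>2 = (norm g)\<^sup>2 + (2 * p - 1) / (2 * p) * \<mu> * (norm v)\<^sup>2"
      unfolding \<kappa>2 using p by (simp add: field_simps)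
    also have "(2 * p - 1) / (2 * p) * \<mu> = embedding_coeff p \<beta>"
      by (simp add: embedding_coeff_def \<mu>_def B_def)
    finally show ?thesis by simp
  qed
qed

lemma decay_rate_eq: "decay_rate \<alpha>\<^sub>0 \<alpha> p \<beta> = min (2 * (\<alpha>\<^sub>0 - \<alpha> - embedding_coeff p \<beta>)) 1"
  by (simp add: decay_rate_def embedding_coeff_def)

text \<open>The exponent \<open>2p/(2p-1)\<close> is the reciprocal of \<open>1 - 1/(2p)\<close>, so the smallness assumption
  says exactly that the embedding coefficient is below \<open>\<alpha>\<^sub>0 - \<alpha>\<close>.\<close>

lemma decay_rate_pos:
  assumes p: "1 \<le> p" and "\<alpha> < \<alpha>\<^sub>0"
    and small: "L_p_norm p \<beta> < ((\<alpha>\<^sub>0 - \<alpha>) / c_const p) powr (1 - 1 / (2 * p))"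
  shows "decay_rate \<alpha>\<^sub>0 \<alpha> p \<beta> > 0"
proof -
  define B where "B = L_p_norm p \<beta>"
  have B0: "0 \<le> B" by (simp add: B_def L_p_norm_def)
  have c: "c_const p > 0" using p by (simp add: c_const_def)
  have e: "2 * p / (2 * p - 1) > 0" using p by simp
  have "B powr (2 * p / (2 * p - 1)) < (((\<alpha>\<^sub>0 - \<alpha>) / c_const p) powr (1 - 1 / (2 * p))) powr (2 * p / (2 * p - 1))"
    using small B0 e unfolding B_def[symmetric] by (intro powr_less_mono2) auto
  also have "\<dots> = ((\<alpha>\<^sub>0 - \<alpha>) / c_const p) powr ((1 - 1 / (2 * p)) * (2 * p / (2 * p - 1)))"
    by (rule powr_powr)
  also have "(1 - 1 / (2 * p)) * (2 * p / (2 * p - 1)) = 1" using p by (simp add: field_simps)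
  also have "((\<alpha>\<^sub>0 - \<alpha>) / c_const p) powr 1 = (\<alpha>\<^sub>0 - \<alpha>) / c_const p" using c assms by simp
  finally have "c_const p * B powr (2 * p / (2 * p - 1)) < \<alpha>\<^sub>0 - \<alpha>" using c by (simp add: field_simps)
  moreover have "(2 * p - 1) / (2 * p) = 1 - 1 / (2 * p)" using p by (simp add: field_simps)
  ultimately have "embedding_coeff p \<beta> < \<alpha>\<^sub>0 - \<alpha>"
    unfolding embedding_coeff_def c_const_def B_def by simp
  then show ?thesis by (simp add: decay_rate_eq)
qed

text \<open>The dissipation \<open>-\<parallel>v'\<parallel>\<^sup>2\<close> of the second-order term is spent entirely on the \<open>\<beta>\<close> part of
  the bound of \<open>c |lam|\<close>; the damping \<open>\<alpha>\<^sub>0\<close> pays for the rest. Here \<open>c |lam| v\<^sup>2\<close> is what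
  the delay term will cost.\<close>

lemma kdvb_operator_dissipative:
  assumes lam0: "L_infty lam\<^sub>0" and lam: "L_infty lam" and lower: "AE x in lebesgue. lam\<^sub>0 x \<ge> \<alpha>\<^sub>0"
    and p: "1 \<le> p" and \<beta>: "L_p p \<beta>" and c: "c \<ge> 0"
    and upper: "AE x in lebesgue. c * \<bar>lam x\<bar> \<le> \<alpha> + \<beta> x"
    and v: "v \<in> sobolev 3"
  shows "inner (kdvb_operator lam\<^sub>0 v) v + c * inner (mult_fun (\<lambda>x. \<bar>lam x\<bar>) v) v
    \<le> - (decay_rate \<alpha>\<^sub>0 \<alpha> p \<beta> / 2) * (norm v)\<^sup>2"
proof -
  define g where "g = weak_deriv 1 v"
  have g: "has_weak_deriv 1 v g" unfolding g_def by (rule has_weak_deriv_weak_deriv[OF v]) simp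
  have iv: "integrable lebesgue (\<lambda>x. (rep_L2 v x)\<^sup>2)" using square_integrable_rep[of v] by (simp add: square_integrable_def)
  have "\<alpha>\<^sub>0 * (norm v)\<^sup>2 \<le> inner (mult_fun lam\<^sub>0 v) v"
    unfolding inner_mult_fun(1)[OF lam0] norm_L2_rep integral_mult_right_zero[symmetric]
    by (rule integral_mono_AE[OF integrable_mult_right[OF iv] inner_mult_fun(2)[OF lam0]])
      (use lower in \<open>auto elim!: eventually_mono simp: power2_eq_square mult.assoc intro!: mult_right_mono\<close>)
  moreover have "c * inner (mult_fun (\<lambda>x. \<bar>lam x\<bar>) v) v \<le> \<alpha> * (norm v)\<^sup>2 + (LINT x|lebesgue. \<bar>\<beta> x\<bar> * (rep_L2 v x)\<^sup>2)"
  proof -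
    have "c * inner (mult_fun (\<lambda>x. \<bar>lam x\<bar>) v) v = (LINT x|lebesgue. c * (\<bar>lam x\<bar> * (rep_L2 v x)\<^sup>2))"
      by (simp add: inner_mult_fun_abs(1)[OF lam])
    also have "\<dots> \<le> (LINT x|lebesgue. \<alpha> * (rep_L2 v x)\<^sup>2 + \<bar>\<beta> x\<bar> * (rep_L2 v x)\<^sup>2)"
    proof (rule integral_mono_AE)
      show "AE x in lebesgue. c * (\<bar>lam x\<bar> * (rep_L2 v x)\<^sup>2) \<le> \<alpha> * (rep_L2 v x)\<^sup>2 + \<bar>\<beta> x\<bar> * (rep_L2 v x)\<^sup>2"
        using upper
      proof eventually_elim
        case (elim x)
        then have "c * \<bar>lam x\<bar> \<le> \<alpha> + \<bar>\<beta> x\<bar>" by linarith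
        from mult_right_mono[OF this, of "(rep_L2 v x)\<^sup>2"] show ?case by (simp add: distrib_right mult.assoc)
      qed
    qed (intro Bochner_Integration.integrable_add integrable_mult_right iv weighted_L2_embedding(1)[OF p \<beta> g] inner_mult_fun_abs(2)[OF lam])+
    also have "\<dots> = \<alpha> * (norm v)\<^sup>2 + (LINT x|lebesgue. \<bar>\<beta> x\<bar> * (rep_L2 v x)\<^sup>2)"
      unfolding norm_L2_rep integral_mult_right_zero[symmetric]
      by (intro Bochner_Integration.integral_add integrable_mult_right iv weighted_L2_embedding(1)[OF p \<beta> g])
    finally show ?thesis .
  qed
  moreover note weighted_L2_embedding(2)[OF p \<beta> g]
  moreover have "inner (kdvb_operator lam\<^sub>0 v) v = - (norm g)\<^sup>2 - inner (mult_fun lam\<^sub>0 v) v"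
    unfolding kdvb_operator_def inner_diff_left H3_dissipation[OF v] g_def by simp
  ultimately have "inner (kdvb_operator lam\<^sub>0 v) v + c * inner (mult_fun (\<lambda>x. \<bar>lam x\<bar>) v) v
      \<le> - (\<alpha>\<^sub>0 - \<alpha> - embedding_coeff p \<beta>) * (norm v)\<^sup>2"
    by (simp add: algebra_simps)
  also have "\<dots> \<le> - (decay_rate \<alpha>\<^sub>0 \<alpha> p \<beta> / 2) * (norm v)\<^sup>2"
  proof (rule mult_right_mono)
    have "decay_rate \<alpha>\<^sub>0 \<alpha> p \<beta> \<le> 2 * (\<alpha>\<^sub>0 - \<alpha> - embedding_coeff p \<beta>)"
      unfolding decay_rate_eq by (rule min.cobounded1)
    then show "- (\<alpha>\<^sub>0 - \<alpha> - embedding_coeff p \<beta>) \<le> - (decay_rate \<alpha>\<^sub>0 \<alpha> p \<beta> / 2)" by (simp add: field_simps)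
  qed simp
  finally show ?thesis .
qed

section \<open>Semigroups of dissipative operators\<close>

text \<open>The sets on which all \<open>T\<^sub>n\<close> are bounded by \<open>m\<close> are closed and exhaust the space, so by Baire
  one of them contains a ball; linearity carries the bound from there to the origin.\<close>

theorem uniform_boundedness_sequence:
  fixes T :: "nat \<Rightarrow> 'a::banach \<Rightarrow> 'b::real_normed_vector"
  assumes T: "\<And>n. bounded_linear (T n)" and bd: "\<And>x. \<exists>K. \<forall>n. norm (T n x) \<le> K"
  obtains K where "\<And>n x. norm (T n x) \<le> K * norm x"
proof -
  define E where "E m = {x. \<forall>n. norm (T n x) \<le> real m}" for m
  have cl: "closed (E m)" for m
    unfolding E_def
    by (intro closed_Collect_all closed_Collect_le continuous_intros linear_continuous_on[OF T])
  have UN: "(\<Union>m. E m) = UNIV"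
  proof -
    have "\<exists>m. x \<in> E m" for x
    proof -
      obtain K where K: "\<And>n. norm (T n x) \<le> K" using bd by blast
      obtain m where "K \<le> real m" using real_arch_simple by blast
      then show ?thesis using K by (auto simp: E_def intro: order_trans)
    qed
    then show ?thesis by blast
  qed
  have "\<exists>m. interior (E m) \<noteq> {}"
  proof (rule ccontr)
    assume "\<not> ?thesis"
    then have "euclidean interior_of (\<Union>(range E)) = {}"
      using cl by (intro Baire_category_alt) (auto simp: completely_metrizable_space_euclidean)
    then show False using UN by simp
  qed
  then obtain m x0 where "x0 \<in> interior (E m)" by blast
  then obtain r where r: "r > 0" "cball x0 r \<subseteq> E m"
    unfolding mem_interior_cball by blast
  have "norm (T n x) \<le> (2 * real m / r) * norm x" for n x
  proof (cases "x = 0")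
    case True
    then show ?thesis using linear_0[OF bounded_linear.linear[OF T]] by simp
  next
    case False
    define y where "y = (r / norm x) *\<^sub>R x"
    have ny: "norm y = r" using False r by (simp add: y_def)
    have "x0 + y \<in> E m" "x0 \<in> E m" using r ny by (auto simp: dist_norm intro!: subsetD[OF r(2)])
    then have "norm (T n (x0 + y)) \<le> m" "norm (T n x0) \<le> m" by (auto simp: E_def)
    moreover have "T n y = T n (x0 + y) - T n x0" by (simp add: bounded_linear.axioms linear_add[OF bounded_linear.linear[OF T]])
    ultimately have "norm (T n y) \<le> 2 * real m"
      using norm_triangle_ineq4[of "T n (x0 + y)" "T n x0"] by simp
    moreover have "norm (T n y) = r / norm x * norm (T n x)"
      using r by (simp add: y_def linear_scale[OF bounded_linear.linear[OF T]])
    ultimately show ?thesis using r False by (simp add: field_simps)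
  qed
  then show ?thesis by (rule that)
qed

text \<open>Time averages regularise: they belong to the domain of the generator, which acts on them as the
  bounded operator \<open>semigroup_quotient\<close>. Everything unbounded about the generator is thereby
  avoided, and \<open>h \<rightarrow> 0\<close> recovers the original vector.\<close>

definition semigroup_average :: "(real \<Rightarrow> 'a \<Rightarrow> 'a) \<Rightarrow> real \<Rightarrow> 'a \<Rightarrow> 'a::banach" where
  "semigroup_average S h f = integral {0..h} (\<lambda>r. S r f) /\<^sub>R h"

definition semigroup_quotient :: "(real \<Rightarrow> 'a \<Rightarrow> 'a) \<Rightarrow> real \<Rightarrow> 'a \<Rightarrow> 'a::banach" where
  "semigroup_quotient S h f = (S h f - f) /\<^sub>R h"

lemma integral_average_tendsto:
  fixes g :: "real \<Rightarrow> 'a::banach"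
  assumes g: "continuous_on {0..1} g"
  shows "((\<lambda>k. integral {0..k} g /\<^sub>R k) \<longlongrightarrow> g 0) (at_right 0)"
proof -
  have "((\<lambda>u. integral {0..u} g) has_vector_derivative g 0) (at 0 within {0..1})"
    using integral_has_vector_derivative[OF g, of 0] by simp
  then have "((\<lambda>u. integral {0..u} g) has_derivative (\<lambda>u. u *\<^sub>R g 0)) (at_right 0)"
    by (simp add: has_vector_derivative_def at_within_Icc_at_right)
  then have "((\<lambda>u. (1 / norm u) *\<^sub>R (integral {0..u} g - u *\<^sub>R g 0)) \<longlongrightarrow> 0) (at_right 0)"
    by (simp add: has_derivative_within)
  then have "((\<lambda>u. integral {0..u} g /\<^sub>R u - g 0) \<longlongrightarrow> 0) (at_right 0)"
    by (rule Lim_transform_eventually)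
      (auto simp: eventually_at_filter scaleR_diff_right divide_inverse)
  then show ?thesis by (rule LIM_zero_cancel)
qed

context
  fixes S :: "real \<Rightarrow> 'a::banach \<Rightarrow> 'a"
  assumes C0: "C0_semigroup S"
begin

lemma semigroup_linear: "0 \<le> t \<Longrightarrow> bounded_linear (S t)"
  and semigroup_zero: "S 0 f = f"
  and semigroup_add: "0 \<le> s \<Longrightarrow> 0 \<le> t \<Longrightarrow> S (s + t) f = S s (S t f)"
  and semigroup_tendsto: "((\<lambda>t. S t f) \<longlongrightarrow> f) (at_right 0)"
  using C0 by (auto simp: C0_semigroup_def)

lemma semigroup_diff: "0 \<le> t \<Longrightarrow> S t (f - g) = S t f - S t g"
  by (rule linear_diff[OF bounded_linear.linear[OF semigroup_linear]])

lemma semigroup_scaleR: "0 \<le> t \<Longrightarrow> S t (c *\<^sub>R f) = c *\<^sub>R S t f"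
  by (rule linear_scale[OF bounded_linear.linear[OF semigroup_linear]])

lemma semigroup_near_zero:
  assumes "e > 0"
  obtains d where "d > 0" "\<And>r. 0 \<le> r \<Longrightarrow> r < d \<Longrightarrow> norm (S r f - f) < e"
proof -
  from tendstoD[OF semigroup_tendsto assms, of f] obtain d where "d > 0" "\<And>r. 0 < r \<Longrightarrow> r < d \<Longrightarrow> dist (S r f) f < e"
    unfolding eventually_at by (auto simp: dist_real_def)
  then show ?thesis using assms
    by (intro that[of d]) (auto simp: dist_norm semigroup_zero order.order_iff_strict)
qed

text \<open>Otherwise there are times \<open>t\<^sub>n \<rightarrow> 0\<close> with unbounded operator norms, although
  \<open>S t\<^sub>n f \<rightarrow> f\<close> for every \<open>f\<close>.\<close>

lemma semigroup_bounded_near_zero: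
  obtains \<delta> K where "\<delta> > 0" "\<And>t f. 0 \<le> t \<Longrightarrow> t \<le> \<delta> \<Longrightarrow> norm (S t f) \<le> K * norm f"
proof -
  have "\<exists>\<delta>>0. \<exists>K. \<forall>t f. 0 \<le> t \<longrightarrow> t \<le> \<delta> \<longrightarrow> norm (S t f) \<le> K * norm f"
  proof (rule ccontr)
    assume contr: "\<not> ?thesis"
    have "\<exists>t f. 0 \<le> t \<and> t \<le> 1 / real (Suc n) \<and> real n * norm f < norm (S t f)" for n
    proof (rule ccontr)
      assume "\<not> ?thesis"
      then have "\<forall>t f. 0 \<le> t \<longrightarrow> t \<le> 1 / real (Suc n) \<longrightarrow> norm (S t f) \<le> real n * norm f"
        by (meson not_less)
      moreover have "1 / real (Suc n) > 0" by simp
      ultimately show False using contr by blast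
    qed
    then obtain t f where t: "\<And>n. 0 \<le> t n" "\<And>n. t n \<le> 1 / real (Suc n)"
      and big: "\<And>n. real n * norm (f n) < norm (S (t n) (f n))" by metis
    have t0: "t \<longlonglongrightarrow> 0"
      by (rule tendsto_sandwich[OF _ _ tendsto_const LIMSEQ_Suc[OF lim_1_over_n]])
        (auto intro!: always_eventually t simp del: of_nat_Suc)
    obtain K where K: "\<And>n x. norm (S (t n) x) \<le> K * norm x"
    proof (rule uniform_boundedness_sequence)
      show "bounded_linear (S (t n))" for n by (rule semigroup_linear[OF t(1)])
      show "\<exists>K. \<forall>n. norm (S (t n) x) \<le> K" for x
      proof -
        have "(\<lambda>n. S (t n) x) \<longlonglongrightarrow> x"
        proof (rule LIMSEQ_I)
          fix e :: real assume "e > 0"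
          then obtain d where d: "d > 0" "\<And>r. 0 \<le> r \<Longrightarrow> r < d \<Longrightarrow> norm (S r x - x) < e"
            using semigroup_near_zero by metis
          from order_tendstoD(2)[OF t0 d(1)] obtain N where "\<And>n. n \<ge> N \<Longrightarrow> t n < d"
            unfolding eventually_sequentially by blast
          then show "\<exists>N. \<forall>n\<ge>N. norm (S (t n) x - x) < e" using d t by blast
        qed
        then have "Bseq (\<lambda>n. S (t n) x)" using convergentI convergent_imp_Bseq by blast
        then show ?thesis unfolding Bseq_def by blast
      qed
    qed blast
    obtain n where n: "K \<le> real n" using real_arch_simple by blast
    have "K * norm (f n) \<le> real n * norm (f n)" using n by (rule mult_right_mono) simp
    then show False using K[of n "f n"] big[of n] by linarith
  qed
  then show ?thesis using that by blast
qed

lemma semigroup_locally_bounded: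
  obtains K where "K > 0" "\<And>t f. 0 \<le> t \<Longrightarrow> t \<le> T \<Longrightarrow> norm (S t f) \<le> K * norm f"
proof -
  obtain \<delta> K0 where \<delta>: "\<delta> > 0" and K0: "\<And>t f. 0 \<le> t \<Longrightarrow> t \<le> \<delta> \<Longrightarrow> norm (S t f) \<le> K0 * norm f"
    using semigroup_bounded_near_zero by blast
  define K where "K = max K0 1"
  have K: "norm (S t f) \<le> K * norm f" if "0 \<le> t" "t \<le> \<delta>" for t f
    using K0[OF that, of f] mult_right_mono[of K0 K "norm f"] by (simp add: K_def)
  have K1: "K \<ge> 1" by (simp add: K_def)
  have "\<forall>t f. 0 \<le> t \<longrightarrow> t \<le> real n * \<delta> \<longrightarrow> norm (S t f) \<le> K ^ n * norm f" for n
  proof (induction n)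
    case 0
    then show ?case by (auto simp: semigroup_zero)
  next
    case (Suc n)
    show ?case
    proof (intro allI impI)
      fix t f assume t: "0 \<le> t" "t \<le> real (Suc n) * \<delta>"
      show "norm (S t f) \<le> K ^ Suc n * norm f"
      proof (cases "t \<le> \<delta>")
        case True
        have "K * 1 \<le> K * K ^ n" using K1 by (intro mult_left_mono) auto
        then have "K * norm f \<le> K ^ Suc n * norm f" by (intro mult_right_mono) auto
        then show ?thesis using K[OF t(1) True, of f] by linarith
      next
        case False
        then have t': "0 \<le> t - \<delta>" "t - \<delta> \<le> real n * \<delta>" using t by (auto simp: algebra_simps)
        have "norm (S (\<delta> + (t - \<delta>)) f) \<le> K * norm (S (t - \<delta>) f)"
          using semigroup_add[of \<delta> "t - \<delta>" f] K[of \<delta> "S (t - \<delta>) f"] \<delta> t' by simp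
        also have "\<dots> \<le> K * (K ^ n * norm f)"
          using Suc t' K1 by (intro mult_left_mono) auto
        finally show ?thesis by simp
      qed
    qed
  qed
  moreover obtain n where "T / \<delta> \<le> real n" using real_arch_simple by blast
  then have "T \<le> real n * \<delta>" using \<delta> by (simp add: field_simps)
  moreover have "K ^ n > 0" using K1 by simp
  ultimately show ?thesis using order_trans by (intro that[of "K ^ n"]) blast+
qed

text \<open>Right continuity is immediate from the semigroup law; left continuity needs the local bound, since
  the increment is \<open>S a (S (b - a) f - f)\<close> with varying \<open>a\<close>.\<close>

lemma semigroup_continuous: "continuous_on {0..T} (\<lambda>t. S t f)"
proof -
  obtain K where K: "K > 0" "\<And>t f. 0 \<le> t \<Longrightarrow> t \<le> T \<Longrightarrow> norm (S t f) \<le> K * norm f"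
    using semigroup_locally_bounded[of T] by blast
  have inc: "norm (S b f - S a f) \<le> K * norm (S (b - a) f - f)" if "0 \<le> a" "a \<le> b" "b \<le> T" for a b
  proof -
    have "S b f - S a f = S a (S (b - a) f - f)"
      using semigroup_add[of a "b - a" f] that by (simp add: semigroup_diff)
    then show ?thesis using K(2)[of a] that by simp
  qed
  show ?thesis
    unfolding continuous_on_iff
  proof (intro ballI allI impI)
    fix t e :: real assume t: "t \<in> {0..T}" and e: "e > 0"
    obtain d where d: "d > 0" "\<And>r. 0 \<le> r \<Longrightarrow> r < d \<Longrightarrow> norm (S r f - f) < e / K"
      using semigroup_near_zero[of "e / K" f] e K(1) by (metis divide_pos_pos)
    have "dist (S s f) (S t f) < e" if s: "s \<in> {0..T}" "dist s t < d" for s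
    proof -
      have "norm (S \<bar>s - t\<bar> f - f) < e / K" using s by (intro d(2)) (auto simp: dist_real_def)
      then have "K * norm (S \<bar>s - t\<bar> f - f) < e" using K(1) by (simp add: field_simps)
      moreover have "dist (S s f) (S t f) \<le> K * norm (S \<bar>s - t\<bar> f - f)"
        using inc[of s t] inc[of t s] s t by (cases "s \<le> t") (auto simp: dist_norm norm_minus_commute)
      ultimately show ?thesis by linarith
    qed
    then show "\<exists>d>0. \<forall>s\<in>{0..T}. dist s t < d \<longrightarrow> dist (S s f) (S t f) < e" using d(1) by blast
  qed
qed

lemma semigroup_integrable_on: "0 \<le> a \<Longrightarrow> (\<lambda>t. S t f) integrable_on {a..b}"
  by (rule integrable_continuous_real, rule continuous_on_subset[OF semigroup_continuous[of b]]) auto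

lemma semigroup_integral:
  assumes "0 \<le> t" "0 \<le> a"
  shows "S t (integral {a..b} (\<lambda>r. S r f)) = integral {a + t..b + t} (\<lambda>r. S r f)"
proof -
  have "S t (integral {a..b} (\<lambda>r. S r f)) = integral {a..b} (S t \<circ> (\<lambda>r. S r f))"
    by (rule integral_linear[OF semigroup_integrable_on[OF assms(2)] semigroup_linear[OF assms(1)], symmetric])
  also have "\<dots> = integral {a..b} ((\<lambda>r. S r f) \<circ> (+) t)"
    by (rule Henstock_Kurzweil_Integration.integral_cong) (use assms in \<open>simp add: semigroup_add\<close>)
  also have "\<dots> = integral {a + t..b + t} (\<lambda>r. S r f)" by (rule integral_shift_Icc_real)
  finally show ?thesis .
qed

lemma semigroup_quotient_commute: "0 \<le> t \<Longrightarrow> 0 \<le> h \<Longrightarrow> S t (semigroup_quotient S h f) = semigroup_quotient S h (S t f)"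
  using semigroup_add[of t h f] semigroup_add[of h t f] by (simp add: semigroup_quotient_def semigroup_scaleR semigroup_diff add.commute)

lemma semigroup_average_commute:
  assumes "0 \<le> t"
  shows "S t (semigroup_average S h f) = semigroup_average S h (S t f)"
proof -
  have "S t (integral {0..h} (\<lambda>r. S r f)) = integral {0..h} (S t \<circ> (\<lambda>r. S r f))"
    by (rule integral_linear[OF semigroup_integrable_on semigroup_linear[OF assms], symmetric]) simp
  also have "\<dots> = integral {0..h} (\<lambda>r. S r (S t f))"
    by (rule Henstock_Kurzweil_Integration.integral_cong)
      (use assms semigroup_add[of t _ f] semigroup_add[of _ t f] in \<open>simp add: add.commute\<close>)
  finally show ?thesis using assms by (simp add: semigroup_average_def semigroup_scaleR)
qed

text \<open>Both sides are differences of integrals of the orbit over windows within \<open>[0, t + h]\<close>, which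
  can be cut at \<open>t\<close> or at \<open>h\<close>.\<close>

lemma semigroup_average_increment:
  assumes t: "0 \<le> t" and h: "0 < h"
  shows "S t (semigroup_average S h f) - semigroup_average S h f
    = integral {0..t} (\<lambda>r. S r (semigroup_quotient S h f))"
proof -
  let ?I = "\<lambda>a b. integral {a..b} (\<lambda>r. S r f)"
  have c: "?I 0 t + ?I t (h + t) = ?I 0 h + ?I h (h + t)"
    using Henstock_Kurzweil_Integration.integral_combine[of 0 t "h + t" "\<lambda>r. S r f"]
      Henstock_Kurzweil_Integration.integral_combine[of 0 h "h + t" "\<lambda>r. S r f"] t h
    by (simp add: semigroup_integrable_on)
  have "S t (semigroup_average S h f) - semigroup_average S h f = (?I t (h + t) - ?I 0 h) /\<^sub>R h"
    using t h by (simp add: semigroup_average_def semigroup_scaleR semigroup_integral scaleR_diff_right)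
  also have "?I t (h + t) - ?I 0 h = ?I h (t + h) - ?I 0 t" using c by (simp add: algebra_simps)
  also have "?I h (t + h) = S h (?I 0 t)" using semigroup_integral[of h 0 t f] h by simp
  also have "(S h (?I 0 t) - ?I 0 t) /\<^sub>R h = semigroup_quotient S h (?I 0 t)"
    by (simp add: semigroup_quotient_def)
  also have "\<dots> = integral {0..t} (semigroup_quotient S h \<circ> (\<lambda>r. S r f))"
    by (rule integral_linear[symmetric, OF semigroup_integrable_on])
      (use h in \<open>auto simp: semigroup_quotient_def[abs_def] intro!: bounded_linear_intros semigroup_linear\<close>)
  also have "\<dots> = integral {0..t} (\<lambda>r. S r (semigroup_quotient S h f))"
    by (rule Henstock_Kurzweil_Integration.integral_cong) (use h in \<open>simp add: semigroup_quotient_commute\<close>)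
  finally show ?thesis .
qed

lemma semigroup_average_tendsto: "((\<lambda>h. semigroup_average S h f) \<longlongrightarrow> f) (at_right 0)"
  using integral_average_tendsto[OF semigroup_continuous[of 1 f]] by (simp add: semigroup_average_def semigroup_zero)

lemma semigroup_average_in_domain:
  assumes gen: "generates A D S" and h: "0 < h"
  shows "semigroup_average S h f \<in> D" "A (semigroup_average S h f) = semigroup_quotient S h f"
proof -
  have "((\<lambda>k. integral {0..k} (\<lambda>r. S r (semigroup_quotient S h f)) /\<^sub>R k) \<longlongrightarrow> semigroup_quotient S h f) (at_right 0)"
    using integral_average_tendsto[OF semigroup_continuous[of 1 "semigroup_quotient S h f"]] by (simp add: semigroup_zero)
  then have "((\<lambda>k. (S k (semigroup_average S h f) - semigroup_average S h f) /\<^sub>R k) \<longlongrightarrow> semigroup_quotient S h f) (at_right 0)"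
    by (rule Lim_transform_eventually)
      (auto simp: eventually_at_filter semigroup_average_increment[OF _ h])
  then show "semigroup_average S h f \<in> D" "A (semigroup_average S h f) = semigroup_quotient S h f"
    using gen unfolding generates_def by auto
qed

lemma bounded_linear_semigroup_quotient: "0 \<le> h \<Longrightarrow> bounded_linear (semigroup_quotient S h)"
  unfolding semigroup_quotient_def[abs_def] by (intro bounded_linear_intros semigroup_linear)

end

text \<open>For an averaged initial vector the orbit is differentiable in time and the derivative of its squared
  norm is twice a value of the form \<open>\<langle>A v, v\<rangle>\<close> with \<open>v\<close> in the domain. Averages converge to
  the vector they are taken of, so the bound passes to all vectors.\<close>

theorem dissipative_imp_contraction:
  fixes S :: "real \<Rightarrow> 'a::{real_inner,banach} \<Rightarrow> 'a"
  assumes gen: "generates A D S" and diss: "\<And>f. f \<in> D \<Longrightarrow> inner (A f) f \<le> 0" and t: "0 \<le> t"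
  shows "norm (S t f) \<le> norm f"
proof -
  have C0: "C0_semigroup S" using gen by (simp add: generates_def)
  note S = semigroup_linear[OF C0]
  have avg: "norm (S t (semigroup_average S h f)) \<le> norm (semigroup_average S h f)" if h: "h > 0" for h
  proof (cases "t = 0")
    case True
    then show ?thesis by (simp add: semigroup_zero[OF C0])
  next
    case False
    with t have t: "0 < t" by simp
    define x where "x = semigroup_average S h f"
    define y where "y = semigroup_quotient S h f"
    have Sx: "S s x = x + integral {0..s} (\<lambda>r. S r y)" if "0 \<le> s" for s
      using semigroup_average_increment[OF C0 that h, of f] by (simp add: x_def y_def algebra_simps)
    have "inner (S t x) (S t x) \<le> inner (S 0 x) (S 0 x)"
    proof (rule DERIV_nonpos_imp_decreasing_open[OF less_imp_le[OF t]])
      show "continuous_on {0..t} (\<lambda>s. inner (S s x) (S s x))"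
        by (intro continuous_intros semigroup_continuous[OF C0])
      fix s assume s: "0 < s" "s < t"
      have "((\<lambda>s. integral {0..s} (\<lambda>r. S r y)) has_vector_derivative S s y) (at s within {0..t})"
        by (rule integral_has_vector_derivative[OF semigroup_continuous[OF C0]]) (use s in auto)
      then have "((\<lambda>s. integral {0..s} (\<lambda>r. S r y)) has_vector_derivative S s y) (at s)"
        by (simp only: at_within_Icc_at[OF s])
      then have "((\<lambda>s. x + integral {0..s} (\<lambda>r. S r y)) has_vector_derivative S s y) (at s)"
        using has_vector_derivative_add[OF has_vector_derivative_const, of _ "S s y" "at s" x] by simp
      then have d: "((\<lambda>s. S s x) has_vector_derivative S s y) (at s)"
        by (rule has_vector_derivative_transform_within_open[where S="{0<..}"]) (use s Sx in auto)
      have "((\<lambda>s. inner (S s x) (S s x)) has_real_derivative inner (S s x) (S s y) + inner (S s y) (S s x)) (at s)"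
        by (rule has_derivative_imp_has_field_derivative[OF has_derivative_inner[OF
              d[unfolded has_vector_derivative_def] d[unfolded has_vector_derivative_def]]])
          (simp add: distrib_left)
      moreover have "S s x = semigroup_average S h (S s f)" "S s y = semigroup_quotient S h (S s f)"
        using s h by (simp_all add: x_def y_def semigroup_average_commute[OF C0] semigroup_quotient_commute[OF C0])
      then have "inner (S s y) (S s x) \<le> 0"
        using diss[OF semigroup_average_in_domain(1)[OF C0 gen h, of "S s f"]] semigroup_average_in_domain(2)[OF C0 gen h, of "S s f"] by simp
      ultimately show "\<exists>d. ((\<lambda>s. inner (S s x) (S s x)) has_real_derivative d) (at s) \<and> d \<le> 0"
        by (auto simp: inner_commute)
    qed
    then show ?thesis unfolding x_def by (simp add: semigroup_zero[OF C0] norm_eq_sqrt_inner)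
  qed
  have a: "((\<lambda>h. semigroup_average S h f) \<longlongrightarrow> f) (at_right 0)" by (rule semigroup_average_tendsto[OF C0])
  show ?thesis
  proof (rule tendsto_le[of "at_right (0::real)"])
    show "((\<lambda>h. norm (semigroup_average S h f)) \<longlongrightarrow> norm f) (at_right 0)" by (intro tendsto_norm a)
    show "((\<lambda>h. norm (S t (semigroup_average S h f))) \<longlongrightarrow> norm (S t f)) (at_right 0)"
      by (intro tendsto_norm bounded_linear.tendsto[OF S[OF t]] a)
    show "\<forall>\<^sub>F h in at_right 0. norm (S t (semigroup_average S h f)) \<le> norm (semigroup_average S h f)"
      by (auto simp: eventually_at_filter avg)
  qed simp
qed

section \<open>The energy inequality for mild solutions\<close>

context
  fixes S :: "real \<Rightarrow> 'a::{real_inner,banach,second_countable_topology} \<Rightarrow> 'a"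
  assumes C0: "C0_semigroup S" and contr: "\<And>t f. 0 \<le> t \<Longrightarrow> norm (S t f) \<le> norm f"
begin

lemma contraction_dist: "0 \<le> t \<Longrightarrow> norm (S t f - S t g) \<le> norm (f - g)"
  using contr[of t "f - g"] by (simp add: semigroup_diff[OF C0])

lemma bounded_linear_semigroup_average:
  assumes h: "0 < h"
  shows "bounded_linear (semigroup_average S h)" and "norm (semigroup_average S h f) \<le> norm f"
proof -
  have nb: "norm (semigroup_average S h f) \<le> norm f" for f
  proof -
    have "norm (integral {0..h} (\<lambda>r. S r f)) \<le> norm f * (h - 0)"
      by (rule integral_bound) (use h contr in \<open>auto intro: semigroup_continuous[OF C0]\<close>)
    then show ?thesis using h by (simp add: semigroup_average_def field_simps)
  qed
  then show "norm (semigroup_average S h f) \<le> norm f" .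
  note i = semigroup_integrable_on[OF C0 order_refl, of _ h]
  show "bounded_linear (semigroup_average S h)"
  proof (rule bounded_linear_intro[where K=1])
    show "semigroup_average S h (f + g) = semigroup_average S h f + semigroup_average S h g" for f g
    proof -
      have "integral {0..h} (\<lambda>r. S r (f + g)) = integral {0..h} (\<lambda>r. S r f + S r g)"
        by (rule Henstock_Kurzweil_Integration.integral_cong)
          (simp add: linear_add[OF bounded_linear.linear[OF semigroup_linear[OF C0]]])
      also have "\<dots> = integral {0..h} (\<lambda>r. S r f) + integral {0..h} (\<lambda>r. S r g)"
        by (rule Henstock_Kurzweil_Integration.integral_add[OF i i])
      finally show ?thesis by (simp add: semigroup_average_def scaleR_add_right)
    qed
    show "semigroup_average S h (c *\<^sub>R f) = c *\<^sub>R semigroup_average S h f" for c f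
    proof -
      have "integral {0..h} (\<lambda>r. S r (c *\<^sub>R f)) = integral {0..h} (\<lambda>r. c *\<^sub>R S r f)"
        by (rule Henstock_Kurzweil_Integration.integral_cong) (simp add: semigroup_scaleR[OF C0])
      then show ?thesis by (simp add: semigroup_average_def)
    qed
    show "norm (semigroup_average S h f) \<le> norm f * 1" for f using nb by simp
  qed
qed

text \<open>The bound uniform in time upgrades strong continuity to joint continuity, and with it the
  measurability of convolution integrands. Truncating time at zero makes the map defined on the whole
  product space, since \<open>S t\<close> is arbitrary for \<open>t < 0\<close>.\<close>

lemma contraction_jointly_continuous: "continuous_on UNIV (\<lambda>z. S (max 0 (fst z)) (snd z))"
  unfolding continuous_on_iff
proof (intro ballI allI impI)
  fix z :: "real \<times> 'a" and e :: real assume e: "e > 0"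
  define r where "r = max 0 (fst z)"
  have "r \<in> {0..r + 1}" by (simp add: r_def)
  moreover have "e / 2 > 0" using e by simp
  ultimately obtain d where d: "d > 0" "\<And>r'. r' \<in> {0..r + 1} \<Longrightarrow> dist r' r < d \<Longrightarrow> dist (S r' (snd z)) (S r (snd z)) < e / 2"
    using semigroup_continuous[OF C0, of "r + 1" "snd z"] unfolding continuous_on_iff by meson
  define d' where "d' = min (min d 1) (e / 2)"
  show "\<exists>d>0. \<forall>z'\<in>UNIV. dist z' z < d \<longrightarrow> dist (S (max 0 (fst z')) (snd z')) (S (max 0 (fst z)) (snd z)) < e"
  proof (intro exI[of _ d'] conjI ballI impI)
    show "d' > 0" using d e by (simp add: d'_def)
    fix z' :: "real \<times> 'a" assume z': "dist z' z < d'"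
    define r' where "r' = max 0 (fst z')"
    have 1: "dist (fst z') (fst z) < d'" "dist (snd z') (snd z) < d'"
      using dist_fst_le[of z' z] dist_snd_le[of z' z] z' by linarith+
    have "dist r' r \<le> dist (fst z') (fst z)" by (simp add: r_def r'_def dist_real_def)
    then have "dist r' r < d" "dist r' r < 1" using 1 by (auto simp: d'_def)
    then have "dist (S r' (snd z)) (S r (snd z)) < e / 2"
      by (intro d(2)) (auto simp: r'_def dist_real_def)
    moreover have "dist (S r' (snd z')) (S r' (snd z)) \<le> dist (snd z') (snd z)"
      unfolding dist_norm by (rule contraction_dist) (simp add: r'_def)
    moreover have "dist (snd z') (snd z) < e / 2" using 1 by (simp add: d'_def)
    ultimately show "dist (S (max 0 (fst z')) (snd z')) (S (max 0 (fst z)) (snd z)) < e"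
      using dist_triangle[of "S r' (snd z')" "S r (snd z)" "S r' (snd z)"] by (simp add: r_def r'_def)
  qed
qed

lemma contraction_measurable:
  assumes [measurable]: "\<rho> \<in> borel_measurable M" "f \<in> borel_measurable M"
  shows "(\<lambda>x. S (max 0 (\<rho> x)) (f x)) \<in> borel_measurable M"
proof -
  have 1: "(\<lambda>z. S (max 0 (fst z)) (snd z)) \<in> borel_measurable (borel \<Otimes>\<^sub>M borel)"
    unfolding borel_prod by (rule borel_measurable_continuous_onI[OF contraction_jointly_continuous])
  have 2: "(\<lambda>x. (\<rho> x, f x)) \<in> M \<rightarrow>\<^sub>M borel \<Otimes>\<^sub>M borel" by measurable
  show ?thesis using measurable_comp[OF 2 1] by (simp add: comp_def)
qed

text \<open>The fundamental theorem of calculus for the orbit of an average, started at time \<open>s\<close>. Pairing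
  with a fixed vector makes the integral real-valued, and writing it over \<open>[0, t]\<close> with an
  indicator prepares the exchange of integrals in \<open>s\<close> and \<open>r\<close>.\<close>

lemma inner_average_expansion:
  assumes h: "0 < h" and s: "0 \<le> s" "s \<le> t"
  shows "inner (S (t - s) (semigroup_average S h x)) z = inner (semigroup_average S h x) z
     + (LINT r|lebesgue_on {0..t}. indicator {s..} r * inner (S (max 0 (r - s)) (semigroup_quotient S h x)) z)"
proof -
  define y where "y = semigroup_quotient S h x"
  define G where "G r = inner (S (max 0 (r - s)) y) z" for r
  have "continuous_on UNIV G"
  proof -
    have "continuous_on UNIV (\<lambda>r. S (max 0 (fst (r - s, y))) (snd (r - s, y)))"
      by (rule continuous_on_compose2[OF contraction_jointly_continuous]) (auto intro!: continuous_intros)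
    then show ?thesis unfolding G_def by (intro continuous_intros) simp
  qed
  then have cG: "continuous_on {a..b} G" for a b using continuous_on_subset by blast
  have "inner (S (t - s) (semigroup_average S h x)) z = inner (semigroup_average S h x) z + inner (integral {0..t - s} (\<lambda>r. S r y)) z"
    using semigroup_average_increment[OF C0 _ h, of "t - s" x] s by (simp add: y_def algebra_simps flip: inner_add_left)
  also have "inner (integral {0..t - s} (\<lambda>r. S r y)) z = integral {0..t - s} ((\<lambda>v. inner v z) \<circ> (\<lambda>r. S r y))"
    by (rule integral_linear[symmetric, OF semigroup_integrable_on[OF C0] bounded_linear_inner_left]) simp
  also have "\<dots> = integral {0..t - s} (G \<circ> (+) s)"
    by (rule Henstock_Kurzweil_Integration.integral_cong) (simp add: G_def)
  also have "\<dots> = integral {s..t} G" using integral_shift_Icc_real[of 0 "t - s" G s] by simp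
  also have "\<dots> = (LINT r|lebesgue_on {s..t}. G r)"
    using lebesgue_integral_eq_integral[OF continuous_imp_integrable_real[OF cG], of s t] by simp
  also have "\<dots> = (LINT r|lebesgue_on {0..t}. indicator {s..t} r *\<^sub>R G r)"
    by (rule integral_lebesgue_on_indicator) (use s in auto)
  also have "\<dots> = (LINT r|lebesgue_on {0..t}. indicator {s..} r * G r)"
    by (rule Bochner_Integration.integral_cong) (auto simp: indicator_def)
  finally show ?thesis by (simp add: G_def y_def)
qed

lemma convolution_integrable:
  assumes f: "integrable (lebesgue_on {0..t}) f"
  shows "integrable (lebesgue_on {0..t}) (\<lambda>s. S (t - s) (f s))"
proof -
  have [measurable]: "(\<lambda>x. x) \<in> borel_measurable (lebesgue_on {0..t})" 
    using id_borel_measurable_lebesgue_on[of "{0..t}"] by (simp add: id_def)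
  have [measurable]: "f \<in> borel_measurable (lebesgue_on {0..t})" using f by simp
  have "integrable (lebesgue_on {0..t}) (\<lambda>s. S (max 0 (t - s)) (f s))"
    by (rule Bochner_Integration.integrable_bound[OF f contraction_measurable]) (auto simp: contr)
  then show ?thesis
    by (rule Bochner_Integration.integrable_cong[THEN iffD1, rotated -1]) (auto simp: max_def)
qed

context
  fixes T :: real and f u :: "real \<Rightarrow> 'a" and u0 :: 'a
  assumes f: "integrable (lebesgue_on {0..T}) f"
    and mild: "\<And>t. t \<in> {0..T} \<Longrightarrow> u t = S t u0 + (LINT s|lebesgue_on {0..t}. S (t - s) (f s))"
    and cu: "continuous_on {0..T} u"
begin

lemma forcing_integrable: "b \<le> T \<Longrightarrow> 0 \<le> a \<Longrightarrow> integrable (lebesgue_on {a..b}) f"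
  by (rule integrable_subinterval_lebesgue_on[OF f])

lemma mild_image_integrable:
  fixes L :: "'a \<Rightarrow> 'b::{banach,second_countable_topology}"
  assumes "bounded_linear L" "0 \<le> a" "b \<le> T"
  shows "integrable (lebesgue_on {a..b}) (\<lambda>s. L (u s))"
  by (rule continuous_imp_Bochner_integrable, rule bounded_linear.continuous_on[OF assms(1)],
      rule continuous_on_subset[OF cu]) (use assms(2,3) in simp)

text \<open>Averaging commutes with the semigroup, so the averaged mild solution is the mild solution for
  averaged data. Averaged data lie in the domain; expanding each orbit by the fundamental theorem of
  calculus and exchanging the two time integrals reassembles the mild formula for \<open>u\<close> under
  the integral sign. Hence the averaged solution solves the differential equation, integrated in time,
  although \<open>u\<close> itself need not.\<close>

lemma mild_regularized:
  assumes h: "0 < h" and t: "t \<in> {0..T}"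
  shows "semigroup_average S h (u t) = semigroup_average S h u0
     + (LINT s|lebesgue_on {0..t}. semigroup_quotient S h (u s) + semigroup_average S h (f s))"
proof -
  define N where "N = lebesgue_on {0..t}"
  have spN: "space N = {0..t}" by (simp add: N_def)
  interpret N: finite_measure N unfolding N_def by (rule finite_measure_lebesgue_on) simp
  interpret NN: pair_sigma_finite N N ..
  have idm[measurable]: "(\<lambda>x. x) \<in> borel_measurable N" 
    unfolding N_def using id_borel_measurable_lebesgue_on[of "{0..t}"] by (simp add: id_def)
  have fN: "integrable N f" unfolding N_def using forcing_integrable[of t 0] t by simp
  then have [measurable]: "f \<in> borel_measurable N" by simp
  let ?M = "semigroup_average S h" and ?B = "semigroup_quotient S h"
  have M: "bounded_linear ?M" by (rule bounded_linear_semigroup_average[OF h])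
  have B: "bounded_linear ?B" by (rule bounded_linear_semigroup_quotient[OF C0]) (use h in simp)
  have iMf: "integrable N (\<lambda>s. ?M (f s))" by (rule integrable_bounded_linear[OF M fN])
  have iBf: "integrable N (\<lambda>s. ?B (f s))" by (rule integrable_bounded_linear[OF B fN])
  then have [measurable]: "(\<lambda>s. ?B (f s)) \<in> borel_measurable N" by simp
  have iBu: "integrable N (\<lambda>s. ?B (u s))" unfolding N_def by (rule mild_image_integrable[OF B]) (use t in auto)
  have iSB: "integrable N (\<lambda>s. S s (?B u0))"
  proof (rule N.integrable_const_bound[of _ "norm (?B u0)"])
    show "(\<lambda>s. S s (?B u0)) \<in> borel_measurable N" unfolding N_def
      by (rule continuous_imp_measurable_on_sets_lebesgue[OF semigroup_continuous[OF C0]]) simp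
  qed (auto simp: spN contr)
  have "inner (?M (u t)) z = inner (?M u0 + (LINT s|N. ?B (u s) + ?M (f s))) z" for z
  proof -
    define G where "G s r = indicator {s..} r * inner (S (max 0 (r - s)) (?B (f s))) z" for s r :: real
    have iG: "integrable (N \<Otimes>\<^sub>M N) (case_prod G)"
    proof (rule Bochner_Integration.integrable_bound)
      show "integrable (N \<Otimes>\<^sub>M N) (\<lambda>(s, r). norm (?B (f s)) * norm z)"
        by (rule NN.Fubini_integrable) (use iBf in \<open>auto intro!: integrable_mult_left integrable_norm\<close>)
      have "case_prod G = (\<lambda>p. indicator {p. fst p \<le> snd p} p * inner (S (max 0 (snd p - fst p)) (?B (f (fst p)))) z)"
        by (auto simp: G_def indicator_def fun_eq_iff)
      moreover have "(\<lambda>p. S (max 0 (snd p - fst p)) (?B (f (fst p)))) \<in> borel_measurable (N \<Otimes>\<^sub>M N)"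
        by (rule contraction_measurable) measurable
      moreover have "{p \<in> space (N \<Otimes>\<^sub>M N). fst p \<le> snd p} \<in> sets (N \<Otimes>\<^sub>M N)" by measurable
      ultimately show "case_prod G \<in> borel_measurable (N \<Otimes>\<^sub>M N)"
        by (auto intro!: borel_measurable_times borel_measurable_inner borel_measurable_indicator')
      show "AE p in N \<Otimes>\<^sub>M N. norm (case_prod G p) \<le> norm (case p of (s, r) \<Rightarrow> norm (?B (f s)) * norm z)"
      proof (rule AE_I2)
        fix p :: "real \<times> real"
        obtain s r where p: "p = (s, r)" by (cases p)
        have "\<bar>inner (S (max 0 (r - s)) (?B (f s))) z\<bar> \<le> norm (?B (f s)) * norm z"
          by (rule order_trans[OF Cauchy_Schwarz_ineq2]) (intro mult_right_mono contr, auto)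
        then show "norm (case_prod G p) \<le> norm (case p of (s, r) \<Rightarrow> norm (?B (f s)) * norm z)"
          by (auto simp: p G_def indicator_def)
      qed
    qed
    have inG: "(LINT s|N. G s r) = inner (?B (u r) - S r (?B u0)) z" if r: "r \<in> {0..t}" for r
    proof -
      have ir: "integrable (lebesgue_on {0..r}) (\<lambda>s. S (r - s) (f s))"
        by (rule convolution_integrable[OF forcing_integrable]) (use r t in auto)
      have "?B (u r) - S r (?B u0) = ?B (u r - S r u0)"
        using semigroup_quotient_commute[OF C0, of r h u0] r h by (simp add: linear_diff[OF bounded_linear.linear[OF B]])
      also have "u r - S r u0 = (LINT s|lebesgue_on {0..r}. S (r - s) (f s))"
        using mild[of r] r t by simp
      also have "inner (?B \<dots>) z = (LINT s|lebesgue_on {0..r}. inner (?B (S (r - s) (f s))) z)"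
        unfolding integral_bounded_linear[OF B ir, symmetric]
        by (rule integral_inner_left[symmetric]) (rule integrable_bounded_linear[OF B ir])
      also have "\<dots> = (LINT s|N. indicator {0..r} s *\<^sub>R inner (?B (S (r - s) (f s))) z)"
        unfolding N_def by (rule integral_lebesgue_on_indicator) (use r in auto)
      also have "\<dots> = (LINT s|N. G s r)"
        by (rule Bochner_Integration.integral_cong)
          (use h in \<open>auto simp: spN G_def indicator_def max_def semigroup_quotient_commute[OF C0]\<close>)
      finally show ?thesis by simp
    qed
    have iSf: "integrable N (\<lambda>s. S (t - s) (f s))" unfolding N_def
      by (rule convolution_integrable[OF forcing_integrable]) (use t in auto)
    have tt: "0 \<le> t" using t by simp
    have "?M (u t) = S t (?M u0) + (LINT s|N. ?M (S (t - s) (f s)))"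
      using mild[OF t] semigroup_average_commute[OF C0 tt, of h u0]
      by (simp add: linear_add[OF bounded_linear.linear[OF M]] integral_bounded_linear[OF M iSf] flip: N_def)
    then have "inner (?M (u t)) z = inner (S t (?M u0)) z + (LINT s|N. inner (?M (S (t - s) (f s))) z)"
      using integral_inner_left[OF integrable_bounded_linear[OF M iSf], of z] by (simp add: inner_add_left)
    also have "(LINT s|N. inner (?M (S (t - s) (f s))) z) = (LINT s|N. inner (?M (f s)) z + (LINT r|N. G s r))"
    proof (rule Bochner_Integration.integral_cong)
      fix s assume "s \<in> space N"
      then have s: "0 \<le> s" "s \<le> t" by (auto simp: spN)
      have "?M (S (t - s) (f s)) = S (t - s) (?M (f s))"
        using semigroup_average_commute[OF C0, of "t - s" h "f s"] s by simp
      then show "inner (?M (S (t - s) (f s))) z = inner (?M (f s)) z + (LINT r|N. G s r)"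
        unfolding N_def G_def using inner_average_expansion[OF h s, of "f s" z] by simp
    qed simp
    also have "\<dots> = (LINT s|N. inner (?M (f s)) z) + (LINT s|N. LINT r|N. G s r)"
      by (intro Bochner_Integration.integral_add integrable_inner_left iMf NN.integrable_fst[OF iG])
    also have "(LINT s|N. LINT r|N. G s r) = (LINT r|N. LINT s|N. G s r)"
      by (rule NN.Fubini_integral[OF iG, symmetric])
    also have "\<dots> = (LINT r|N. inner (?B (u r) - S r (?B u0)) z)"
      by (rule Bochner_Integration.integral_cong) (auto simp: spN inG)
    also have "\<dots> = inner (LINT r|N. ?B (u r)) z - inner (LINT r|N. S r (?B u0)) z"
      using iBu iSB by (simp add: inner_diff_left integral_inner_left)
    also have "inner (S t (?M u0)) z = inner (?M u0) z + inner (LINT r|N. S r (?B u0)) z"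
    proof -
      have "inner (S t (?M u0)) z = inner (?M u0) z + (LINT r|N. indicator {0..} r * inner (S (max 0 (r - 0)) (?B u0)) z)"
        unfolding N_def using inner_average_expansion[OF h order_refl tt, of u0 z] by simp
      also have "(LINT r|N. indicator {0..} r * inner (S (max 0 (r - 0)) (?B u0)) z) = (LINT r|N. inner (S r (?B u0)) z)"
        by (rule Bochner_Integration.integral_cong) (auto simp: spN indicator_def)
      also have "\<dots> = inner (LINT r|N. S r (?B u0)) z" by (rule integral_inner_left) (rule iSB)
      finally show ?thesis .
    qed
    also have "(LINT s|N. inner (?M (f s)) z) = inner (LINT s|N. ?M (f s)) z"
      by (rule integral_inner_left) (rule iMf)
    finally show ?thesis
      using iBu iMf by (simp add: inner_add_left)
  qed
  then show ?thesis unfolding N_def using vector_eq_rdot by blast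
qed

lemma regularized_energy_identity:
  assumes h: "0 < h" and ab: "0 \<le> a" "a \<le> b" "b \<le> T"
  defines "g \<equiv> \<lambda>s. semigroup_quotient S h (u s) + semigroup_average S h (f s)"
  shows "integrable (lebesgue_on {a..b}) (\<lambda>s. inner (g s) (semigroup_average S h (u s)))"
    and "(norm (semigroup_average S h (u b)))\<^sup>2 - (norm (semigroup_average S h (u a)))\<^sup>2
     = 2 * (LINT s|lebesgue_on {a..b}. inner (g s) (semigroup_average S h (u s)))"
proof -
  let ?M = "semigroup_average S h" and ?B = "semigroup_quotient S h"
  have M: "bounded_linear ?M" by (rule bounded_linear_semigroup_average[OF h])
  have B: "bounded_linear ?B" by (rule bounded_linear_semigroup_quotient[OF C0]) (use h in simp)
  have ig: "integrable (lebesgue_on {c..d}) g" if "0 \<le> c" "d \<le> T" for c d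
    unfolding g_def using that
    by (intro Bochner_Integration.integrable_add mild_image_integrable[OF B] integrable_bounded_linear[OF M forcing_integrable]) auto
  have eq: "?M (u s) = ?M (u a) + (LINT x|lebesgue_on {a..s}. g x)" if "s \<in> {a..b}" for s
  proof -
    have "(LINT x|lebesgue_on {0..s}. g x) = (LINT x|lebesgue_on {0..a}. g x) + (LINT x|lebesgue_on {a..s}. g x)"
      by (rule integral_lebesgue_on_combine[OF ig]) (use that ab in auto)
    then show ?thesis
      using mild_regularized[OF h, of s] mild_regularized[OF h, of a] that ab by (simp add: g_def)
  qed
  have c1: "integrable (lebesgue_on {a..b}) (\<lambda>s. inner (g s) (?M (u a) + (LINT x|lebesgue_on {a..s}. g x)))
       = integrable (lebesgue_on {a..b}) (\<lambda>s. inner (g s) (?M (u s)))"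
    by (rule Bochner_Integration.integrable_cong) (simp_all add: eq[symmetric])
  have c2: "(LINT s|lebesgue_on {a..b}. inner (g s) (?M (u a) + (LINT x|lebesgue_on {a..s}. g x)))
       = (LINT s|lebesgue_on {a..b}. inner (g s) (?M (u s)))"
    by (rule Bochner_Integration.integral_cong) (simp_all add: eq[symmetric])
  have c3: "(LINT s|lebesgue_on {a..b}. inner (?M (u a) + (LINT x|lebesgue_on {a..s}. g x)) (g s))
       = (LINT s|lebesgue_on {a..b}. inner (g s) (?M (u s)))"
    by (rule Bochner_Integration.integral_cong) (simp_all add: eq[symmetric] inner_commute)
  show "integrable (lebesgue_on {a..b}) (\<lambda>s. inner (g s) (?M (u s)))"
    using integral_inner_by_parts(1)[OF ig[OF ab(1,3)] ig[OF ab(1,3)] ab(2), where w = "?M (u a)"] by (simp only: c1)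
  have "inner (?M (u b)) (?M (u b)) = inner (?M (u a)) (?M (u a)) + (LINT s|lebesgue_on {a..b}. inner (g s) (?M (u s)))
      + (LINT s|lebesgue_on {a..b}. inner (g s) (?M (u s)))"
    using integral_inner_by_parts(3)[OF ig[OF ab(1,3)] ig[OF ab(1,3)] ab(2), where v = "?M (u a)" and w = "?M (u a)"] eq[of b] ab
    by (simp only: c2 c3) simp
  then show "(norm (?M (u b)))\<^sup>2 - (norm (?M (u a)))\<^sup>2 = 2 * (LINT s|lebesgue_on {a..b}. inner (g s) (?M (u s)))"
    by (simp add: power2_norm_eq_inner)
qed

text \<open>For the averaged solution the energy identity holds, and its right-hand side contains the quadratic
  form of \<open>A\<close> only at vectors of the domain, where coercivity applies. The resulting bound contains
  only bounded operators, so averaging can be removed by dominated convergence. Applying coercivity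
  before the limit avoids any semicontinuity argument for the unbounded form.\<close>

theorem mild_energy_inequality:
  assumes gen: "generates A D S" and L: "bounded_linear L"
    and coercive: "\<And>v. v \<in> D \<Longrightarrow> inner (A v) v \<le> - inner (L v) v"
    and ab: "0 \<le> a" "a \<le> b" "b \<le> T"
  shows "integrable (lebesgue_on {a..b}) (\<lambda>s. inner (f s - L (u s)) (u s))"
    and "(norm (u b))\<^sup>2 - (norm (u a))\<^sup>2 \<le> 2 * (LINT s|lebesgue_on {a..b}. inner (f s - L (u s)) (u s))"
proof -
  define h where "h n = 1 / real (Suc n)" for n
  have h: "h n > 0" for n by (simp add: h_def)
  define M where "M n = semigroup_average S (h n)" for n
  have M: "bounded_linear (M n)" and Mb: "norm (M n x) \<le> norm x" for n x
    unfolding M_def by (rule bounded_linear_semigroup_average[OF h])+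
  have "filterlim h (at_right 0) sequentially"
    unfolding filterlim_at
  proof
    show "h \<longlonglongrightarrow> 0" unfolding h_def[abs_def] by (intro LIMSEQ_Suc lim_1_over_n)
  qed (use h in \<open>auto intro!: always_eventually simp: less_imp_neq[symmetric]\<close>)
  then have Mlim: "(\<lambda>n. M n x) \<longlonglongrightarrow> x" for x
    unfolding M_def by (rule filterlim_compose[OF semigroup_average_tendsto[OF C0]])
  obtain K where K: "\<And>x. norm (L x) \<le> norm x * K" using bounded_linear.bounded[OF L] by blast
  have K0: "norm (L x) \<le> norm x * \<bar>K\<bar>" for x
    by (rule order_trans[OF K]) (simp add: mult_left_mono)
  obtain R where R: "\<And>s. s \<in> {0..T} \<Longrightarrow> norm (u s) \<le> R"
    using continuous_bounded_on_Icc[OF cu] by blast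
  define N where "N = lebesgue_on {a..b}"
  have spN: "space N = {a..b}" by (simp add: N_def)
  interpret N: finite_measure N unfolding N_def by (rule finite_measure_lebesgue_on) simp
  have fN: "integrable N f" unfolding N_def by (rule forcing_integrable) (use ab in auto)
  have uN: "integrable N (\<lambda>s. u s)" unfolding N_def
    by (rule mild_image_integrable[of "\<lambda>x. x"]) (use ab in \<open>auto intro: bounded_linear_ident\<close>)
  have [measurable]: "f \<in> borel_measurable N" "u \<in> borel_measurable N" using fN uN by auto
  have [measurable]: "(\<lambda>s. M n (u s)) \<in> borel_measurable N" "(\<lambda>s. M n (f s)) \<in> borel_measurable N"
    "(\<lambda>s. L (M n (u s))) \<in> borel_measurable N" "(\<lambda>s. L (u s)) \<in> borel_measurable N" for n
    using integrable_bounded_linear[OF M uN, of n] integrable_bounded_linear[OF M fN, of n]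
      integrable_bounded_linear[OF L integrable_bounded_linear[OF M uN, of n]] integrable_bounded_linear[OF L uN]
    by auto
  define F where "F n s = inner (M n (f s) - L (M n (u s))) (M n (u s))" for n s
  \<comment> \<open>the majorant uses that averaging is a contraction and that \<open>u\<close> is bounded\<close>
  define w where "w s = (norm (f s) + R * \<bar>K\<bar>) * R" for s
  have iw: "integrable N w" unfolding w_def using fN by (intro integrable_mult_left Bochner_Integration.integrable_add) auto
  have Fw: "norm (F n s) \<le> w s" if "s \<in> {a..b}" for n s
  proof -
    have u: "norm (u s) \<le> R" using R that ab by auto
    then have R0: "R \<ge> 0" using norm_ge_zero[of "u s"] by linarith
    have Mu: "norm (M n (u s)) \<le> R" by (rule order_trans[OF Mb u])
    have "norm (L (M n (u s))) \<le> R * \<bar>K\<bar>"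
      by (rule order_trans[OF K0]) (use Mu in \<open>auto intro: mult_right_mono\<close>)
    then have "norm (M n (f s) - L (M n (u s))) \<le> norm (f s) + R * \<bar>K\<bar>"
      using norm_triangle_ineq4[of "M n (f s)" "L (M n (u s))"] Mb[of n "f s"] by linarith
    then show ?thesis unfolding F_def w_def real_norm_def
      by (intro order_trans[OF Cauchy_Schwarz_ineq2] mult_mono Mu) (use R0 in auto)
  qed
  have iF: "integrable N (F n)" for n
  proof (rule Bochner_Integration.integrable_bound[OF iw])
    show "F n \<in> borel_measurable N" unfolding F_def[abs_def] by measurable
    show "AE s in N. norm (F n s) \<le> norm (w s)"
    proof (rule AE_I2)
      fix s assume "s \<in> space N"
      then have "norm (F n s) \<le> w s" by (intro Fw) (simp add: spN)
      then show "norm (F n s) \<le> norm (w s)" by simp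
    qed
  qed
  have le: "(norm (M n (u b)))\<^sup>2 - (norm (M n (u a)))\<^sup>2 \<le> 2 * (LINT s|N. F n s)" for n
  proof -
    note I = regularized_energy_identity[OF h[of n] ab]
    have "(LINT s|N. inner (semigroup_quotient S (h n) (u s) + M n (f s)) (M n (u s))) \<le> (LINT s|N. F n s)"
    proof (rule integral_mono)
      show "integrable N (\<lambda>s. inner (semigroup_quotient S (h n) (u s) + M n (f s)) (M n (u s)))"
        using I(1) by (simp add: N_def M_def)
      show "inner (semigroup_quotient S (h n) (u s) + M n (f s)) (M n (u s)) \<le> F n s" for s
        using coercive[OF semigroup_average_in_domain(1)[OF C0 gen h[of n], of "u s"]] 
          semigroup_average_in_domain(2)[OF C0 gen h[of n], of "u s"]
        by (simp add: F_def M_def inner_add_left inner_diff_left)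
    qed (rule iF)
    then show ?thesis using I(2) by (simp add: N_def M_def)
  qed
  have Flim: "AE s in N. (\<lambda>n. F n s) \<longlonglongrightarrow> inner (f s - L (u s)) (u s)"
    unfolding F_def by (intro AE_I2 tendsto_intros bounded_linear.tendsto[OF L] Mlim)
  have Fdom: "AE s in N. norm (F n s) \<le> w s" for n using Fw by (intro AE_I2) (auto simp: spN)
  have Fm: "(\<lambda>s. inner (f s - L (u s)) (u s)) \<in> borel_measurable N" by measurable
  note lim = integral_dominated_convergence[OF Fm borel_measurable_integrable[OF iF] iw Flim Fdom]
  show "integrable (lebesgue_on {a..b}) (\<lambda>s. inner (f s - L (u s)) (u s))"
    using integrable_dominated_convergence[OF Fm borel_measurable_integrable[OF iF] iw Flim Fdom] by (simp add: N_def)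
  show "(norm (u b))\<^sup>2 - (norm (u a))\<^sup>2 \<le> 2 * (LINT s|lebesgue_on {a..b}. inner (f s - L (u s)) (u s))"
    unfolding N_def[symmetric]
  proof (rule LIMSEQ_le)
    show "(\<lambda>n. (norm (M n (u b)))\<^sup>2 - (norm (M n (u a)))\<^sup>2) \<longlonglongrightarrow> (norm (u b))\<^sup>2 - (norm (u a))\<^sup>2"
      by (intro tendsto_intros Mlim)
    show "(\<lambda>n. 2 * (LINT s|N. F n s)) \<longlonglongrightarrow> 2 * (LINT s|N. inner (f s - L (u s)) (u s))"
      by (intro tendsto_intros lim)
    show "\<exists>N'. \<forall>n\<ge>N'. (norm (M n (u b)))\<^sup>2 - (norm (M n (u a)))\<^sup>2 \<le> 2 * (LINT s|N. F n s)"
      using le by blast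
  qed
qed

end

end

section \<open>Measurability of pointwise products\<close>

text \<open>Lebesgue measure restricted to a measurable set is complete.\<close>

lemma borel_measurable_lebesgue_on_AE_cong:
  fixes f g :: "real \<Rightarrow> 'b::topological_space"
  assumes g: "g \<in> borel_measurable (lebesgue_on A)" and A: "A \<in> sets lebesgue"
    and eq: "AE x in lebesgue_on A. f x = g x"
  shows "f \<in> borel_measurable (lebesgue_on A)"
proof -
  interpret complete_measure "lebesgue_on A"
  proof
    fix B C assume "B \<subseteq> C" "C \<in> null_sets (lebesgue_on A)"
    then have "C \<in> null_sets lebesgue" "C \<subseteq> A" using A by (auto simp: null_sets_restrict_space)
    then have "B \<in> null_sets lebesgue" "B \<subseteq> A" using \<open>B \<subseteq> C\<close> by (auto intro: completion.complete2)
    then show "B \<in> sets (lebesgue_on A)" using A by (auto simp: sets_restrict_space_iff)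
  qed
  show ?thesis
  proof (rule measurableI)
    fix B :: "'b set" assume B: "B \<in> sets borel"
    show "f -` B \<inter> space (lebesgue_on A) \<in> sets (lebesgue_on A)"
    proof (rule in_sets_AE)
      show "AE x in lebesgue_on A. x \<in> g -` B \<inter> space (lebesgue_on A) \<longleftrightarrow> x \<in> f -` B \<inter> space (lebesgue_on A)"
        using eq by (rule eventually_mono) auto
      show "g -` B \<inter> space (lebesgue_on A) \<in> sets (lebesgue_on A)"
        by (rule measurable_sets[OF g B])
    qed auto
  qed simp
qed

text \<open>Multiplication is not continuous from \<open>L\<^sup>2 \<times> L\<^sup>2\<close> to \<open>L\<^sup>2\<close>, not even everywhere defined.
  Clipping both factors at height \<open>n\<close> makes it Lipschitz, and \<open>n \<rightarrow> \<infinity>\<close> recovers the product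
  wherever that is square integrable.\<close>

definition clip :: "real \<Rightarrow> real \<Rightarrow> real" where
  "clip n y = max (- n) (min n y)"

lemma clip_bounds:
  assumes "0 \<le> n"
  shows "\<bar>clip n y\<bar> \<le> n" "\<bar>clip n y\<bar> \<le> \<bar>y\<bar>" "\<bar>clip n y - clip n z\<bar> \<le> \<bar>y - z\<bar>"
  using assms by (auto simp: clip_def)

lemma clip_measurable [measurable]: "clip n \<in> borel_measurable borel"
  unfolding clip_def[abs_def] by measurable

lemma clip_mult_Lipschitz:
  assumes "0 \<le> n"
  shows "\<bar>clip n a * clip n b - clip n a' * clip n b'\<bar> \<le> n * (\<bar>a - a'\<bar> + \<bar>b - b'\<bar>)"
proof -
  have "clip n a * clip n b - clip n a' * clip n b' = (clip n a - clip n a') * clip n b + clip n a' * (clip n b - clip n b')"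
    by (simp add: algebra_simps)
  also have "\<bar>\<dots>\<bar> \<le> \<bar>clip n a - clip n a'\<bar> * \<bar>clip n b\<bar> + \<bar>clip n a'\<bar> * \<bar>clip n b - clip n b'\<bar>"
    by (rule order_trans[OF abs_triangle_ineq]) (simp add: abs_mult)
  also have "\<dots> \<le> \<bar>a - a'\<bar> * n + n * \<bar>b - b'\<bar>"
    using clip_bounds[OF assms] assms by (intro add_mono mult_mono) auto
  finally show ?thesis by (simp add: algebra_simps)
qed

definition clipped_mult_L2 :: "real \<Rightarrow> L2 \<Rightarrow> L2 \<Rightarrow> L2" where
  "clipped_mult_L2 n f g = L2_class (\<lambda>x. clip n (rep_L2 f x) * clip n (rep_L2 g x))"

lemma square_integrable_clipped:
  assumes "0 \<le> n"
  shows "square_integrable (\<lambda>x. clip n (rep_L2 f x) * clip n (rep_L2 g x))"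
proof (rule square_integrable_bound[OF square_integrable_rep[of g]])
  show "AE x in lebesgue. \<bar>clip n (rep_L2 f x) * clip n (rep_L2 g x)\<bar> \<le> \<bar>n * rep_L2 g x\<bar>"
    using mult_mono[OF clip_bounds(1)[OF assms] clip_bounds(2)[OF assms] assms abs_ge_zero] assms
    by (intro AE_I2) (simp add: abs_mult)
qed measurable

lemma clipped_mult_L2_continuous:
  assumes n: "0 \<le> n"
  shows "continuous_on UNIV (\<lambda>z. clipped_mult_L2 n (fst z) (snd z))"
proof -
  have lip: "norm (clipped_mult_L2 n f g - clipped_mult_L2 n f' g') \<le> n * (norm (f - f') + norm (g - g'))" for f g f' g'
  proof -
    note s = square_integrable_clipped[OF n]
    note a = square_integrable_abs[OF square_integrable_rep]
    have "clipped_mult_L2 n f g - clipped_mult_L2 n f' g' = L2_class (\<lambda>x. clip n (rep_L2 f x) * clip n (rep_L2 g x) - clip n (rep_L2 f' x) * clip n (rep_L2 g' x))"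
      unfolding clipped_mult_L2_def by (rule L2_class_diff[symmetric, OF s s])
    also have "norm \<dots> \<le> norm (L2_class (\<lambda>x. n * (\<bar>rep_L2 (f - f') x\<bar> + \<bar>rep_L2 (g - g') x\<bar>)))"
    proof (rule norm_L2_class_mono[OF square_integrable_diff[OF s s] square_integrable_scale[OF square_integrable_add[OF a a]]])
      show "AE x in lebesgue. \<bar>clip n (rep_L2 f x) * clip n (rep_L2 g x) - clip n (rep_L2 f' x) * clip n (rep_L2 g' x)\<bar>
          \<le> \<bar>n * (\<bar>rep_L2 (f - f') x\<bar> + \<bar>rep_L2 (g - g') x\<bar>)\<bar>"
        using rep_L2_diff[of f f'] rep_L2_diff[of g g']
      proof eventually_elim
        case (elim x)
        show ?case unfolding elim by (rule order_trans[OF clip_mult_Lipschitz[OF n] abs_ge_self])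
      qed
    qed
    also have "L2_class (\<lambda>x. n * (\<bar>rep_L2 (f - f') x\<bar> + \<bar>rep_L2 (g - g') x\<bar>)) = n *\<^sub>R (L2_class (\<lambda>x. \<bar>rep_L2 (f - f') x\<bar>) + L2_class (\<lambda>x. \<bar>rep_L2 (g - g') x\<bar>))"
      by (simp add: L2_class_scale[OF square_integrable_add[OF a a]] L2_class_add[OF a a])
    also have "norm \<dots> \<le> n * (norm (L2_class (\<lambda>x. \<bar>rep_L2 (f - f') x\<bar>)) + norm (L2_class (\<lambda>x. \<bar>rep_L2 (g - g') x\<bar>)))"
      using n by (simp add: mult_left_mono norm_triangle_ineq)
    also have "\<dots> \<le> n * (norm (f - f') + norm (g - g'))"
      using norm_L2_class_mono[OF a square_integrable_rep, of "f - f'" "f - f'"]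
        norm_L2_class_mono[OF a square_integrable_rep, of "g - g'" "g - g'"] n
      by (intro mult_left_mono add_mono) (auto simp: L2_class_rep)
    finally show ?thesis .
  qed
  show ?thesis
  proof (rule lipschitz_on_continuous_on, rule lipschitz_onI)
    show "0 \<le> 2 * n" using n by simp
    show "dist (clipped_mult_L2 n (fst x) (snd x)) (clipped_mult_L2 n (fst y) (snd y)) \<le> 2 * n * dist x y" for x y
    proof -
      have "norm (fst x - fst y) \<le> norm (x - y)" "norm (snd x - snd y) \<le> norm (x - y)"
        using dist_fst_le[of x y] dist_snd_le[of x y] by (simp_all add: dist_norm)
      then have "n * (norm (fst x - fst y) + norm (snd x - snd y)) \<le> n * (2 * norm (x - y))"
        using n by (intro mult_left_mono) auto
      then show ?thesis using lip[of "fst x" "snd x" "fst y" "snd y"] by (simp add: dist_norm)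
    qed
  qed
qed

lemma clipped_mult_L2_tendsto:
  assumes sq: "square_integrable (\<lambda>x. rep_L2 f x * rep_L2 g x)"
  shows "(\<lambda>n. clipped_mult_L2 (real n) f g) \<longlonglongrightarrow> mult_L2 f g"
  unfolding clipped_mult_L2_def mult_L2_def
proof (rule L2_class_dominated[OF square_integrable_clipped sq])
  show "square_integrable (\<lambda>x. 2 * \<bar>rep_L2 f x * rep_L2 g x\<bar>)"
    by (intro square_integrable_scale square_integrable_abs sq)
  show "AE x in lebesgue. \<bar>clip (real n) (rep_L2 f x) * clip (real n) (rep_L2 g x) - rep_L2 f x * rep_L2 g x\<bar>
      \<le> 2 * \<bar>rep_L2 f x * rep_L2 g x\<bar>" for n
  proof (rule AE_I2)
    fix x
    have "\<bar>clip (real n) (rep_L2 f x) * clip (real n) (rep_L2 g x)\<bar> \<le> \<bar>rep_L2 f x * rep_L2 g x\<bar>"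
      unfolding abs_mult by (intro mult_mono clip_bounds) auto
    then show "\<bar>clip (real n) (rep_L2 f x) * clip (real n) (rep_L2 g x) - rep_L2 f x * rep_L2 g x\<bar>
      \<le> 2 * \<bar>rep_L2 f x * rep_L2 g x\<bar>" by linarith
  qed
  show "AE x in lebesgue. (\<lambda>n. clip (real n) (rep_L2 f x) * clip (real n) (rep_L2 g x)) \<longlonglongrightarrow> rep_L2 f x * rep_L2 g x"
  proof (rule AE_I2)
    fix x
    have "(\<lambda>n. clip (real n) y) \<longlonglongrightarrow> y" for y
    proof (rule tendsto_eventually)
      obtain N where N: "\<bar>y\<bar> \<le> real N" using real_arch_simple by blast
      show "\<forall>\<^sub>F n in sequentially. clip (real n) y = y"
        using eventually_ge_at_top[of N]
      proof eventually_elim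
        case (elim n)
        then have "\<bar>y\<bar> \<le> real n" using N by (meson of_nat_le_iff order_trans)
        then show ?case by (simp add: clip_def abs_le_iff)
      qed
    qed
    then show "(\<lambda>n. clip (real n) (rep_L2 f x) * clip (real n) (rep_L2 g x)) \<longlonglongrightarrow> rep_L2 f x * rep_L2 g x"
      by (intro tendsto_mult)
  qed
qed simp

text \<open>An almost everywhere limit of continuous functions of \<open>(p, q)\<close>.\<close>

lemma mult_L2_measurable:
  fixes p q :: "real \<Rightarrow> L2"
  assumes A: "A \<in> sets lebesgue"
    and p: "p \<in> borel_measurable (lebesgue_on A)" and q: "q \<in> borel_measurable (lebesgue_on A)"
    and sq: "AE s in lebesgue_on A. square_integrable (\<lambda>x. rep_L2 (p s) x * rep_L2 (q s) x)"
  shows "(\<lambda>s. mult_L2 (p s) (q s)) \<in> borel_measurable (lebesgue_on A)"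
proof (rule borel_measurable_lebesgue_on_AE_cong[OF _ A])
  note [measurable] = p q
  have [measurable]: "(\<lambda>s. clipped_mult_L2 (real n) (p s) (q s)) \<in> borel_measurable (lebesgue_on A)" for n
  proof -
    have 1: "(\<lambda>z. clipped_mult_L2 (real n) (fst z) (snd z)) \<in> borel_measurable (borel \<Otimes>\<^sub>M borel)"
      unfolding borel_prod by (rule borel_measurable_continuous_onI[OF clipped_mult_L2_continuous]) simp
    have 2: "(\<lambda>s. (p s, q s)) \<in> lebesgue_on A \<rightarrow>\<^sub>M borel \<Otimes>\<^sub>M borel" by measurable
    show ?thesis using measurable_comp[OF 2 1] by (simp add: comp_def)
  qed
  show "(\<lambda>s. lim (\<lambda>n. clipped_mult_L2 (real n) (p s) (q s))) \<in> borel_measurable (lebesgue_on A)"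
    by measurable
  show "AE s in lebesgue_on A. mult_L2 (p s) (q s) = lim (\<lambda>n. clipped_mult_L2 (real n) (p s) (q s))"
    using sq by (rule eventually_mono) (rule limI[OF clipped_mult_L2_tendsto, symmetric])
qed

section \<open>Decay of the energy\<close>

text \<open>The hypothesis says that \<open>G = E + \<gamma> \<integral>E\<close> decreases. With \<open>I = \<integral>E\<close> one has
  \<open>(e\<^sup>\<gamma>\<^sup>t I)' = e\<^sup>\<gamma>\<^sup>t G \<ge> e\<^sup>\<gamma>\<^sup>t G T\<close>, hence a lower bound for \<open>I T\<close> and an upper bound for
  \<open>E T = G T - \<gamma> I T\<close>. The hypothesis is required on all subintervals: from \<open>a = 0\<close> alone no
  decay follows, because of the sign of the integral term.\<close>

lemma integral_Gronwall_decay: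
  fixes E :: "real \<Rightarrow> real"
  assumes cE: "continuous_on {0..T} E" and "0 \<le> T" and \<gamma>: "\<gamma> > 0"
    and dec: "\<And>a b. 0 \<le> a \<Longrightarrow> a \<le> b \<Longrightarrow> b \<le> T \<Longrightarrow> E b - E a \<le> - \<gamma> * integral {a..b} E"
  shows "E T \<le> E 0 * exp (- \<gamma> * T)"
proof -
  define I where "I t = integral {0..t} E" for t
  define G where "G t = E t + \<gamma> * I t" for t
  have G: "G b \<le> G a" if "0 \<le> a" "a \<le> b" "b \<le> T" for a b
  proof -
    have "E integrable_on {0..b}"
      by (rule integrable_continuous_real, rule continuous_on_subset[OF cE]) (use that in auto)
    then have "I b = I a + integral {a..b} E"
      unfolding I_def using that Henstock_Kurzweil_Integration.integral_combine[of 0 a b E] by simp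
    then show ?thesis using dec[OF that] by (simp add: G_def algebra_simps)
  qed
  define \<phi> where "\<phi> t = exp (\<gamma> * t) * I t - G T / \<gamma> * exp (\<gamma> * t)" for t
  have "\<phi> 0 \<le> \<phi> T"
  proof (rule DERIV_nonneg_imp_increasing_open[OF \<open>0 \<le> T\<close>])
    have "E integrable_on {0..T}" by (rule integrable_continuous_real[OF cE])
    then show "continuous_on {0..T} \<phi>"
      unfolding \<phi>_def I_def by (intro continuous_intros indefinite_integral_continuous_1)
    fix t assume t: "0 < t" "t < T"
    have "(I has_real_derivative E t) (at t within {0..T})"
      unfolding I_def[abs_def] by (rule integral_has_real_derivative[OF cE]) (use t in auto)
    then have I': "(I has_real_derivative E t) (at t)" by (simp only: at_within_Icc_at[OF t])
    have "(\<phi> has_real_derivative (exp (\<gamma> * t) * E t + \<gamma> * exp (\<gamma> * t) * I t - G T / \<gamma> * (\<gamma> * exp (\<gamma> * t)))) (at t)"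
      unfolding \<phi>_def[abs_def] by (auto intro!: derivative_eq_intros I')
    moreover have "exp (\<gamma> * t) * E t + \<gamma> * exp (\<gamma> * t) * I t - G T / \<gamma> * (\<gamma> * exp (\<gamma> * t)) = exp (\<gamma> * t) * (G t - G T)"
      using \<gamma> by (simp add: G_def field_simps)
    moreover have "0 \<le> exp (\<gamma> * t) * (G t - G T)" using G[of t T] t by simp
    ultimately show "\<exists>y. (\<phi> has_real_derivative y) (at t) \<and> 0 \<le> y" by metis
  qed
  then have "\<gamma> * \<phi> 0 \<le> \<gamma> * \<phi> T" using \<gamma> by (intro mult_left_mono) auto
  moreover have "\<gamma> * \<phi> 0 = - G T" "\<gamma> * \<phi> T = exp (\<gamma> * T) * (\<gamma> * I T) - exp (\<gamma> * T) * G T"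
    using \<gamma> by (simp_all add: \<phi>_def I_def[of 0] right_diff_distrib)
  moreover have "exp (\<gamma> * T) * G T = exp (\<gamma> * T) * E T + exp (\<gamma> * T) * (\<gamma> * I T)"
    by (simp add: G_def distrib_left)
  ultimately have "exp (\<gamma> * T) * E T \<le> G T" by linarith
  also have "\<dots> \<le> G 0" using G[of 0 T] \<open>0 \<le> T\<close> by simp
  also have "\<dots> = E 0" by (simp add: G_def I_def)
  finally show ?thesis by (simp add: exp_minus field_simps)
qed

text \<open>The quantity \<open>\<integral>|lam| u\<^sup>2\<close> at time \<open>s\<close>, written as a quadratic form so that it inherits
  continuity in time from \<open>u\<close>.\<close>

definition delay_weight :: "(real \<Rightarrow> real) \<Rightarrow> (real \<Rightarrow> L2) \<Rightarrow> real \<Rightarrow> real" where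
  "delay_weight lam u s = inner (mult_fun (\<lambda>x. \<bar>lam x\<bar>) (u s)) (u s)"

lemma energy_eq_delay_weight:
  assumes "L_infty lam"
  shows "energy \<tau> lam u t = 1 / 2 * (norm (u t))\<^sup>2
    + 1 / 2 * (LINT s|lebesgue_on {t - \<tau>..t}. exp (- (t - s)) * delay_weight lam u s)"
  unfolding energy_def norm_L2_rep delay_weight_def inner_mult_fun_abs(1)[OF assms]
  by (simp add: mult.assoc)

lemma initial_energy_eq:
  assumes "L_infty lam" "\<tau> > 0" and u: "\<And>s. s \<in> {-\<tau>..0} \<Longrightarrow> u s = u\<^sub>0 s"
  shows "energy \<tau> lam u 0 = initial_energy \<tau> lam u\<^sub>0"
proof -
  have "(LINT s|lebesgue_on {-\<tau>..0}. exp s * delay_weight lam u s)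
      = (LINT s|lebesgue_on {-\<tau>..0}. exp s * (LINT x|lebesgue. \<bar>lam x\<bar> * (rep_L2 (u\<^sub>0 s) x)\<^sup>2))"
    by (rule Bochner_Integration.integral_cong)
      (simp_all add: delay_weight_def inner_mult_fun_abs(1)[OF assms(1)] u)
  then show ?thesis
    using u[of 0] \<open>\<tau> > 0\<close> by (simp add: energy_eq_delay_weight[OF assms(1)] initial_energy_def)
qed

context
  fixes \<tau> \<gamma> :: real and lam lam\<^sub>0 :: "real \<Rightarrow> real" and S :: "real \<Rightarrow> L2 \<Rightarrow> L2" and u u\<^sub>0 :: "real \<Rightarrow> L2"
  assumes \<tau>: "\<tau> > 0" and lam: "L_infty lam" and \<gamma>: "0 < \<gamma>" "\<gamma> \<le> 1"
    and gen: "generates (kdvb_operator lam\<^sub>0) (sobolev 3) S"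
    and diss: "\<And>v. v \<in> sobolev 3 \<Longrightarrow> inner (kdvb_operator lam\<^sub>0 v) v
        + (exp \<tau> + 1) / 2 * inner (mult_fun (\<lambda>x. \<bar>lam x\<bar>) v) v \<le> - (\<gamma> / 2) * (norm v)\<^sup>2"
    and u0: "continuous_on {-\<tau>..0} u\<^sub>0" and sol: "global_mild_solution S \<tau> lam u\<^sub>0 u"
begin

lemma solution_history: "s \<in> {-\<tau>..0} \<Longrightarrow> u s = u\<^sub>0 s"
  and solution_B_space: "T > 0 \<Longrightarrow> u \<in> B_space T"
  and solution_mild: "0 \<le> t \<Longrightarrow> u t = S t (u\<^sub>0 0)
          - (LINT s|lebesgue_on {0..t}. S (t - s) (mult_fun lam (u (s - \<tau>))))
          - (LINT s|lebesgue_on {0..t}. S (t - s) (mult_L2 (u s) (weak_deriv 1 (u s))))"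
proof -
  have m: "mild_solution S \<tau> lam u\<^sub>0 T u" if "T > 0" for T
    using sol that by (simp add: global_mild_solution_def)
  show "s \<in> {-\<tau>..0} \<Longrightarrow> u s = u\<^sub>0 s" using m[of 1] by (simp add: mild_solution_def)
  show "T > 0 \<Longrightarrow> u \<in> B_space T" using m[of T] by (simp add: mild_solution_def)
  show "0 \<le> t \<Longrightarrow> u t = S t (u\<^sub>0 0)
          - (LINT s|lebesgue_on {0..t}. S (t - s) (mult_fun lam (u (s - \<tau>))))
          - (LINT s|lebesgue_on {0..t}. S (t - s) (mult_L2 (u s) (weak_deriv 1 (u s))))"
    using m[of "t + 1"] by (simp add: mild_solution_def)
qed

lemma solution_continuous: "continuous_on {-\<tau>..T} u"
proof (cases "T > 0")
  case True
  have "continuous_on {-\<tau>..0} u"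
    using u0 by (rule continuous_on_eq) (simp add: solution_history)
  moreover have "continuous_on {0..T} u" using solution_B_space[OF True] by (simp add: B_space_def)
  ultimately have "continuous_on ({-\<tau>..0} \<union> {0..T}) u" by (intro continuous_on_closed_Un) auto
  moreover have "{-\<tau>..0} \<union> {0..T} = {-\<tau>..T}" using \<tau> True by auto
  ultimately show ?thesis by simp
next
  case False
  have "continuous_on {-\<tau>..0} u"
    using u0 by (rule continuous_on_eq) (simp add: solution_history)
  then show ?thesis by (rule continuous_on_subset) (use False in auto)
qed

lemma delay_weight_continuous: "continuous_on {-\<tau>..T} (delay_weight lam u)"
  unfolding delay_weight_def[abs_def]
  by (intro continuous_on_inner bounded_linear.continuous_on[OF bounded_linear_mult_fun[OF L_infty_abs[OF lam]]] solution_continuous)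

lemma forward_continuity:
  assumes "0 \<le> a"
  shows "continuous_on {a..b} (delay_weight lam u)"
    and "continuous_on {a..b} (\<lambda>s. delay_weight lam u (s - \<tau>))"
    and "continuous_on {a..b} u"
proof -
  note c = delay_weight_continuous[of b] solution_continuous[of b]
  show "continuous_on {a..b} (delay_weight lam u)" "continuous_on {a..b} u"
    using \<tau> assms by (auto intro: continuous_on_subset[OF c(1)] continuous_on_subset[OF c(2)])
  show "continuous_on {a..b} (\<lambda>s. delay_weight lam u (s - \<tau>))"
    by (rule continuous_on_compose2[OF c(1)]) (use \<tau> assms in \<open>auto intro!: continuous_intros\<close>)
qed

lemma delay_weight_nonneg: "0 \<le> delay_weight lam u s"
  unfolding delay_weight_def by (rule inner_mult_fun_abs_nonneg[OF lam])

lemma semigroup_contraction: "0 \<le> t \<Longrightarrow> norm (S t f) \<le> norm f"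
proof (rule dissipative_imp_contraction[OF gen])
  show "inner (kdvb_operator lam\<^sub>0 v) v \<le> 0" if "v \<in> sobolev 3" for v
  proof -
    have "0 \<le> (exp \<tau> + 1) / 2 * inner (mult_fun (\<lambda>x. \<bar>lam x\<bar>) v) v"
      using inner_mult_fun_abs_nonneg[OF lam, of v] by (intro mult_nonneg_nonneg) (auto intro: add_nonneg_nonneg)
    moreover have "- (\<gamma> / 2) * (norm v)\<^sup>2 \<le> 0" using \<gamma> by simp
    ultimately show ?thesis using diss[OF that] by linarith
  qed
qed

lemma solution_weak_deriv: "T > 0 \<Longrightarrow> AE s in lebesgue_on {0..T}. has_weak_deriv 1 (u s) (weak_deriv 1 (u s))"
  using solution_B_space[of T] by (auto simp: B_space_def elim!: eventually_mono intro: has_weak_deriv_weak_deriv)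

lemma burgers_term_integrable:
  assumes T: "T > 0"
  shows "integrable (lebesgue_on {0..T}) (\<lambda>s. mult_L2 (u s) (weak_deriv 1 (u s)))"
proof (rule Bochner_Integration.integrable_bound)
  note B = solution_B_space[OF T]
  show "integrable (lebesgue_on {0..T}) (\<lambda>t. (norm (u t))\<^sup>2 + (norm (weak_deriv 1 (u t)))\<^sup>2)"
    using B by (simp add: B_space_def)
  show "(\<lambda>s. mult_L2 (u s) (weak_deriv 1 (u s))) \<in> borel_measurable (lebesgue_on {0..T})"
  proof (rule mult_L2_measurable)
    show "u \<in> borel_measurable (lebesgue_on {0..T})"
      using B by (intro continuous_imp_measurable_on_sets_lebesgue) (auto simp: B_space_def)
    show "(\<lambda>t. weak_deriv 1 (u t)) \<in> borel_measurable (lebesgue_on {0..T})"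
      using B by (simp add: B_space_def)
    show "AE s in lebesgue_on {0..T}. square_integrable (\<lambda>x. rep_L2 (u s) x * rep_L2 (weak_deriv 1 (u s)) x)"
      using solution_weak_deriv[OF T] by (rule eventually_mono) (rule H1_burgers_term(1))
  qed simp
  show "AE s in lebesgue_on {0..T}. norm (mult_L2 (u s) (weak_deriv 1 (u s)))
      \<le> norm ((norm (u s))\<^sup>2 + (norm (weak_deriv 1 (u s)))\<^sup>2)"
    using solution_weak_deriv[OF T] by (rule eventually_mono) (use H1_burgers_term(2) in force)
qed

lemma delay_term_continuous: "continuous_on {0..T} (\<lambda>s. mult_fun lam (u (s - \<tau>)))"
proof (rule bounded_linear.continuous_on[OF bounded_linear_mult_fun[OF lam]])
  show "continuous_on {0..T} (\<lambda>s. u (s - \<tau>))"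
    by (rule continuous_on_compose2[OF solution_continuous[of T]]) (use \<tau> in \<open>auto intro!: continuous_intros\<close>)
qed

lemma delay_term_integrable: "integrable (lebesgue_on {0..T}) (\<lambda>s. mult_fun lam (u (s - \<tau>)))"
  by (rule continuous_imp_Bochner_integrable[OF delay_term_continuous])

text \<open>The abstract energy inequality with the delay and Burgers terms as forcing. The Burgers term does no
  work. The delay term \<open>\<langle>lam u(s - \<tau>), u(s)\<rangle>\<close> is split by Young with weight \<open>e\<^sup>-\<^sup>\<tau>\<close>, which matches
  the weight that the energy puts on the oldest history. Coercivity with constant
  \<open>(e\<^sup>\<tau> + 1)/2\<close> absorbs the current part \<open>e\<^sup>\<tau>/2\<close> and leaves \<open>-1/2\<close> over to cancel the inflow into
  the history energy.\<close>

lemma L2_norm_inequality: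
  assumes ab: "0 \<le> a" "a \<le> b"
  shows "(norm (u b))\<^sup>2 - (norm (u a))\<^sup>2 \<le> 2 * integral {a..b}
      (\<lambda>s. - (\<gamma> / 2) * (norm (u s))\<^sup>2 - 1 / 2 * delay_weight lam u s + exp (- \<tau>) / 2 * delay_weight lam u (s - \<tau>))"
proof -
  \<comment> \<open>a positive horizon is required even if \<open>b = 0\<close>\<close>
  define T where "T = b + 1"
  have T: "T > 0" "b \<le> T" using ab by (auto simp: T_def)
  define f where "f s = - (mult_fun lam (u (s - \<tau>))) - mult_L2 (u s) (weak_deriv 1 (u s))" for s
  \<comment> \<open>chosen so that the coercivity bound reads \<open>\<langle>A v, v\<rangle> \<le> - \<langle>L v, v\<rangle>\<close>\<close>
  define L where "L v = ((exp \<tau> + 1) / 2) *\<^sub>R mult_fun (\<lambda>x. \<bar>lam x\<bar>) v + (\<gamma> / 2) *\<^sub>R v" for v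
  define \<psi> where "\<psi> s = - (\<gamma> / 2) * (norm (u s))\<^sup>2 - 1 / 2 * delay_weight lam u s + exp (- \<tau>) / 2 * delay_weight lam u (s - \<tau>)" for s
  have C0: "C0_semigroup S" using gen by (simp add: generates_def)
  have L: "bounded_linear L"
    unfolding L_def by (intro bounded_linear_intros bounded_linear_mult_fun L_infty_abs lam)
  have f: "integrable (lebesgue_on {0..T}) f"
    unfolding f_def by (intro Bochner_Integration.integrable_diff Bochner_Integration.integrable_minus burgers_term_integrable delay_term_integrable T)
  have mild: "u t = S t (u\<^sub>0 0) + (LINT s|lebesgue_on {0..t}. S (t - s) (f s))" if t: "t \<in> {0..T}" for t
  proof -
    have i1: "integrable (lebesgue_on {0..t}) (\<lambda>s. S (t - s) (mult_fun lam (u (s - \<tau>))))"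
      by (rule convolution_integrable[OF C0 semigroup_contraction delay_term_integrable])
    have i2: "integrable (lebesgue_on {0..t}) (\<lambda>s. S (t - s) (mult_L2 (u s) (weak_deriv 1 (u s))))"
      by (rule convolution_integrable[OF C0 semigroup_contraction integrable_subinterval_lebesgue_on[OF burgers_term_integrable[OF T(1)]]])
        (use t in auto)
    have "(LINT s|lebesgue_on {0..t}. S (t - s) (f s)) = (LINT s|lebesgue_on {0..t}. - S (t - s) (mult_fun lam (u (s - \<tau>))) - S (t - s) (mult_L2 (u s) (weak_deriv 1 (u s))))"
      by (rule Bochner_Integration.integral_cong)
        (simp_all add: f_def semigroup_diff[OF C0] linear_neg[OF bounded_linear.linear[OF semigroup_linear[OF C0]]])
    also have "\<dots> = - (LINT s|lebesgue_on {0..t}. S (t - s) (mult_fun lam (u (s - \<tau>)))) - (LINT s|lebesgue_on {0..t}. S (t - s) (mult_L2 (u s) (weak_deriv 1 (u s))))"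
      using i1 i2 by simp
    finally show ?thesis using solution_mild[of t] t by simp
  qed
  have cu: "continuous_on {0..T} u" by (rule forward_continuity(3)) simp
  have c\<psi>: "continuous_on {a..b} \<psi>"
    unfolding \<psi>_def by (intro continuous_intros forward_continuity ab)
  have i\<psi>: "integrable (lebesgue_on {a..b}) \<psi>" by (rule continuous_imp_integrable_real[OF c\<psi>])
  have "inner (kdvb_operator lam\<^sub>0 v) v \<le> - inner (L v) v" if "v \<in> sobolev 3" for v
    using diss[OF that] by (simp add: L_def inner_add_left power2_norm_eq_inner)
  note energy = mild_energy_inequality[OF C0 semigroup_contraction f mild cu gen L this ab T(2)]
  note energy(2)
  also have "(LINT s|lebesgue_on {a..b}. inner (f s - L (u s)) (u s)) \<le> (LINT s|lebesgue_on {a..b}. \<psi> s)"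
  proof (rule integral_mono_AE)
    show "integrable (lebesgue_on {a..b}) (\<lambda>s. inner (f s - L (u s)) (u s))" by (rule energy(1))
    show "integrable (lebesgue_on {a..b}) \<psi>" by (rule i\<psi>)
    have "AE s in lebesgue_on {0..T}. inner (f s - L (u s)) (u s) \<le> \<psi> s"
      using solution_weak_deriv[OF T(1)]
    proof (rule eventually_mono)
      fix s assume "has_weak_deriv 1 (u s) (weak_deriv 1 (u s))"
      then have "inner (f s) (u s) = - inner (mult_fun lam (u (s - \<tau>))) (u s)"
        using H1_burgers_term(3) by (simp add: f_def inner_diff_left)
      also have "\<dots> \<le> \<bar>inner (mult_fun lam (u (s - \<tau>))) (u s)\<bar>" by linarith
      also have "\<dots> \<le> exp (- \<tau>) / 2 * delay_weight lam u (s - \<tau>) + 1 / (2 * exp (- \<tau>)) * delay_weight lam u s"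
        unfolding delay_weight_def by (rule inner_mult_fun_weighted_Young[OF lam]) simp
      also have "1 / (2 * exp (- \<tau>)) = exp \<tau> / 2" by (simp add: exp_minus inverse_eq_divide)
      finally have "inner (f s) (u s) \<le> exp (- \<tau>) / 2 * delay_weight lam u (s - \<tau>) + exp \<tau> / 2 * delay_weight lam u s" .
      moreover have "inner (L (u s)) (u s) = (exp \<tau> + 1) / 2 * delay_weight lam u s + \<gamma> / 2 * (norm (u s))\<^sup>2"
        by (simp add: L_def inner_add_left delay_weight_def power2_norm_eq_inner)
      ultimately show "inner (f s - L (u s)) (u s) \<le> \<psi> s"
        by (simp add: inner_diff_left \<psi>_def field_simps)
    qed
    then have "AE s in lebesgue. s \<in> {0..T} \<longrightarrow> inner (f s - L (u s)) (u s) \<le> \<psi> s"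
      by (subst (asm) AE_restrict_space_iff) auto
    then have "AE s in lebesgue. s \<in> {a..b} \<longrightarrow> inner (f s - L (u s)) (u s) \<le> \<psi> s"
      by (rule eventually_mono) (use ab T in auto)
    then show "AE s in lebesgue_on {a..b}. inner (f s - L (u s)) (u s) \<le> \<psi> s"
      by (subst AE_restrict_space_iff) auto
  qed
  also have "(LINT s|lebesgue_on {a..b}. \<psi> s) = integral {a..b} \<psi>"
    by (rule lebesgue_integral_eq_integral[OF i\<psi>]) simp
  finally show ?thesis unfolding \<psi>_def by simp
qed

text \<open>The history part of the energy is \<open>e\<^sup>-\<^sup>t/2\<close> times the integral of \<open>e\<^sup>s \<integral>|lam| u\<^sup>2\<close> over the sliding
  window \<open>[t - \<tau>, t]\<close>, hence differentiable: inflow at \<open>t\<close>, discounted outflow at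
  \<open>t - \<tau>\<close>, and decay at rate one from the prefactor.\<close>

lemma history_energy:
  obtains H where "\<And>t. 0 \<le> t \<Longrightarrow> energy \<tau> lam u t = 1 / 2 * (norm (u t))\<^sup>2 + H t"
    and "\<And>t. 0 \<le> t \<Longrightarrow> 0 \<le> H t"
    and "\<And>t. 0 \<le> t \<Longrightarrow> (H has_real_derivative
        1 / 2 * delay_weight lam u t - exp (- \<tau>) / 2 * delay_weight lam u (t - \<tau>) - H t) (at t)"
proof -
  \<comment> \<open>continued constantly before the history starts, so that \<open>g\<close> is continuous on the whole line\<close>
  define g where "g s = exp s * delay_weight lam u (max (- \<tau>) s)" for s
  have cg: "continuous_on UNIV g"
  proof -
    have "continuous_on UNIV (\<lambda>s. delay_weight lam u (max (- \<tau>) s))"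
    proof -
      have "isCont (\<lambda>s. delay_weight lam u (max (- \<tau>) s)) x" for x
      proof -
        have "continuous_on {x - 1..x + 1} (\<lambda>s. delay_weight lam u (max (- \<tau>) s))"
          by (rule continuous_on_compose2[OF delay_weight_continuous[of "max (- \<tau>) (x + 1)"]])
            (auto intro!: continuous_intros)
        then show ?thesis by (rule continuous_on_interior) simp
      qed
      then show ?thesis by (simp add: continuous_at_imp_continuous_on)
    qed
    then show ?thesis unfolding g_def by (intro continuous_intros)
  qed
  have "integrable (lebesgue_on {a..b}) g" for a b
    by (rule continuous_imp_integrable_real, rule continuous_on_subset[OF cg]) simp
  then obtain W where W: "primitive_of W g" using primitive_of_exists by blast
  define H where "H t = 1 / 2 * (exp (- t) * (W t - W (t - \<tau>)))" for t
  have HI: "H t = 1 / 2 * (LINT s|lebesgue_on {t - \<tau>..t}. exp (- (t - s)) * delay_weight lam u s)" if "0 \<le> t" for t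
  proof -
    have "(LINT s|lebesgue_on {t - \<tau>..t}. exp (- (t - s)) * delay_weight lam u s) = (LINT s|lebesgue_on {t - \<tau>..t}. exp (- t) * g s)"
      by (rule Bochner_Integration.integral_cong)
        (use that in \<open>auto simp: g_def max_def exp_diff exp_minus field_simps\<close>)
    also have "\<dots> = exp (- t) * (W t - W (t - \<tau>))"
      using primitive_ofD(2)[OF W, of "t - \<tau>" t] \<tau> by simp
    finally show ?thesis by (simp add: H_def)
  qed
  show ?thesis
  proof (rule that[of H])
    fix t :: real assume t: "0 \<le> t"
    show "energy \<tau> lam u t = 1 / 2 * (norm (u t))\<^sup>2 + H t"
      unfolding energy_eq_delay_weight[OF lam] HI[OF t] ..
    show "0 \<le> H t" unfolding HI[OF t]
      using Bochner_Integration.integral_nonneg[of "lebesgue_on {t - \<tau>..t}" "\<lambda>s. exp (- (t - s)) * delay_weight lam u s"] delay_weight_nonneg by simp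
    have W1: "(W has_real_derivative g t) (at t)" by (rule primitive_of_deriv[OF W cg])
    have W2: "((\<lambda>t. W (t - \<tau>)) has_real_derivative g (t - \<tau>)) (at t)"
    proof -
      have "((\<lambda>t. t - \<tau>) has_real_derivative 1) (at t)" by (auto intro!: derivative_eq_intros)
      from DERIV_chain2[OF primitive_of_deriv[OF W cg, of "t - \<tau>"] this] show ?thesis by simp
    qed
    have E: "((\<lambda>t. exp (- t)) has_real_derivative - exp (- t)) (at t)" by (auto intro!: derivative_eq_intros)
    have "(H has_real_derivative 1 / 2 * (- exp (- t) * (W t - W (t - \<tau>)) + (g t - g (t - \<tau>)) * exp (- t))) (at t)"
      unfolding H_def[abs_def] by (intro DERIV_cmult DERIV_mult E DERIV_diff W1 W2)
    moreover have "1 / 2 * (- exp (- t) * (W t - W (t - \<tau>)) + (g t - g (t - \<tau>)) * exp (- t))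
        = 1 / 2 * delay_weight lam u t - exp (- \<tau>) / 2 * delay_weight lam u (t - \<tau>) - H t"
    proof -
      have 1: "g t * exp (- t) = delay_weight lam u t" using t \<tau> by (simp add: g_def max_def exp_minus)
      have 2: "g (t - \<tau>) * exp (- t) = exp (- \<tau>) * delay_weight lam u (t - \<tau>)"
        using t by (simp add: g_def max_def exp_minus exp_diff field_simps)
      show ?thesis unfolding left_diff_distrib 1 2 H_def by (simp add: field_simps)
    qed
    ultimately show "(H has_real_derivative 1 / 2 * delay_weight lam u t - exp (- \<tau>) / 2 * delay_weight lam u (t - \<tau>) - H t) (at t)" by (simp only:)
  qed
qed

text \<open>Adding the two balances, the delay terms cancel. What is left is \<open>-(\<gamma>/2) \<parallel>u\<parallel>\<^sup>2\<close> minus the history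
  energy, which is at most \<open>-\<gamma>\<close> times the energy since \<open>\<gamma> \<le> 1\<close>.\<close>

theorem energy_decay:
  assumes T: "0 \<le> T"
  shows "energy \<tau> lam u T \<le> energy \<tau> lam u 0 * exp (- \<gamma> * T)"
proof -
  obtain H where EH: "\<And>t. 0 \<le> t \<Longrightarrow> energy \<tau> lam u t = 1 / 2 * (norm (u t))\<^sup>2 + H t"
    and H0: "\<And>t. 0 \<le> t \<Longrightarrow> 0 \<le> H t"
    and Hd: "\<And>t. 0 \<le> t \<Longrightarrow> (H has_real_derivative
        1 / 2 * delay_weight lam u t - exp (- \<tau>) / 2 * delay_weight lam u (t - \<tau>) - H t) (at t)"
    using history_energy by metis
  define E where "E t = 1 / 2 * (norm (u t))\<^sup>2 + H t" for t
  have cH: "continuous_on {a..b} H" if "0 \<le> a" for a b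
    by (rule DERIV_continuous_on, rule DERIV_subset[OF Hd]) (use that in auto)
  have cE: "continuous_on {a..b} E" if "0 \<le> a" for a b
    unfolding E_def by (intro continuous_intros forward_continuity(3) cH that)
  have "E T \<le> E 0 * exp (- \<gamma> * T)"
  proof (rule integral_Gronwall_decay[OF cE T \<gamma>(1)])
    fix a b assume ab: "0 \<le> a" "a \<le> b" "b \<le> T"
    define \<psi> where "\<psi> s = - (\<gamma> / 2) * (norm (u s))\<^sup>2 - 1 / 2 * delay_weight lam u s + exp (- \<tau>) / 2 * delay_weight lam u (s - \<tau>)" for s
    define \<eta> where "\<eta> s = 1 / 2 * delay_weight lam u s - exp (- \<tau>) / 2 * delay_weight lam u (s - \<tau>) - H s" for s
    have i\<psi>: "\<psi> integrable_on {a..b}" unfolding \<psi>_def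
      by (intro integrable_continuous_real continuous_intros forward_continuity ab)
    have i\<eta>: "\<eta> integrable_on {a..b}" unfolding \<eta>_def
      by (intro integrable_continuous_real continuous_intros forward_continuity cH ab)
    have iE: "E integrable_on {a..b}" by (intro integrable_continuous_real cE ab)
    have "(\<eta> has_integral (H b - H a)) {a..b}"
    proof (rule fundamental_theorem_of_calculus[OF ab(2)])
      fix t assume "t \<in> {a..b}"
      then have "(H has_real_derivative \<eta> t) (at t within {a..b})"
        unfolding \<eta>_def using ab by (intro DERIV_subset[OF Hd]) auto
      then show "(H has_vector_derivative \<eta> t) (at t within {a..b})"
        by (simp add: has_real_derivative_iff_has_vector_derivative)
    qed
    then have "H b - H a = integral {a..b} \<eta>" by (simp add: integral_unique)
    moreover have "(norm (u b))\<^sup>2 - (norm (u a))\<^sup>2 \<le> 2 * integral {a..b} \<psi>"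
      unfolding \<psi>_def by (rule L2_norm_inequality[OF ab(1,2)])
    ultimately have "E b - E a \<le> integral {a..b} \<psi> + integral {a..b} \<eta>" by (simp add: E_def)
    also have "\<dots> = integral {a..b} (\<lambda>s. \<psi> s + \<eta> s)"
      by (rule Henstock_Kurzweil_Integration.integral_add[symmetric, OF i\<psi> i\<eta>])
    also have "\<dots> \<le> integral {a..b} (\<lambda>s. - \<gamma> * E s)"
    proof (rule integral_le)
      show "(\<lambda>s. \<psi> s + \<eta> s) integrable_on {a..b}" by (rule Henstock_Kurzweil_Integration.integrable_add[OF i\<psi> i\<eta>])
      show "(\<lambda>s. - \<gamma> * E s) integrable_on {a..b}" by (intro integrable_continuous_real continuous_intros cE ab)
      show "\<psi> s + \<eta> s \<le> - \<gamma> * E s" if "s \<in> {a..b}" for s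
      proof -
        have "\<gamma> * H s \<le> 1 * H s" using H0[of s] that ab \<gamma> by (intro mult_right_mono) auto
        then show ?thesis by (simp add: \<psi>_def \<eta>_def E_def algebra_simps)
      qed
    qed
    also have "\<dots> = - \<gamma> * integral {a..b} E" by simp
    finally show "E b - E a \<le> - \<gamma> * integral {a..b} E" .
  qed simp
  then show ?thesis using EH[OF T] EH[of 0] by (simp add: E_def)
qed

end

theorem theorem3p6:
  fixes \<tau> \<alpha>\<^sub>0 \<alpha> p :: real
    and lam\<^sub>0 lam \<beta> :: "real \<Rightarrow> real"
    and S :: "real \<Rightarrow> L2 \<Rightarrow> L2"
  assumes "\<tau> > 0"
    and "L_infty lam\<^sub>0" and "L_infty lam"
    and "\<alpha>\<^sub>0 > 0" and "AE x in lebesgue. lam\<^sub>0 x \<ge> \<alpha>\<^sub>0"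
    and "1 \<le> p" and "L_p p \<beta>"
    and "AE x in lebesgue. (exp \<tau> + 1) / 2 * \<bar>lam x\<bar> \<le> \<alpha> + \<beta> x"
    and "0 \<le> \<alpha>" and "\<alpha> < \<alpha>\<^sub>0"
    and "L_p_norm p \<beta> < ((\<alpha>\<^sub>0 - \<alpha>) / c_const p) powr (1 - 1 / (2 * p))"
    and "generates (kdvb_operator lam\<^sub>0) (sobolev 3) S"
  shows "exponentially_stable S \<tau> lam \<and>
    decay_rate \<alpha>\<^sub>0 \<alpha> p \<beta> > 0 \<and>
    (\<forall>u\<^sub>0 u. continuous_on {-\<tau>..0} u\<^sub>0 \<longrightarrow> global_mild_solution S \<tau> lam u\<^sub>0 u \<longrightarrow>
       energy \<tau> lam u 0 = initial_energy \<tau> lam u\<^sub>0 \<and>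
       (\<forall>t\<ge>0. energy \<tau> lam u t \<le> initial_energy \<tau> lam u\<^sub>0 * exp (- decay_rate \<alpha>\<^sub>0 \<alpha> p \<beta> * t)))"
proof -
  define \<gamma> where "\<gamma> = decay_rate \<alpha>\<^sub>0 \<alpha> p \<beta>"
  have \<gamma>0: "\<gamma> > 0" unfolding \<gamma>_def by (rule decay_rate_pos[OF assms(6) assms(10) assms(11)])
  have \<gamma>1: "\<gamma> \<le> 1" by (simp add: \<gamma>_def decay_rate_def)
  have diss: "inner (kdvb_operator lam\<^sub>0 v) v + (exp \<tau> + 1) / 2 * inner (mult_fun (\<lambda>x. \<bar>lam x\<bar>) v) v
      \<le> - (\<gamma> / 2) * (norm v)\<^sup>2" if "v \<in> sobolev 3" for v
    unfolding \<gamma>_def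
    by (rule kdvb_operator_dissipative[OF assms(2,3,5,6,7) _ assms(8) that]) (simp add: add_nonneg_nonneg)
  have main: "energy \<tau> lam u 0 = initial_energy \<tau> lam u\<^sub>0 \<and>
      (\<forall>t\<ge>0. energy \<tau> lam u t \<le> initial_energy \<tau> lam u\<^sub>0 * exp (- \<gamma> * t))"
    if u0: "continuous_on {-\<tau>..0} u\<^sub>0" and sol: "global_mild_solution S \<tau> lam u\<^sub>0 u" for u\<^sub>0 u
  proof -
    have "energy \<tau> lam u 0 = initial_energy \<tau> lam u\<^sub>0"
      by (rule initial_energy_eq[OF assms(3,1)
            solution_history[OF assms(1,3) \<gamma>0 \<gamma>1 assms(12) diss u0 sol]])
    then show ?thesis
      using energy_decay[OF assms(1,3) \<gamma>0 \<gamma>1 assms(12) diss u0 sol] by simp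
  qed
  moreover have "exponentially_stable S \<tau> lam"
    unfolding exponentially_stable_def using \<gamma>0 main by blast
  ultimately show ?thesis using \<gamma>0 unfolding \<gamma>_def by blast
qed

end
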